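(* In the setting described in the context, let $Z^1=(X^1,Y^1,N^1)$ and $Z^2=(X^2,Y^2,N^2)$ be the strong solutions, with two different initial conditions, of the system (driven by one and the same Poisson random measure $\wp$) $$X_t=X_0+\int_{0+}^t\int_{\mathbb{R}}h_\Lambda(X_{u-},Y_{u-},N_{u-},v)\,\wp(du,dv),$$ $$Y_t=Y_0+t-\int_{0+}^t (Y_{u-})\int_{\mathbb{R}}g_\Lambda(X_{u-},Y_{u-},N_{u-},v)\,\wp(du,dv),$$ $$N_t=\int_{0+}^t\int_{\mathbb{R}}g_\Lambda(X_{u-},Y_{u-},N_{u-},v)\,\wp(du,dv),\qquad t\ge0.$$ Under (A3), the infinitesimal generator $\mathcal{A}$ of the augmented process $Z=(Z^1,Z^2)$ is given by $$\begin{aligned}\mathcal{A}\varphi(z_1,z_2):={}&\Big(\frac{\partial}{\partial y_1}+\frac{\partial}{\partial y_2}\Big)\varphi(z_1,z_2)+\int_{\mathbb{R}_+}\big[\varphi(z_1+J(z_1,v),z_2+J(z_2,v))-\varphi(z_1,z_2)\big]dv\\={}&\Big(\frac{\partial}{\partial y_1}+\frac{\partial}{\partial y_2}\Big)\varphi(z_1,z_2)\\&+\sum_{j\in\mathcal{X}\setminus\{i_1\}}\big(\lambda_{i_1j}(y_1,n_1)-\delta_{i_1i_2}\lambda_{i_2j}(y_2,n_2)\big)^+[\varphi(j,0,n_1+1,z_2)-\varphi(z_1,z_2)]\\&+\sum_{j\in\mathcal{X}\setminus\{i_2\}}\big(\lambda_{i_2j}(y_2,n_2)-\delta_{i_1i_2}\lambda_{i_1j}(y_1,n_1)\big)^+[\varphi(z_1,j,0,n_2+1)-\varphi(z_1,z_2)]\\&+\delta_{i_1i_2}\sum_{j\in\mathcal{X}\setminus\{i_1,i_2\}}\big(\lambda_{i_1j}(y_1,n_1)\wedge\lambda_{i_2j}(y_2,n_2)\big)[\varphi(j,0,n_1+1,j,0,n_2+1)-\varphi(z_1,z_2)],\end{aligned}$$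 where $\varphi:(\mathcal{X}\times\mathbb{R}_+\times\mathbb{N}_0)^2\to\mathbb{R}$ is bounded and continuously differentiable in its continuous variables, $z_1=(i_1,y_1,n_1)$, $z_2=(i_2,y_2,n_2)$, $\delta_{ij}$ is the Kronecker delta, $a^+=\max(0,a)$ and $a\wedge b=\min(a,b)$.
   Context: $(\Omega,\mathcal{F},\{\mathcal{F}_t\}_{t\ge0},P)$ is a filtered probability space satisfying the usual hypothesis; $\mathcal{X}=\{1,2,\dots\}$ is the state space, embedded in $\mathbb{R}$; $\mathbb{N}_0=\{0,1,2,\dots\}$, $\mathbb{R}_+=[0,\infty)$; $m_d$ is Lebesgue measure on $\mathbb{R}^d$. $\mathcal{X}$ is endowed with a total order $\prec_1$, which induces a total order $\prec_2$ on $\mathcal{X}_2:=\{(i,j)\in\mathcal{X}^2: i\ne j\}$ by the lexicographic order. For each $(i,j)\in\mathcal{X}_2$, $\lambda_{ij}:\mathbb{R}_+\times\mathbb{N}_0\to\mathbb{R}_+$ is a bounded measurable function; $\lambda_i(y,n):=\sum_{j\in\mathcal{X}\setminus\{i\}}\lambda_{ij}(y,n)$. These satisfy: (A1) with $c_i:=\sum_{j\in\mathcal{X}\setminus\{i\}}\|\lambda_{ij}\|_{L^\infty(\mathbb{R}_+\times\mathbb{N}_0)}$, one has $c:=\sup_i c_i<\infty$; (A2) for each $n\in\mathbb{N}_0$ and $i\in\mathcal{X}$, $\lim_{y\to\infty}\gamma_i(y,n)=\infty$, where $\gamma_i(y,n):=\int_0^y\lambda_i(y',n)\,dy'$. For $(i,j)\in\mathcal{X}_2$,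 $\tilde\lambda_{ij}:\mathbb{R}_+\times\mathbb{N}_0\to\mathbb{R}_+$ is the measurable function fixed by (A3) for all $y\in\mathbb{R}_+$, $n\in\mathbb{N}_0$ and $(i,j)\in\mathcal{X}_2$, $\tilde\lambda_{ij}(y,n)=\max\big(\|\lambda_{ij}\|_{L^\infty(\mathbb{R}_+\times\mathbb{N}_0)},\lambda_{ij}(y,n)\big)$. For each $y,n$ a disjoint collection of intervals is defined by $$\Lambda_{ij}(y,n)=\Big(\sum_{(i',j')\prec_2(i,j)}\tilde\lambda_{i'j'}(y,n)\Big)+[0,\lambda_{ij}(y,n)),\qquad (i,j)\in\mathcal{X}_2,$$ where $a+B=\{a+b: b\in B\}$. The functions $h_\Lambda,g_\Lambda:\mathcal{X}\times\mathbb{R}_+\times\mathbb{N}_0\times\mathbb{R}\to\mathbb{R}$ are $$h_\Lambda(i,y,n,v):=\sum_{j\in\mathcal{X}\setminus\{i\}}(j-i)\mathbf{1}_{\Lambda_{ij}(y,n)}(v),\qquad g_\Lambda(i,y,n,v):=\sum_{j\in\mathcal{X}\setminus\{i\}}\mathbf{1}_{\Lambda_{ij}(y,n)}(v),$$ and for $z=(i,y,n)$, $J(z,v):=(h_\Lambda(z,v),\,-y\,g_\Lambda(z,v),\,g_\Lambda(z,v))$. $\wp(du,dv)$ is a Poisson random measure on $\mathbb{R}_+\times\mathbb{R}$ with intensity $m_2(du,dv)$, defined on $(\Omega,\mathcal{F},P)$, and $\{\wp((0,t]\times dv)\}_{t\ge0}$ is adapted to $\{\mathcal{F}_t\}_{t\ge0}$.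 Initial values satisfy $X_0\in\mathcal{X}$, $Y_0\in\mathbb{R}_+$, $N_0=0$. $\int_{0+}^t$ denotes integration over $(0,t]$.
   Formalization: The generator is proved in the martingale-problem sense; the equality of the two expressions and the derivative of Eφ(Z_t) at t=0 hold for y1,y2 off a Lebesgue-null set; ℘ on (s,∞)×ℝ is also assumed independent of F_s, and the left end points of Λ_ij are assumed finite. *)

theory Defs
  imports "HOL-Probability.Probability"
begin

section \<open>Filtrations, martingales, Poisson random measures\<close>

definition usual_filtration :: "'w measure \<Rightarrow> (real \<Rightarrow> 'w measure) \<Rightarrow> bool" where
  "usual_filtration M F \<longleftrightarrow>
     (\<forall>t\<ge>0. subalgebra M (F t)) \<and>
     (\<forall>s t. 0 \<le> s \<longrightarrow> s \<le> t \<longrightarrow> sets (F s) \<subseteq> sets (F t)) \<and>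
     (\<forall>t\<ge>0. sets (F t) = (\<Inter>s\<in>{t<..}. sets (F s))) \<and>
     complete_measure M \<and> null_sets M \<subseteq> sets (F 0)"

definition martingale :: "'w measure \<Rightarrow> (real \<Rightarrow> 'w measure) \<Rightarrow> (real \<Rightarrow> 'w \<Rightarrow> real) \<Rightarrow> bool" where
  "martingale M F V \<longleftrightarrow>
     (\<forall>t\<ge>0. V t \<in> borel_measurable (F t) \<and> integrable M (V t)) \<and>
     (\<forall>s t. 0 \<le> s \<longrightarrow> s \<le> t \<longrightarrow> (AE w in M. real_cond_exp M (F s) (V t) w = V s w))"

text \<open>A Poisson random measure with intensity \<open>N\<close>: an integer-valued random measure \<open>w \<mapsto> P w\<close>
  such that \<open>P(B)\<close> is Poisson distributed with parameter \<open>N(B)\<close> (a.s. infinite if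
  \<open>N(B) = \<infinity>\<close>), and values on disjoint sets are independent.\<close>

definition poisson_random_measure ::
    "'w measure \<Rightarrow> 'b measure \<Rightarrow> ('w \<Rightarrow> 'b measure) \<Rightarrow> bool" where
  "poisson_random_measure M N P \<longleftrightarrow>
     (\<forall>w\<in>space M. sets (P w) = sets N \<and>
        (\<forall>B\<in>sets N. emeasure (P w) B \<in> insert \<infinity> (range of_nat))) \<and>
     (\<forall>B\<in>sets N. (\<lambda>w. emeasure (P w) B) \<in> borel_measurable M) \<and>
     (\<forall>B\<in>sets N. emeasure N B < \<infinity> \<longrightarrow>
        (\<forall>k::nat. measure M {w\<in>space M. emeasure (P w) B = of_nat k} =
           exp (- measure N B) * measure N B ^ k / fact k)) \<and>
     (\<forall>B\<in>sets N. emeasure N B = \<infinity> \<longrightarrow> (AE w in M. emeasure (P w) B = \<infinity>)) \<and>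
     (\<forall>(I::nat set) B. finite I \<longrightarrow> B ` I \<subseteq> sets N \<longrightarrow> disjoint_family_on B I \<longrightarrow>
        prob_space.indep_vars M (\<lambda>_. borel) (\<lambda>k w. emeasure (P w) (B k)) I)"

text \<open>The intensity \<open>m\<^sub>2\<close> on \<open>\<real>\<^sub>+ \<times> \<real>\<close>.\<close>

definition m2 :: "(real \<times> real) measure" where
  "m2 = restrict_space lborel ({0..} \<times> UNIV)"

text \<open>A Poisson random measure relative to the filtration: besides being adapted, its restriction
  to \<open>(s,\<infinity>) \<times> \<real>\<close> is independent of \<open>F s\<close>.  The second property is what
  makes the equation a Markovian one; it is automatic if the filtration is generated by the initial
  data and the random measure and these two are independent.\<close>

definition adapted_prm ::
    "'w measure \<Rightarrow> (real \<Rightarrow> 'w measure) \<Rightarrow> ('w \<Rightarrow> (real \<times> real) measure) \<Rightarrow> bool" where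
  "adapted_prm M F P \<longleftrightarrow>
     poisson_random_measure M m2 P \<and>
     (\<forall>t\<ge>0. \<forall>B\<in>sets borel. (\<lambda>w. emeasure (P w) ({0<..t} \<times> B)) \<in> borel_measurable (F t)) \<and>
     (\<forall>s\<ge>0. prob_space.indep_set M (sets (F s))
        (sigma_sets (space M)
          {{w\<in>space M. emeasure (P w) C \<in> A} | C A.
             C \<in> sets m2 \<and> C \<subseteq> {s<..} \<times> UNIV \<and> A \<in> sets borel}))"

section \<open>Transition rates and the associated intervals\<close>

definition XX :: "nat set" where
  "XX = {1..}"

definition XX2 :: "(nat \<times> nat) set" where
  "XX2 = {(i, j). i \<in> XX \<and> j \<in> XX \<and> i \<noteq> j}"

type_synonym rates = "nat \<Rightarrow> nat \<Rightarrow> real \<Rightarrow> nat \<Rightarrow> real"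

text \<open>\<open>\<real>\<^sub>+ \<times> \<nat>\<^sub>0\<close> with Lebesgue times counting measure.\<close>

definition age_measure :: "(real \<times> nat) measure" where
  "age_measure = restrict_space lborel {0..} \<Otimes>\<^sub>M count_space UNIV"

definition Linf_norm :: "(real \<Rightarrow> nat \<Rightarrow> real) \<Rightarrow> real" where
  "Linf_norm f = real_of_ereal (esssup age_measure (\<lambda>(y, n). ereal \<bar>f y n\<bar>))"

definition rate_functions :: "rates \<Rightarrow> bool" where
  "rate_functions lam \<longleftrightarrow> (\<forall>(i, j)\<in>XX2.
     (\<lambda>(y, n). lam i j y n) \<in> borel_measurable age_measure \<and>
     (\<forall>y\<ge>0. \<forall>n. 0 \<le> lam i j y n) \<and>
     (\<exists>B. \<forall>y\<ge>0. \<forall>n. lam i j y n \<le> B))"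

definition total_rate :: "rates \<Rightarrow> nat \<Rightarrow> real \<Rightarrow> nat \<Rightarrow> real" where
  "total_rate lam i y n = (\<Sum>\<^sub>\<infinity>j\<in>XX - {i}. lam i j y n)"

definition cumulative_rate :: "rates \<Rightarrow> nat \<Rightarrow> real \<Rightarrow> nat \<Rightarrow> real" where
  "cumulative_rate lam i y n = (LINT y':{0..y}|lborel. total_rate lam i y' n)"

definition A1 :: "rates \<Rightarrow> bool" where
  "A1 lam \<longleftrightarrow>
     (\<forall>i\<in>XX. (\<lambda>j. Linf_norm (lam i j)) summable_on (XX - {i})) \<and>
     bdd_above ((\<lambda>i. \<Sum>\<^sub>\<infinity>j\<in>XX - {i}. Linf_norm (lam i j)) ` XX)"

definition A2 :: "rates \<Rightarrow> bool" where
  "A2 lam \<longleftrightarrow> (\<forall>n. \<forall>i\<in>XX. filterlim (\<lambda>y. cumulative_rate lam i y n) at_top at_top)"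

definition tlam :: "rates \<Rightarrow> rates" where
  "tlam lam i j y n = max (Linf_norm (lam i j)) (lam i j y n)"

definition preds2 :: "nat rel \<Rightarrow> nat \<times> nat \<Rightarrow> (nat \<times> nat) set" where
  "preds2 prec p = {q\<in>XX2. (q, p) \<in> prec <*lex*> prec}"

text \<open>The left end points of the intervals are finite.  This is implicit in the definition of
  the intervals; it is automatic when every state has finitely many predecessors, but not
  for an arbitrary total order.\<close>

definition intervals_well_defined :: "rates \<Rightarrow> nat rel \<Rightarrow> bool" where
  "intervals_well_defined lam prec \<longleftrightarrow>
     (\<forall>p\<in>XX2. \<forall>y\<ge>0. \<forall>n. (\<lambda>(i', j'). tlam lam i' j' y n) summable_on preds2 prec p)"

definition Lam :: "rates \<Rightarrow> nat rel \<Rightarrow> nat \<Rightarrow> nat \<Rightarrow> real \<Rightarrow> nat \<Rightarrow> real set" where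
  "Lam lam prec i j y n =
     (\<lambda>b. (\<Sum>\<^sub>\<infinity>(i', j')\<in>preds2 prec (i, j). tlam lam i' j' y n) + b) ` {0..<lam i j y n}"

section \<open>The stochastic equation\<close>

type_synonym state = "nat \<times> real \<times> nat"

definition states :: "state set" where
  "states = XX \<times> {0..} \<times> UNIV"

definition h_Lam :: "rates \<Rightarrow> nat rel \<Rightarrow> state \<Rightarrow> real \<Rightarrow> real" where
  "h_Lam lam prec = (\<lambda>(i, y, n) v.
     \<Sum>\<^sub>\<infinity>j\<in>XX - {i}. (real j - real i) * indicator (Lam lam prec i j y n) v)"

definition g_Lam :: "rates \<Rightarrow> nat rel \<Rightarrow> state \<Rightarrow> real \<Rightarrow> real" where
  "g_Lam lam prec = (\<lambda>(i, y, n) v. \<Sum>\<^sub>\<infinity>j\<in>XX - {i}. indicator (Lam lam prec i j y n) v)"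

definition J :: "rates \<Rightarrow> nat rel \<Rightarrow> state \<Rightarrow> real \<Rightarrow> real \<times> real \<times> real" where
  "J lam prec z v =
     (h_Lam lam prec z v, - fst (snd z) * g_Lam lam prec z v, g_Lam lam prec z v)"

text \<open>\<open>z + J z v\<close> back in the discrete-continuous state type; the rounding is exact, since the
  first and third components of \<open>z + J z v\<close> are natural numbers.\<close>

definition shift :: "state \<Rightarrow> real \<times> real \<times> real \<Rightarrow> state" where
  "shift = (\<lambda>(i, y, n) (a, b, c). (nat \<lfloor>real i + a\<rfloor>, y + b, nat \<lfloor>real n + c\<rfloor>))"

type_synonym 'w process = "real \<Rightarrow> 'w \<Rightarrow> state"

text \<open>\<open>Z\<^bsub>u-\<^esub>\<close>\<close>

definition left_lim :: "'w process \<Rightarrow> real \<Rightarrow> 'w \<Rightarrow> state" where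
  "left_lim Z u w = Lim (at_left u) (\<lambda>s. Z s w)"

definition cadlag :: "(real \<Rightarrow> 's::topological_space) \<Rightarrow> bool" where
  "cadlag f \<longleftrightarrow> (\<forall>t\<ge>0. continuous (at_right t) f) \<and> (\<forall>t>0. \<exists>l. (f \<longlongrightarrow> l) (at_left t))"

text \<open>Existence of the (Bochner) integrals is part of being a solution.  The initial value \<open>n\<^sub>0\<close> of
  the third component is arbitrary; the system with \<open>N\<^sub>0 = 0\<close> is a special case.\<close>

definition solves_equation ::
    "rates \<Rightarrow> nat rel \<Rightarrow> ('w \<Rightarrow> (real \<times> real) measure) \<Rightarrow> ('w \<Rightarrow> state) \<Rightarrow> 'w process \<Rightarrow> 'w \<Rightarrow> bool" where
  "solves_equation lam prec P Z0 Z w \<longleftrightarrow>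
    (case Z0 w of (x0, y0, n0) \<Rightarrow> \<forall>t\<ge>0. case Z t w of (x, y, n) \<Rightarrow>
      (let D = {0<..t} \<times> UNIV;
           H = (\<lambda>(u, v). h_Lam lam prec (left_lim Z u w) v);
           G = (\<lambda>(u, v). g_Lam lam prec (left_lim Z u w) v);
           K = (\<lambda>(u, v). fst (snd (left_lim Z u w)) * g_Lam lam prec (left_lim Z u w) v)
       in set_integrable (P w) D H \<and> set_integrable (P w) D G \<and> set_integrable (P w) D K \<and>
          real x = real x0 + (LINT p:D|P w. H p) \<and>
          y = y0 + t - (LINT p:D|P w. K p) \<and>
          real n = real n0 + (LINT p:D|P w. G p)))"

definition strong_solution ::
    "'w measure \<Rightarrow> (real \<Rightarrow> 'w measure) \<Rightarrow> rates \<Rightarrow> nat rel \<Rightarrow>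
     ('w \<Rightarrow> (real \<times> real) measure) \<Rightarrow> ('w \<Rightarrow> state) \<Rightarrow> 'w process \<Rightarrow> bool" where
  "strong_solution M F lam prec P Z0 Z \<longleftrightarrow>
     Z0 \<in> F 0 \<rightarrow>\<^sub>M (count_space UNIV \<Otimes>\<^sub>M borel \<Otimes>\<^sub>M count_space UNIV) \<and>
     (\<forall>w\<in>space M. Z0 w \<in> states) \<and>
     (\<forall>t\<ge>0. Z t \<in> F t \<rightarrow>\<^sub>M (count_space UNIV \<Otimes>\<^sub>M borel \<Otimes>\<^sub>M count_space UNIV)) \<and>
     (\<forall>t\<ge>0. \<forall>w\<in>space M. Z t w \<in> states) \<and>
     (AE w in M. cadlag (\<lambda>t. Z t w) \<and> solves_equation lam prec P Z0 Z w)"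

section \<open>The generator\<close>

definition dy1 :: "(state \<times> state \<Rightarrow> real) \<Rightarrow> state \<times> state \<Rightarrow> real" where
  "dy1 \<phi> = (\<lambda>((i1, y1, n1), z2).
     vector_derivative (\<lambda>y. \<phi> ((i1, y, n1), z2)) (at y1 within {0..}))"

definition dy2 :: "(state \<times> state \<Rightarrow> real) \<Rightarrow> state \<times> state \<Rightarrow> real" where
  "dy2 \<phi> = (\<lambda>(z1, (i2, y2, n2)).
     vector_derivative (\<lambda>y. \<phi> (z1, (i2, y, n2))) (at y2 within {0..}))"

text \<open>Bounded functions that are continuously differentiable in \<open>(y\<^sub>1, y\<^sub>2)\<close> (one-sided at the
  boundary of \<open>\<real>\<^sub>+ \<times> \<real>\<^sub>+\<close>).\<close>

definition test_functions :: "(state \<times> state \<Rightarrow> real) set" where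
  "test_functions = {\<phi>.
     (\<exists>B. \<forall>z\<in>states \<times> states. \<bar>\<phi> z\<bar> \<le> B) \<and>
     (\<forall>i1\<in>XX. \<forall>i2\<in>XX. \<forall>n1 n2.
        (\<forall>y1\<ge>0. \<forall>y2\<ge>0.
           (\<lambda>y. \<phi> ((i1, y, n1), (i2, y2, n2))) differentiable (at y1 within {0..}) \<and>
           (\<lambda>y. \<phi> ((i1, y1, n1), (i2, y, n2))) differentiable (at y2 within {0..})) \<and>
        continuous_on ({0..} \<times> {0..}) (\<lambda>(y1, y2). dy1 \<phi> ((i1, y1, n1), (i2, y2, n2))) \<and>
        continuous_on ({0..} \<times> {0..}) (\<lambda>(y1, y2). dy2 \<phi> ((i1, y1, n1), (i2, y2, n2))))}"

definition gen_integral ::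
    "rates \<Rightarrow> nat rel \<Rightarrow> (state \<times> state \<Rightarrow> real) \<Rightarrow> state \<times> state \<Rightarrow> real" where
  "gen_integral lam prec \<phi> = (\<lambda>(z1, z2).
     dy1 \<phi> (z1, z2) + dy2 \<phi> (z1, z2) +
     (LINT v:{0..}|lborel.
        \<phi> (shift z1 (J lam prec z1 v), shift z2 (J lam prec z2 v)) - \<phi> (z1, z2)))"

definition kron :: "nat \<Rightarrow> nat \<Rightarrow> real" where
  "kron i j = (if i = j then 1 else 0)"

definition gen_sum ::
    "rates \<Rightarrow> (state \<times> state \<Rightarrow> real) \<Rightarrow> state \<times> state \<Rightarrow> real" where
  "gen_sum lam \<phi> = (\<lambda>((i1, y1, n1), (i2, y2, n2)).
     let z1 = (i1, y1, n1); z2 = (i2, y2, n2) in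
     dy1 \<phi> (z1, z2) + dy2 \<phi> (z1, z2) +
     (\<Sum>\<^sub>\<infinity>j\<in>XX - {i1}. max 0 (lam i1 j y1 n1 - kron i1 i2 * lam i2 j y2 n2) *
        (\<phi> ((j, 0, n1 + 1), z2) - \<phi> (z1, z2))) +
     (\<Sum>\<^sub>\<infinity>j\<in>XX - {i2}. max 0 (lam i2 j y2 n2 - kron i1 i2 * lam i1 j y1 n1) *
        (\<phi> (z1, (j, 0, n2 + 1)) - \<phi> (z1, z2))) +
     kron i1 i2 * (\<Sum>\<^sub>\<infinity>j\<in>XX - {i1, i2}. min (lam i1 j y1 n1) (lam i2 j y2 n2) *
        (\<phi> ((j, 0, n1 + 1), (j, 0, n2 + 1)) - \<phi> (z1, z2))))"

text \<open>\<open>A\<close> is the generator of the process \<open>W\<close> on the domain \<open>D\<close> in the sense of the martingale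
  problem (the extended generator).\<close>

definition extended_generator ::
    "'w measure \<Rightarrow> (real \<Rightarrow> 'w measure) \<Rightarrow> (real \<Rightarrow> 'w \<Rightarrow> 's) \<Rightarrow> ('s \<Rightarrow> real) set \<Rightarrow>
     (('s \<Rightarrow> real) \<Rightarrow> 's \<Rightarrow> real) \<Rightarrow> bool" where
  "extended_generator M F W D A \<longleftrightarrow> (\<forall>\<phi>\<in>D.
     (AE w in M. \<forall>t\<ge>0. set_integrable lebesgue {0..t} (\<lambda>u. A \<phi> (W u w))) \<and>
     martingale M F
       (\<lambda>t w. \<phi> (W t w) - \<phi> (W 0 w) - (LINT u:{0..t}|lebesgue. A \<phi> (W u w))))"

text \<open>\<open>a\<close> is the value of the generator at \<open>\<phi>\<close> and at the (deterministic) starting point of \<open>W\<close>,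
  as the right derivative at \<open>t = 0\<close> of \<open>t \<mapsto> E (\<phi> (W t))\<close>.  As the rates are only
  measurable in \<open>y\<close>, it may fail to exist on a null set of starting ages.\<close>

definition generator_value ::
    "'w measure \<Rightarrow> (real \<Rightarrow> 'w \<Rightarrow> 's) \<Rightarrow> 's \<Rightarrow> ('s \<Rightarrow> real) \<Rightarrow> real \<Rightarrow> bool" where
  "generator_value M W z \<phi> a \<longleftrightarrow>
     (\<forall>t\<ge>0. integrable M (\<lambda>w. \<phi> (W t w))) \<and>
     ((\<lambda>t. ((LINT w|M. \<phi> (W t w)) - \<phi> z) / t) \<longlongrightarrow> a) (at_right 0)"

end

theory Submission
  imports Defs
begin

text \<open>
  Since a test function may have unbounded derivatives, Ito's formula is replaced by an argument
  along single paths: between jumps the test function follows the deterministic flow, at an atom of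
  the random measure both components jump simultaneously, and a bisection argument adds these local
  contributions up.  The integrand of the resulting sum over jumps is predictable because left
  limits are, so Poisson independence on predictable rectangles and a monotone class argument turn
  the sum minus its compensator into a martingale.  The compensator density is the integral of the
  jump difference over the mark; it splits into the three coupled sums because away from a null set
  of ages the intervals of both components have common left end points, so two intervals are nested
  when they have the same index and disjoint otherwise.

  For the generator at a point, a Duhamel interpolation around the deterministic flow leaves an
  error quadratic in time, the probability of a jump being linear, and the compensator along the
  flow is differentiated at Lebesgue density points of the superlevel sets of the rates.
\<close>

section \<open>Rate intervals and the coupled jump map\<close>

text \<open>Two obstacles shape the construction. At an age where a rate exceeds its essential
  bound, \<open>tlam\<close> moves the end points and the two components can no longer be compared.
  Such ages form a null set, and since age grows at unit speed between jumps, a path visits them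
  only for a null set of times. That is invisible to a compensator but not to a derivative at a
  fixed starting point: hence the set \<open>E\<close> in the pointwise statement and its absence
  from the martingale statement. The random measure is given by its values on sets, not as a sum of
  point masses. Almost surely a time slice has mass at most one, and the state after a jump depends
  on the mark only through the countably valued \<open>jmp\<close>; so one representative mark
  describes the effect of a slice on both components at once. Jump times are never enumerated:
  equality of the counter at two times expresses that no mark in between has hit an
  interval.\<close>

lemma infsum_insert_le:
  fixes f :: "'b \<Rightarrow> real"
  assumes "f summable_on B" "insert x A \<subseteq> B" "x \<notin> A" "\<And>y. y \<in> B \<Longrightarrow> 0 \<le> f y"
  shows "infsum f A + f x \<le> infsum f B"
proof -
  have s: "f summable_on A" using assms(1,2) summable_on_subset_banach by blast
  have "infsum f (insert x A) \<le> infsum f B"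
    using assms s by (intro infsum_mono2) (auto simp: summable_on_insert_iff)
  moreover have "infsum f (insert x A) = f x + infsum f A"
    using assms s by (subst infsum_insert) auto
  ultimately show ?thesis by simp
qed

section \<open>Essential bounds of the rates and the layout of the intervals\<close>

locale jump_rates =
  fixes lam :: rates and prec :: "nat rel"
  assumes lin: "strict_linear_order_on XX prec"
    and rates: "rate_functions lam"
    and A1: "A1 lam"
    and intervals: "intervals_well_defined lam prec"
begin

abbreviation nrm :: "nat \<Rightarrow> nat \<Rightarrow> real" where
  "nrm i j \<equiv> Linf_norm (lam i j)"

text \<open>Outside these ages (A3) makes the majorant \<open>tlam\<close> constant, so that the left end points of
  the intervals depend on neither age nor counter.\<close>

definition bad_ages :: "real set" where
  "bad_ages = (\<Union>(i, j)\<in>XX2. \<Union>n. {y\<in>{0..}. nrm i j < lam i j y n})"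

definition left_end :: "nat \<Rightarrow> nat \<Rightarrow> real \<Rightarrow> nat \<Rightarrow> real" where
  "left_end i j y n = (\<Sum>\<^sub>\<infinity>(i', j')\<in>preds2 prec (i, j). tlam lam i' j' y n)"

text \<open>The value that every left end point takes outside \<open>bad_ages\<close>. Being free of
  age and counter, it can be compared between two components whose ages differ.\<close>

definition base :: "nat \<Rightarrow> nat \<Rightarrow> real" where
  "base i j = (\<Sum>\<^sub>\<infinity>(i', j')\<in>preds2 prec (i, j). nrm i' j')"

lemma XX2I: "i \<in> XX \<Longrightarrow> j \<in> XX - {i} \<Longrightarrow> (i, j) \<in> XX2"
  by (auto simp: XX2_def)

lemma Lam_eq: "Lam lam prec i j y n = {left_end i j y n ..< left_end i j y n + lam i j y n}"
proof -
  have "(\<lambda>b. a + b) ` {0..<l} = {a..<a + l}" for a l :: real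
    using image_add_atLeastLessThan[of a 0 l] by (simp add: add.commute)
  then show ?thesis
    unfolding Lam_def left_end_def .
qed

lemma lam_nonneg: "(i, j) \<in> XX2 \<Longrightarrow> 0 \<le> y \<Longrightarrow> 0 \<le> lam i j y n"
  using rates unfolding rate_functions_def by auto

lemma lam_measurable_age: "(i, j) \<in> XX2 \<Longrightarrow> (\<lambda>(y, n). lam i j y n) \<in> borel_measurable age_measure"
  using rates unfolding rate_functions_def by auto

text \<open>Precomposition with \<open>max 0\<close> extends a rate to a Borel function on the whole
  line; \<open>age_measure\<close> lives on nonnegative ages only.\<close>

lemma lam_measurable:
  assumes "(i, j) \<in> XX2"
  shows "(\<lambda>y. lam i j (max 0 y) n) \<in> borel_measurable borel"
proof -
  have 1: "(\<lambda>y::real. (max 0 y, n)) \<in> borel \<rightarrow>\<^sub>M age_measure"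
    unfolding age_measure_def
    by (intro measurable_Pair measurable_restrict_space2) auto
  from measurable_compose[OF 1 lam_measurable_age[OF assms]] show ?thesis
    by simp
qed

text \<open>\<open>Linf_norm\<close> passes through \<open>real_of_ereal\<close>, which sends
  infinite values to 0, so it has its intended meaning only for a finite essential supremum.
  Boundedness of the rate excludes \<infinity>; comparison with the constant 0 excludes negative
  values.\<close>

lemma nrm_esssup:
  assumes "(i, j) \<in> XX2"
  shows "ereal (nrm i j) = esssup age_measure (\<lambda>(y, n). ereal \<bar>lam i j y n\<bar>)"
    and "0 \<le> nrm i j"
proof -
  let ?f = "\<lambda>(y, n). ereal \<bar>lam i j y n\<bar>"
  obtain B where B: "\<And>y n. 0 \<le> y \<Longrightarrow> lam i j y n \<le> B"
    using rates assms unfolding rate_functions_def by fastforce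
  have m: "?f \<in> borel_measurable age_measure"
    using lam_measurable_age[OF assms] by (simp add: split_beta')
  have sp: "x \<in> space age_measure \<longleftrightarrow> 0 \<le> fst x" for x
    by (cases x) (auto simp: age_measure_def space_pair_measure space_restrict_space)
  have up: "esssup age_measure ?f \<le> ereal B"
    using m
  proof (rule esssup_I, intro AE_I2)
    fix x assume "x \<in> space age_measure"
    then show "?f x \<le> ereal B"
      using B[of "fst x" "snd x"] lam_nonneg[OF assms, of "fst x" "snd x"] by (auto simp: sp split_beta)
  qed
  \<comment> \<open>A constant is its own essential supremum only for a nonzero measure; one set of
    mass 1 is enough.\<close>
  have "emeasure age_measure ({0..1} \<times> {0}) = emeasure lborel {0..1::real} * 1"
  proof -
    interpret c: sigma_finite_measure "count_space (UNIV::nat set)"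
      by (rule sigma_finite_measure_count_space)
    show ?thesis unfolding age_measure_def
      by (subst c.emeasure_pair_measure_Times)
         (auto simp: sets_restrict_space_iff emeasure_restrict_space)
  qed
  then have "emeasure age_measure (space age_measure) \<noteq> 0"
    by (metis emeasure_lborel_Icc emeasure_space ennreal_1 le_zero_eq mult.right_neutral diff_zero zero_le_one zero_neq_one)
  then have "esssup age_measure (\<lambda>_. 0) = (0::ereal)"
    by (rule esssup_const)
  moreover have "esssup age_measure (\<lambda>_. 0::ereal) \<le> esssup age_measure ?f"
    by (rule esssup_mono) (auto simp: split_beta)
  ultimately have lo: "0 \<le> esssup age_measure ?f" by simp
  from up lo show "ereal (nrm i j) = esssup age_measure ?f" "0 \<le> nrm i j"
    unfolding Linf_norm_def
    by (cases "esssup age_measure ?f"; auto)+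
qed

lemmas nrm_nonneg = nrm_esssup(2)

text \<open>For one index pair the violations form a null set in age times counter. At almost every
  age its section is null for counting measure, hence empty; only countably many pairs and counters
  remain to be united.\<close>

lemma bad_ages_null: "bad_ages \<in> null_sets lborel"
proof -
  have null1: "{y\<in>{0..}. nrm i j < lam i j y n} \<in> null_sets lborel" if ij: "(i, j) \<in> XX2" for i j n
  proof -
    interpret p: pair_sigma_finite "restrict_space lborel {0::real..}" "count_space (UNIV::nat set)"
      by (intro pair_sigma_finite.intro sigma_finite_measure_count_space
            sigma_finite_measure_restrict_space sigma_finite_lborel) simp
    have "AE x in age_measure. (case x of (y, n) \<Rightarrow> ereal \<bar>lam i j y n\<bar>) \<le> ereal (nrm i j)"
      unfolding nrm_esssup(1)[OF ij] by (rule esssup_AE)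
    then have "AE x in age_measure. (case x of (y, n) \<Rightarrow> lam i j y n) \<le> nrm i j"
      by eventually_elim auto
    then have "AE y in restrict_space lborel {0..}. AE n in count_space UNIV. lam i j y n \<le> nrm i j"
      unfolding age_measure_def
      by (drule_tac p.AE_pair) simp
    then have "AE y in restrict_space lborel {0..}. lam i j y n \<le> nrm i j"
      by (auto simp: AE_count_space elim: eventually_mono)
    then have "AE y in lborel. 0 \<le> y \<longrightarrow> lam i j y n \<le> nrm i j"
      by (simp add: AE_restrict_space_iff)
    moreover have "{y\<in>{0..}. nrm i j < lam i j y n} \<in> sets lborel"
    proof -
      have "{y\<in>{0..}. nrm i j < lam i j y n} = {0..} \<inter> {y\<in>space borel. nrm i j < lam i j (max 0 y) n}"
        by auto
      moreover have "{y\<in>space borel. nrm i j < lam i j (max 0 y) n} \<in> sets borel"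
        using lam_measurable[OF ij] by measurable
      ultimately show ?thesis by simp
    qed
    moreover from calculation(1) have "AE y in lborel. y \<notin> {y\<in>{0..}. nrm i j < lam i j y n}"
      by (rule eventually_mono) auto
    ultimately show ?thesis
      using AE_iff_null_sets by blast
  qed
  have c: "countable XX2"
    by (rule countableI_type)
  show ?thesis
    unfolding bad_ages_def
  proof (rule null_sets_UN'[OF c])
    fix p assume "p \<in> XX2"
    then show "(case p of (i, j) \<Rightarrow> \<Union>n. {y\<in>{0..}. nrm i j < lam i j y n}) \<in> null_sets lborel"
      using null1 by (cases p) (auto intro!: null_sets_UN)
  qed
qed

lemma lam_le_nrm: "(i, j) \<in> XX2 \<Longrightarrow> 0 \<le> y \<Longrightarrow> y \<notin> bad_ages \<Longrightarrow> lam i j y n \<le> nrm i j"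
proof (rule ccontr)
  assume a: "(i, j) \<in> XX2" "0 \<le> y" "y \<notin> bad_ages" "\<not> lam i j y n \<le> nrm i j"
  then have "y \<in> bad_ages"
    unfolding bad_ages_def by (intro UN_I[OF a(1)]) (auto simp: not_le)
  with a show False by simp
qed

lemma tlam_off_bad: "(i, j) \<in> XX2 \<Longrightarrow> 0 \<le> y \<Longrightarrow> y \<notin> bad_ages \<Longrightarrow> tlam lam i j y n = nrm i j"
  using lam_le_nrm[of i j y n] by (simp add: tlam_def)

lemma left_end_off_bad:
  assumes "0 \<le> y" "y \<notin> bad_ages"
  shows "left_end i j y n = base i j"
  unfolding left_end_def base_def
  by (rule infsum_cong) (use assms tlam_off_bad in \<open>auto simp: preds2_def\<close>)

lemma tlam_nonneg: "(i, j) \<in> XX2 \<Longrightarrow> 0 \<le> tlam lam i j y n"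
  using nrm_nonneg[of i j] unfolding tlam_def by simp

lemma tlam_summable:
  "p \<in> XX2 \<Longrightarrow> 0 \<le> y \<Longrightarrow> (\<lambda>(i', j'). tlam lam i' j' y n) summable_on preds2 prec p"
  using intervals unfolding intervals_well_defined_def by auto

text \<open>\<open>tlam\<close> dominates the norm at every age and counter, so its summability at
  age 0 and counter 0 suffices.\<close>

lemma nrm_summable_preds:
  assumes "p \<in> XX2"
  shows "(\<lambda>(i', j'). nrm i' j') summable_on preds2 prec p"
  using tlam_summable[OF assms, of 0 0]
  by (rule summable_on_comparison_test)
     (auto simp: preds2_def tlam_def nrm_nonneg)

lemma left_end_nonneg: "0 \<le> left_end i j y n"
  unfolding left_end_def by (rule infsum_nonneg) (auto simp: preds2_def tlam_nonneg)

lemma preds2_step: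
  assumes "p \<in> XX2" "q \<in> XX2" "(p, q) \<in> prec <*lex*> prec"
  shows "insert p (preds2 prec p) \<subseteq> preds2 prec q" "p \<notin> preds2 prec p"
proof -
  have t: "trans prec" and i: "irrefl prec"
    using lin unfolding strict_linear_order_on_def by auto
  show "insert p (preds2 prec p) \<subseteq> preds2 prec q"
    using assms trans_lex_prod[OF t t] unfolding preds2_def by (auto dest: transD simp del: in_lex_prod)
  show "p \<notin> preds2 prec p"
    using i unfolding preds2_def by (cases p) (auto simp: irrefl_def)
qed

lemma lex_total:
  assumes "p \<in> XX2" "q \<in> XX2" "p \<noteq> q"
  shows "(p, q) \<in> prec <*lex*> prec \<or> (q, p) \<in> prec <*lex*> prec"
proof (cases "fst p = fst q")
  case True
  then have "snd p \<noteq> snd q" using assms(3) by (simp add: prod_eq_iff)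
  then show ?thesis
    using True assms lin unfolding strict_linear_order_on_def total_on_def XX2_def by (cases p; cases q) force
next
  case False
  then show ?thesis
    using assms lin unfolding strict_linear_order_on_def total_on_def XX2_def by (cases p; cases q) force
qed

text \<open>The predecessors of a later pair include those of the earlier pair and the earlier pair
  itself, so the later left end point leaves room for one full majorant.\<close>

lemma left_end_step:
  assumes "(i, j) \<in> XX2" "(i', j') \<in> XX2" "((i, j), (i', j')) \<in> prec <*lex*> prec" "0 \<le> y"
  shows "left_end i j y n + tlam lam i j y n \<le> left_end i' j' y n"
  using infsum_insert_le[OF tlam_summable[OF assms(2,4)] preds2_step[OF assms(1-3)]]
  unfolding left_end_def by (auto simp: preds2_def tlam_nonneg)

lemma base_step:
  assumes "(i, j) \<in> XX2" "(i', j') \<in> XX2" "((i, j), (i', j')) \<in> prec <*lex*> prec"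
  shows "base i j + nrm i j \<le> base i' j'"
  using infsum_insert_le[OF nrm_summable_preds[OF assms(2)] preds2_step[OF assms(1-3)]]
  unfolding base_def by (auto simp: preds2_def nrm_nonneg)

text \<open>At a common age and counter the gaps between left end points are measured by
  \<open>tlam\<close>, which dominates \<open>lam\<close>; therefore bad ages need no
  exception.\<close>

lemma Lam_disjoint:
  assumes "(i, j) \<in> XX2" "(i', j') \<in> XX2" "(i, j) \<noteq> (i', j')" "0 \<le> y"
  shows "Lam lam prec i j y n \<inter> Lam lam prec i' j' y n = {}"
proof -
  have "lam i j y n \<le> tlam lam i j y n" for i j by (simp add: tlam_def)
  note t = this[of i j] this[of i' j']
  from lex_total[OF assms(1-3)] show ?thesis
  proof
    assume "((i, j), (i', j')) \<in> prec <*lex*> prec"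
    from left_end_step[OF assms(1,2) this assms(4), of n] t show ?thesis
      unfolding Lam_eq by auto
  next
    assume "((i', j'), (i, j)) \<in> prec <*lex*> prec"
    from left_end_step[OF assms(2,1) this assms(4), of n] t show ?thesis
      unfolding Lam_eq by auto
  qed
qed

text \<open>The cells \<open>[base, base + nrm)\<close> are fixed, so they also separate marks of
  two components with different ages and counters, which \<open>Lam_disjoint\<close> does
  not.\<close>

lemma base_disjoint:
  assumes "(i, j) \<in> XX2" "(i', j') \<in> XX2" "(i, j) \<noteq> (i', j')"
  shows "{base i j ..< base i j + nrm i j} \<inter> {base i' j' ..< base i' j' + nrm i' j'} = {}"
  using lex_total[OF assms]
proof
  assume "((i, j), (i', j')) \<in> prec <*lex*> prec"
  from base_step[OF assms(1,2) this] show ?thesis by auto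
next
  assume "((i', j'), (i, j)) \<in> prec <*lex*> prec"
  from base_step[OF assms(2,1) this] show ?thesis by auto
qed

lemma Lam_off_bad:
  assumes "0 \<le> y" "y \<notin> bad_ages"
  shows "Lam lam prec i j y n = {base i j ..< base i j + lam i j y n}"
  unfolding Lam_eq left_end_off_bad[OF assms] ..

lemma Lam_subset_base:
  assumes "(i, j) \<in> XX2" "0 \<le> y" "y \<notin> bad_ages"
  shows "Lam lam prec i j y n \<subseteq> {base i j ..< base i j + nrm i j}"
  unfolding Lam_off_bad[OF assms(2,3)] using lam_le_nrm[OF assms, of n] by auto

text \<open>A nonnegative unordered sum is the supremum of its finite partial sums, and a countable
  index set has only countably many finite subsets.\<close>

lemma left_end_measurable:
  assumes "(i, j) \<in> XX2"
  shows "(\<lambda>y. left_end i j (max 0 y) n) \<in> borel_measurable borel"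
proof -
  let ?P = "preds2 prec (i, j)"
  let ?F = "{F. finite F \<and> F \<subseteq> ?P}"
  let ?s = "\<lambda>y F. \<Sum>(i', j')\<in>F. tlam lam i' j' (max 0 y) n"
  have sub: "q \<in> ?P \<Longrightarrow> q \<in> XX2" for q by (simp add: preds2_def)
  have eq: "left_end i j (max 0 y) n = (SUP F\<in>?F. ?s y F)" for y
    unfolding left_end_def
    by (rule infsum_nonneg_is_SUPREMUM_real[OF tlam_summable[OF assms]])
       (auto dest!: sub simp: tlam_nonneg)
  have "countable ?F"
    by (rule countable_subset[OF _ countable_Collect_finite]) auto
  moreover have "(\<lambda>y. ?s y F) \<in> borel_measurable borel" if "F \<in> ?F" for F
    using that sub unfolding split_beta tlam_def
    by (intro borel_measurable_sum borel_measurable_max borel_measurable_const lam_measurable) auto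
  moreover have "bdd_above ((\<lambda>F. ?s y F) ` ?F)" for y
  proof (rule bdd_aboveI2)
    fix F assume "F \<in> ?F"
    then show "?s y F \<le> left_end i j (max 0 y) n"
      unfolding left_end_def
      by (intro finite_sum_le_infsum[OF tlam_summable[OF assms]])
         (auto dest!: sub simp: tlam_nonneg)
  qed
  ultimately show ?thesis unfolding eq
    by (intro borel_measurable_cSUP) auto
qed

end

abbreviation state_space :: "state measure" where
  "state_space \<equiv> count_space UNIV \<Otimes>\<^sub>M borel \<Otimes>\<^sub>M count_space UNIV"

text \<open>A measurable retraction onto \<open>states\<close>: test functions are constrained on \<open>states\<close> only.\<close>

definition clean :: "state \<Rightarrow> state" where
  "clean = (\<lambda>(i, y, n). (max 1 i, max 0 y, n))"

lemma clean_in_states [simp]: "clean z \<in> states"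
  by (cases z) (auto simp: clean_def states_def XX_def)

lemma clean_id [simp]: "z \<in> states \<Longrightarrow> clean z = z"
  by (cases z) (auto simp: clean_def states_def XX_def)

lemma in_states [simp]: "(i, y, n) \<in> states \<longleftrightarrow> i \<in> XX \<and> 0 \<le> y"
  by (auto simp: states_def)

lemma clean_measurable [measurable]: "clean \<in> state_space \<rightarrow>\<^sub>M state_space"
  unfolding clean_def split_beta' by measurable

section \<open>Integration over countable partitions of the marks\<close>

lemma infsum_single_nonzero:
  fixes f :: "'b \<Rightarrow> real"
  assumes "\<And>x. x \<in> A \<Longrightarrow> x \<noteq> k \<Longrightarrow> f x = 0"
  shows "infsum f A = (if k \<in> A then f k else 0)"
proof -
  have "infsum f A = infsum f (A \<inter> {k})"
    by (rule infsum_cong_neutral) (use assms in auto)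
  then show ?thesis by (cases "k \<in> A") auto
qed

text \<open>The masses are summable and the values bounded by \<open>C\<close>, so everything
  converges absolutely. This is needed twice: to exchange series and integral, and to identify the
  ordered series with the unordered \<open>infsum\<close>.\<close>

lemma integral_countable_partition:
  fixes D :: "'b \<Rightarrow> real" and A :: "nat \<Rightarrow> 'b set"
  assumes A: "\<And>j. j \<in> I \<Longrightarrow> A j \<in> sets N" "\<And>j. j \<in> I \<Longrightarrow> emeasure N (A j) = ennreal (m j)"
      "\<And>j. j \<in> I \<Longrightarrow> 0 \<le> m j"
    and disj: "disjoint_family_on A I" and m: "m summable_on I"
    and D: "\<And>j v. j \<in> I \<Longrightarrow> v \<in> A j \<Longrightarrow> D v = c j" "\<And>v. v \<in> space N \<Longrightarrow> (\<And>j. j \<in> I \<Longrightarrow> v \<notin> A j) \<Longrightarrow> D v = 0"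
    and c: "\<And>j. j \<in> I \<Longrightarrow> \<bar>c j\<bar> \<le> C"
  shows "integrable N D \<and> (LINT v|N. D v) = (\<Sum>\<^sub>\<infinity>j\<in>I. m j * c j)"
proof
  \<comment> \<open>Indices outside \<open>I\<close> contribute zero, so that theorems on series
    over all natural numbers apply.\<close>
  define f where "f j v = (if j \<in> I then indicator (A j) v * c j else 0)" for j v
  define m' where "m' j = (if j \<in> I then m j else 0)" for j
  have m'0: "0 \<le> m' j" for j using A by (simp add: m'_def)
  have "m' summable_on UNIV \<longleftrightarrow> m summable_on I"
    by (rule summable_on_cong_neutral) (auto simp: m'_def)
  with m m'0 have sm': "summable m'"
    using summable_on_UNIV_nonneg_real_iff by blast
  have fin: "emeasure N (A j) < \<infinity>" if "j \<in> I" for j using A that by simp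
  have int: "integrable N (f j)" for j
    unfolding f_def using A fin
    by (cases "j \<in> I") (auto intro!: integrable_mult_left integrable_real_indicator)
  have meas: "measure N (A j) = m j" if "j \<in> I" for j
    using A that by (simp add: measure_def)
  have fint: "(LINT v|N. f j v) = (if j \<in> I then m j * c j else 0)" for j
    unfolding f_def using A meas by (auto simp: sets.Int_space_eq2)
  have nint: "(LINT v|N. norm (f j v)) \<le> C * m' j" for j
  proof (cases "j \<in> I")
    case True
    have "(LINT v|N. norm (f j v)) = (LINT v|N. indicator (A j) v * \<bar>c j\<bar>)"
      unfolding f_def using True by (intro Bochner_Integration.integral_cong) (auto simp: abs_mult)
    also have "\<dots> = m j * \<bar>c j\<bar>" using A meas True by (simp add: sets.Int_space_eq2)
    also have "\<dots> \<le> m j * C" using A c True by (intro mult_left_mono) auto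
    finally show ?thesis using True by (simp add: m'_def mult.commute)
  qed (simp add: f_def m'_def)
  have sn: "summable (\<lambda>j. LINT v|N. norm (f j v))"
    by (rule summable_comparison_test'[OF summable_mult[OF sm', of C]])
       (use nint in \<open>auto intro!: integral_nonneg\<close>)
  have single: "f j v = 0" if "j \<noteq> k" "k \<in> I" "v \<in> A k" for j k v
    using that disj unfolding f_def disjoint_family_on_def by (auto simp: indicator_def)
  have sums: "(\<lambda>j. f j v) sums D v \<and> summable (\<lambda>j. norm (f j v))" if v: "v \<in> space N" for v
  proof (cases "\<exists>k\<in>I. v \<in> A k")
    case True
    then obtain k where k: "k \<in> I" "v \<in> A k" by blast
    have "(\<lambda>j. f j v) sums (\<Sum>j\<in>{k}. f j v)"
      by (rule sums_finite) (use single[OF _ k] in auto)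
    moreover have "(\<lambda>j. norm (f j v)) sums (\<Sum>j\<in>{k}. norm (f j v))"
      by (rule sums_finite) (use single[OF _ k] in auto)
    moreover have "f k v = D v" using k D by (simp add: f_def)
    ultimately show ?thesis by (auto simp: sums_iff)
  next
    case False
    then have "f j v = 0" for j by (auto simp: f_def indicator_def)
    moreover have "D v = 0" using D(2)[OF v] False by blast
    ultimately show ?thesis by simp
  qed
  have ae: "AE v in N. summable (\<lambda>j. norm (f j v))" using sums by (intro AE_I2) blast
  have Deq: "D v = (\<Sum>j. f j v)" if "v \<in> space N" for v using sums[OF that] by (simp add: sums_iff)
  have "integrable N (\<lambda>v. \<Sum>j. f j v)" by (rule integrable_suminf[OF int ae sn])
  then show "integrable N D"
    by (subst Bochner_Integration.integrable_cong[OF refl Deq]) auto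
  have "(\<lambda>j. LINT v|N. f j v) sums (LINT v|N. (\<Sum>j. f j v))"
    by (rule sums_integral[OF int ae sn])
  also have "(LINT v|N. (\<Sum>j. f j v)) = (LINT v|N. D v)"
    using Deq by (intro Bochner_Integration.integral_cong) auto
  finally have s1: "(\<lambda>j. if j \<in> I then m j * c j else 0) sums (LINT v|N. D v)"
    unfolding fint .
  have "(\<lambda>j. norm (if j \<in> I then m j * c j else 0)) summable_on UNIV"
  proof (rule Infinite_Sum.abs_summable_on_comparison_test')
    show "(\<lambda>j. C * m' j) summable_on UNIV"
      using sm' m'0 summable_on_UNIV_nonneg_real_iff by (intro summable_on_cmult_right) blast
    show "norm (if j \<in> I then m j * c j else 0) \<le> C * m' j" for j
      using c[of j] A(3)[of j] by (auto simp: m'_def abs_mult mult.commute[of C] intro!: mult_left_mono)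
  qed
  then have "((\<lambda>j. if j \<in> I then m j * c j else 0) has_sum (\<Sum>\<^sub>\<infinity>j. if j \<in> I then m j * c j else 0)) UNIV"
    by (rule has_sum_infsum[OF abs_summable_summable])
  then have "(LINT v|N. D v) = (\<Sum>\<^sub>\<infinity>j. if j \<in> I then m j * c j else 0)"
    by (rule sums_unique2[OF s1 has_sum_imp_sums])
  also have "\<dots> = (\<Sum>\<^sub>\<infinity>j\<in>I. m j * c j)"
    by (rule infsum_cong_neutral) auto
  finally show "(LINT v|N. D v) = (\<Sum>\<^sub>\<infinity>j\<in>I. m j * c j)" .
qed

section \<open>The jump map, its measurability and the size of the hit sets\<close>

context jump_rates
begin

text \<open>The value 0, which is not a state, stands for ``no jump''.\<close>

definition jmp :: "state \<Rightarrow> real \<Rightarrow> nat" where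
  "jmp = (\<lambda>(i, y, n) v. if \<exists>j\<in>XX - {i}. v \<in> Lam lam prec i j y n
      then SOME j. j \<in> XX - {i} \<and> v \<in> Lam lam prec i j y n else 0)"

definition move :: "state \<Rightarrow> real \<Rightarrow> state" where
  "move z v = (if jmp z v = 0 then z else (jmp z v, 0, snd (snd z) + 1))"

text \<open>The constant \<open>c\<close> of (A1): it bounds the total length of the cells belonging
  to one source state.\<close>

definition rate_bound :: real where
  "rate_bound = (SUP i\<in>XX. \<Sum>\<^sub>\<infinity>j\<in>XX - {i}. nrm i j)"

lemma jmp_nonzeroD:
  assumes "jmp (i, y, n) v = j" "j \<noteq> 0"
  shows "j \<in> XX - {i}" "v \<in> Lam lam prec i j y n"
proof -
  let ?P = "\<lambda>j. j \<in> XX - {i} \<and> v \<in> Lam lam prec i j y n"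
  have "\<exists>j. ?P j" using assms by (auto simp: jmp_def split: if_splits)
  moreover have "j = (SOME j. ?P j)" using assms by (auto simp: jmp_def split: if_splits)
  ultimately show "j \<in> XX - {i}" "v \<in> Lam lam prec i j y n"
    using someI_ex[of ?P] by auto
qed

text \<open>Disjointness of the intervals at one age and counter makes the choice in
  \<open>jmp\<close> unique.\<close>

lemma jmp_eqI:
  assumes "i \<in> XX" "0 \<le> y" "j \<in> XX - {i}" "v \<in> Lam lam prec i j y n"
  shows "jmp (i, y, n) v = j"
proof -
  have "jmp (i, y, n) v \<noteq> 0"
  proof -
    have "\<exists>j. j \<in> XX - {i} \<and> v \<in> Lam lam prec i j y n" using assms by blast
    from someI_ex[OF this] show ?thesis
      using assms by (auto simp: jmp_def XX_def)
  qed
  from jmp_nonzeroD[OF refl this] show ?thesis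
    using Lam_disjoint[OF XX2I[OF assms(1,3)] XX2I[OF assms(1), of "jmp (i, y, n) v"], of y n] assms
    by auto
qed

lemma jmp_iff:
  assumes "i \<in> XX" "0 \<le> y" "j \<noteq> 0"
  shows "jmp (i, y, n) v = j \<longleftrightarrow> j \<in> XX - {i} \<and> v \<in> Lam lam prec i j y n"
  using jmp_eqI[OF assms(1,2)] jmp_nonzeroD[OF _ assms(3)] by blast

lemma move_states: "z \<in> states \<Longrightarrow> move z v \<in> states"
  by (cases z) (auto simp: move_def XX_def)

text \<open>At most one interval contains \<open>v\<close>, so the sum collapses to one term. The
  weight 1 gives \<open>g_Lam\<close>, the weight \<open>j - i\<close> gives
  \<open>h_Lam\<close>.\<close>

lemma infsum_Lam:
  assumes z: "(i, y, n) \<in> states"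
  shows "(\<Sum>\<^sub>\<infinity>j\<in>XX - {i}. f j * indicator (Lam lam prec i j y n) v) =
    (if jmp (i, y, n) v = 0 then 0 else f (jmp (i, y, n) v) :: real)"
proof -
  let ?k = "jmp (i, y, n) v"
  have *: "f j * indicator (Lam lam prec i j y n) v = 0" if "j \<in> XX - {i}" "j \<noteq> ?k" for j
    using jmp_eqI[of i y j v n] that z by (auto simp: indicator_def)
  have "(\<Sum>\<^sub>\<infinity>j\<in>XX - {i}. f j * indicator (Lam lam prec i j y n) v) =
     (if ?k \<in> XX - {i} then f ?k * indicator (Lam lam prec i ?k y n) v else 0)"
    by (rule infsum_single_nonzero) (use * in auto)
  then show ?thesis
    using jmp_nonzeroD[of i y n v ?k] by (cases "?k = 0") (auto simp: XX_def)
qed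

lemma g_Lam_eq: "z \<in> states \<Longrightarrow> g_Lam lam prec z v = (if jmp z v = 0 then 0 else 1)"
  using infsum_Lam[of "fst z" "fst (snd z)" "snd (snd z)" "\<lambda>_. 1" v] by (cases z) (auto simp: g_Lam_def)

lemma h_Lam_eq: "z \<in> states \<Longrightarrow> h_Lam lam prec z v = (if jmp z v = 0 then 0 else real (jmp z v) - real (fst z))"
  using infsum_Lam[of "fst z" "fst (snd z)" "snd (snd z)" "\<lambda>j. real j - real (fst z)" v]
  by (cases z) (auto simp: h_Lam_def)

lemma shift_J: "z \<in> states \<Longrightarrow> shift z (J lam prec z v) = move z v"
proof -
  have "\<lfloor>real b - real a\<rfloor> = int b - int a" for a b
    by (metis floor_of_int of_int_diff of_int_of_nat_eq)
  then show "z \<in> states \<Longrightarrow> ?thesis"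
    by (cases z) (auto simp: J_def g_Lam_eq h_Lam_eq shift_def move_def nat_add_distrib)
qed

text \<open>For fixed source, target and counter the event is a pair of inequalities between the
  mark and measurable functions of the age. The actual source and counter are substituted by
  countable composition, and the value 0 is the complement of the positive values.\<close>

lemma jmp_measurable [measurable]:
  "(\<lambda>(z, v). jmp (clean z) v) \<in> state_space \<Otimes>\<^sub>M borel \<rightarrow>\<^sub>M count_space UNIV"
proof -
  let ?S = "state_space \<Otimes>\<^sub>M (borel :: real measure)"
  have 1: "Measurable.pred ?S (\<lambda>x. left_end i j (max 0 (fst (snd (fst x)))) n \<le> snd x \<and>
      snd x < left_end i j (max 0 (fst (snd (fst x)))) n + lam i j (max 0 (fst (snd (fst x)))) n)"
    if "(i, j) \<in> XX2" for i j n
  proof -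
    note [measurable] = left_end_measurable[OF that, of n] lam_measurable[OF that, of n]
    show ?thesis by measurable
  qed
  define p where "p j i n x \<longleftrightarrow> (i, j) \<in> XX2 \<and> left_end i j (max 0 (fst (snd (fst x)))) n \<le> snd x \<and>
      snd x < left_end i j (max 0 (fst (snd (fst x)))) n + lam i j (max 0 (fst (snd (fst x)))) n"
    for j i n and x :: "state \<times> real"
  have 2: "Measurable.pred ?S (p j i n)" for j i n
    unfolding p_def using 1 by (cases "(i, j) \<in> XX2") auto
  have 3: "Measurable.pred ?S (\<lambda>x. p j (max 1 (fst (fst x))) n x)" for j n
    by (rule measurable_compose_countable[OF 2]) measurable
  have 4: "Measurable.pred ?S (\<lambda>x. p j (max 1 (fst (fst x))) (snd (snd (fst x))) x)" for j
    by (rule measurable_compose_countable[OF 3]) measurable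
  have eq: "jmp (clean z) v = j \<longleftrightarrow> p j (max 1 (fst z)) (snd (snd z)) (z, v)" if "j \<noteq> 0" for j z v
  proof -
    obtain i y n where z: "z = (i, y, n)" by (cases z)
    have "j \<in> XX" "max 1 i \<in> XX" using that by (auto simp: XX_def)
    then show ?thesis using that
      unfolding z by (auto simp: clean_def p_def jmp_iff Lam_eq XX2_def)
  qed
  show ?thesis
  proof (subst measurable_count_space_eq2_countable, safe)
    fix j
    have ne: "(\<lambda>(z, v). jmp (clean z) v) -` {k} \<inter> space ?S \<in> sets ?S" if "k \<noteq> 0" for k
    proof -
      have "(\<lambda>(z, v). jmp (clean z) v) -` {k} \<inter> space ?S =
          {x \<in> space ?S. p k (max 1 (fst (fst x))) (snd (snd (fst x))) x}"
        by (rule set_eqI) (simp add: split_beta eq[OF that] conj_commute del: One_nat_def)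
      then show ?thesis using 4[of k] by (simp add: pred_def)
    qed
    show "(\<lambda>(z, v). jmp (clean z) v) -` {j} \<inter> space ?S \<in> sets ?S"
    proof (cases "j = 0")
      case True
      have "(\<lambda>(z, v). jmp (clean z) v) -` {0} \<inter> space ?S =
          space ?S - (\<Union>k. (\<lambda>(z, v). jmp (clean z) v) -` {Suc k} \<inter> space ?S)"
      proof -
        have "n = 0 \<longleftrightarrow> (\<forall>k. n \<noteq> Suc k)" for n :: nat by (cases n) auto
        then show ?thesis by auto
      qed
      then show ?thesis using ne True
        by (auto simp: Int_UN_distrib2 intro!: sets.compl_sets sets.countable_UN simp del: sets.compl_sets UN_simps)
    qed (use ne in simp)
  qed simp
qed

lemma move_measurable [measurable]:
  "(\<lambda>(z, v). move (clean z) v) \<in> state_space \<Otimes>\<^sub>M borel \<rightarrow>\<^sub>M state_space"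
  using jmp_measurable unfolding move_def split_beta' by measurable

lemma nrm_summable: "i \<in> XX \<Longrightarrow> nrm i summable_on XX - {i}"
  using A1 unfolding A1_def by (simp add: eta_contract_eq)

lemma nrm_sum_le: "i \<in> XX \<Longrightarrow> (\<Sum>\<^sub>\<infinity>j\<in>XX - {i}. nrm i j) \<le> rate_bound"
  using A1 unfolding A1_def rate_bound_def by (auto intro: cSUP_upper)

lemma rate_bound_nonneg: "0 \<le> rate_bound"
proof -
  have "0 \<le> (\<Sum>\<^sub>\<infinity>j\<in>XX - {1}. nrm 1 j)"
    by (rule infsum_nonneg) (auto intro!: nrm_nonneg simp: XX2_def XX_def)
  also have "\<dots> \<le> rate_bound" by (rule nrm_sum_le) (simp add: XX_def)
  finally show ?thesis .
qed

definition good_states :: "state set" where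
  "good_states = XX \<times> ({0..} - bad_ages) \<times> UNIV"

lemma good_states_iff [simp]: "(i, y, n) \<in> good_states \<longleftrightarrow> i \<in> XX \<and> 0 \<le> y \<and> y \<notin> bad_ages"
  by (auto simp: good_states_def)

lemma good_states_subset: "z \<in> good_states \<Longrightarrow> z \<in> states"
  by (cases z) auto

lemma jmp_section_measurable [measurable]:
  assumes "z \<in> states"
  shows "jmp z \<in> borel \<rightarrow>\<^sub>M count_space UNIV"
proof -
  have "(\<lambda>v. (z, v)) \<in> borel \<rightarrow>\<^sub>M state_space \<Otimes>\<^sub>M borel"
    by (intro measurable_Pair) (auto simp: space_pair_measure)
  from measurable_compose[OF this jmp_measurable] show ?thesis using assms by simp
qed

lemma jmp_base:
  assumes "(i, y, n) \<in> good_states" "jmp (i, y, n) v = j" "j \<noteq> 0"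
  shows "v \<in> {base i j ..< base i j + nrm i j}"
  using jmp_nonzeroD[OF assms(2,3)] Lam_subset_base[of i j y n] assms by (auto simp: XX2_def)

text \<open>A mark that moves both components lies in one cell of each. Cells of different index
  pairs are disjoint whatever the ages, so the two cells coincide: simultaneous jumps share source
  and target.\<close>

lemma jmp_both:
  assumes "(i1, y1, n1) \<in> good_states" "(i2, y2, n2) \<in> good_states"
    "jmp (i1, y1, n1) v \<noteq> 0" "jmp (i2, y2, n2) v \<noteq> 0"
  shows "i1 = i2" "jmp (i1, y1, n1) v = jmp (i2, y2, n2) v"
proof -
  let ?j1 = "jmp (i1, y1, n1) v" and ?j2 = "jmp (i2, y2, n2) v"
  have "(i1, ?j1) \<in> XX2" "(i2, ?j2) \<in> XX2"
    using jmp_nonzeroD[OF refl assms(3)] jmp_nonzeroD[OF refl assms(4)] assms by (auto simp: XX2_def)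
  from base_disjoint[OF this] jmp_base[OF assms(1) refl assms(3)] jmp_base[OF assms(2) refl assms(4)]
  show "i1 = i2" "?j1 = ?j2" by auto
qed

text \<open>All left end points are nonnegative. This lets the integral over the half line in
  \<open>gen_integral\<close> be read as one over the whole line.\<close>

lemma jmp_nonneg_arg:
  assumes "jmp z v \<noteq> 0" shows "0 \<le> v"
proof -
  obtain i y n where z: "z = (i, y, n)" by (cases z)
  show ?thesis
    using jmp_nonzeroD(2)[OF refl assms[unfolded z]] left_end_nonneg[of i "jmp (i, y, n) v" y n]
    unfolding Lam_eq by simp
qed

text \<open>A fixed set containing every mark that can hit source \<open>i\<close> at a good age.
  Since it is independent of age it can serve as the support of a dominating function.\<close>

definition base_union :: "nat \<Rightarrow> real set" where
  "base_union i = (\<Union>j\<in>XX - {i}. {base i j ..< base i j + nrm i j})"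

lemma base_union_measurable [measurable]: "base_union i \<in> sets borel"
  unfolding base_union_def by (rule sets.countable_UN') (auto intro: countableI_type)

lemma jmp_in_base_union:
  assumes "(i, y, n) \<in> good_states" "jmp (i, y, n) v \<noteq> 0"
  shows "v \<in> base_union i"
  unfolding base_union_def
  using jmp_nonzeroD(1)[OF refl assms(2)] jmp_base[OF assms(1) refl assms(2)] by (rule UN_I)

text \<open>The cells are disjoint, so their lengths add up to the sum that (A1) bounds uniformly in
  \<open>i\<close>.\<close>

lemma emeasure_base_union_le:
  assumes i: "i \<in> XX"
  shows "emeasure lborel (base_union i) \<le> ennreal rate_bound"
proof -
  define A where "A j = {base i j ..< base i j + nrm i j}" for j
  define f :: "real \<Rightarrow> real" where "f = indicator (base_union i)"
  have U: "base_union i = (\<Union>j\<in>XX - {i}. A j)" by (simp add: base_union_def A_def)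
  have nn: "0 \<le> nrm i j" if "j \<in> XX - {i}" for j
    using nrm_nonneg[OF XX2I[OF i that]] .
  have P: "integrable lborel f \<and> (LINT v|lborel. f v) = (\<Sum>\<^sub>\<infinity>j\<in>XX - {i}. nrm i j * 1)"
  proof (rule integral_countable_partition[of "XX - {i}" A lborel "nrm i" f "\<lambda>_. 1" 1])
    show "disjoint_family_on A (XX - {i})"
      unfolding disjoint_family_on_def A_def
      by (intro ballI impI base_disjoint XX2I i) auto
  next
    fix j assume j: "j \<in> XX - {i}"
    show "emeasure lborel (A j) = ennreal (nrm i j)"
      using nn[OF j] by (simp add: A_def)
    show "f v = 1" if "v \<in> A j" for v
      using that j by (auto simp: f_def U indicator_def)
  next
    fix v assume "\<And>j. j \<in> XX - {i} \<Longrightarrow> v \<notin> A j"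
    then show "f v = 0" by (auto simp: f_def U indicator_def)
  qed (use nn i in \<open>auto simp: A_def nrm_summable\<close>)
  have "emeasure lborel (base_union i) = (\<integral>\<^sup>+v. ennreal (f v) \<partial>lborel)"
    by (simp add: f_def ennreal_indicator)
  also have "\<dots> = ennreal (LINT v|lborel. f v)"
    using P by (intro nn_integral_eq_integral) (auto simp: f_def)
  also have "\<dots> \<le> ennreal rate_bound"
    using nrm_sum_le[OF i] P by (intro ennreal_leI) simp
  finally show ?thesis .
qed

lemma emeasure_hit_le:
  assumes "z \<in> good_states"
  shows "emeasure lborel {v. jmp z v \<noteq> 0} \<le> ennreal rate_bound"
proof -
  obtain i y n where z: "z = (i, y, n)" by (cases z)
  have "{v. jmp z v \<noteq> 0} \<subseteq> base_union i"
    using jmp_in_base_union assms unfolding z by blast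
  then have "emeasure lborel {v. jmp z v \<noteq> 0} \<le> emeasure lborel (base_union i)"
    by (rule emeasure_mono) simp
  also have "\<dots> \<le> ennreal rate_bound"
    using assms by (intro emeasure_base_union_le) (simp add: z)
  finally show ?thesis .
qed

end

section \<open>Jump differences and their integral over the mark\<close>

definition bounded_on_states :: "(state \<times> state \<Rightarrow> real) \<Rightarrow> real \<Rightarrow> bool" where
  "bounded_on_states \<theta> B \<longleftrightarrow> (\<forall>z\<in>states \<times> states. \<bar>\<theta> z\<bar> \<le> B)"

lemma bounded_on_statesD: "bounded_on_states \<theta> B \<Longrightarrow> z1 \<in> states \<Longrightarrow> z2 \<in> states \<Longrightarrow> \<bar>\<theta> (z1, z2)\<bar> \<le> B"
  by (auto simp: bounded_on_states_def)

lemma bounded_on_states_diff: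
  assumes "bounded_on_states \<theta> B" "z1 \<in> states" "z2 \<in> states" "z1' \<in> states" "z2' \<in> states"
  shows "\<bar>\<theta> (z1, z2) - \<theta> (z1', z2')\<bar> \<le> 2 * B"
  using bounded_on_statesD[OF assms(1-3)] bounded_on_statesD[OF assms(1,4,5)] by linarith

context jump_rates
begin

definition jump_diff :: "(state \<times> state \<Rightarrow> real) \<Rightarrow> state \<Rightarrow> state \<Rightarrow> real \<Rightarrow> real" where
  "jump_diff \<theta> z1 z2 v = \<theta> (move z1 v, move z2 v) - \<theta> (z1, z2)"

lemma jump_diff_no_hit: "jmp z1 v = 0 \<Longrightarrow> jmp z2 v = 0 \<Longrightarrow> jump_diff \<theta> z1 z2 v = 0"
  by (simp add: jump_diff_def move_def)

lemma jump_diff_bound: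
  assumes "bounded_on_states \<theta> B" "z1 \<in> states" "z2 \<in> states"
  shows "\<bar>jump_diff \<theta> z1 z2 v\<bar> \<le> 2 * B"
  unfolding jump_diff_def by (intro bounded_on_states_diff[OF assms(1)] move_states assms)

text \<open>The marks are split according to which components they move. For equal sources the two
  intervals of a target \<open>j\<close> start at the same point \<open>base i1 j\<close>: their
  intersection has the length of the minimum, and what is left of either is again an interval, whose
  length is the positive part. For different sources no mark moves both. Each of the three classes
  is a countable partition with constant difference on every piece.\<close>

lemma jump_diff_integral:
  assumes z: "(i1, y1, n1) \<in> good_states" "(i2, y2, n2) \<in> good_states" and B: "bounded_on_states \<theta> B"
  defines "z1 \<equiv> (i1, y1, n1)" and "z2 \<equiv> (i2, y2, n2)"
  shows "integrable lborel (jump_diff \<theta> z1 z2)"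
    and "(LINT v|lborel. jump_diff \<theta> z1 z2 v) =
     (\<Sum>\<^sub>\<infinity>j\<in>XX - {i1}. max 0 (lam i1 j y1 n1 - kron i1 i2 * lam i2 j y2 n2) *
        (\<theta> ((j, 0, n1 + 1), z2) - \<theta> (z1, z2))) +
     (\<Sum>\<^sub>\<infinity>j\<in>XX - {i2}. max 0 (lam i2 j y2 n2 - kron i1 i2 * lam i1 j y1 n1) *
        (\<theta> (z1, (j, 0, n2 + 1)) - \<theta> (z1, z2))) +
     kron i1 i2 * (\<Sum>\<^sub>\<infinity>j\<in>XX - {i1, i2}. min (lam i1 j y1 n1) (lam i2 j y2 n2) *
        (\<theta> ((j, 0, n1 + 1), (j, 0, n2 + 1)) - \<theta> (z1, z2)))"
proof -
  let ?D = "jump_diff \<theta> z1 z2"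
  have s: "z1 \<in> states" "z2 \<in> states" using z by (auto simp: z1_def z2_def)
  have i: "i1 \<in> XX" "i2 \<in> XX" and y: "0 \<le> y1" "0 \<le> y2" using z by auto
  define k where "k = kron i1 i2"
  have k: "k = (if i1 = i2 then 1 else 0)" by (simp add: k_def kron_def)
  have l0: "0 \<le> lam i1 j y1 n1" "lam i1 j y1 n1 \<le> nrm i1 j" if "j \<in> XX - {i1}" for j
    using XX2I[OF i(1) that] lam_nonneg lam_le_nrm z by auto
  have l0': "0 \<le> lam i2 j y2 n2" "lam i2 j y2 n2 \<le> nrm i2 j" if "j \<in> XX - {i2}" for j
    using XX2I[OF i(2) that] lam_nonneg lam_le_nrm z by auto
  have L: "Lam lam prec i1 j y1 n1 = {base i1 j ..< base i1 j + lam i1 j y1 n1}"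
    "Lam lam prec i2 j y2 n2 = {base i2 j ..< base i2 j + lam i2 j y2 n2}" for j
    using z by (auto simp: Lam_off_bad)
  have both: "i1 = i2" "jmp z1 v = jmp z2 v" if "jmp z1 v \<noteq> 0" "jmp z2 v \<noteq> 0" for v
    using jmp_both[OF z, folded z1_def z2_def, of v] that by auto
  have j1: "jmp z1 v = j \<longleftrightarrow> base i1 j \<le> v \<and> v < base i1 j + lam i1 j y1 n1" if "j \<in> XX - {i1}" for j v
    using jmp_iff[of i1 y1 j n1 v] that i y unfolding L by (auto simp: z1_def XX_def)
  have j2: "jmp z2 v = j \<longleftrightarrow> base i2 j \<le> v \<and> v < base i2 j + lam i2 j y2 n2" if "j \<in> XX - {i2}" for j v
    using jmp_iff[of i2 y2 j n2 v] that i y unfolding L by (auto simp: z2_def XX_def)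
  have jX: "jmp z1 v \<noteq> 0 \<Longrightarrow> jmp z1 v \<in> XX - {i1}" "jmp z2 v \<noteq> 0 \<Longrightarrow> jmp z2 v \<in> XX - {i2}" for v
    using jmp_nonzeroD(1)[OF refl] by (auto simp: z1_def z2_def)
  have n0: "j \<in> XX - {i'} \<Longrightarrow> j \<noteq> 0" for j i' by (auto simp: XX_def)
  define D1 where "D1 v = (if jmp z1 v \<noteq> 0 \<and> jmp z2 v = 0 then ?D v else 0)" for v
  define D2 where "D2 v = (if jmp z2 v \<noteq> 0 \<and> jmp z1 v = 0 then ?D v else 0)" for v
  define D3 where "D3 v = (if jmp z1 v \<noteq> 0 \<and> jmp z2 v \<noteq> 0 then ?D v else 0)" for v
  have split: "?D = (\<lambda>v. D1 v + D2 v + D3 v)"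
    by (rule ext) (auto simp: D1_def D2_def D3_def jump_diff_no_hit)
  \<comment> \<open>The common left part of the two intervals is cut off; the factor
    \<open>k\<close> switches the cut off when the sources differ.\<close>
  define A1 where "A1 j = {base i1 j + k * min (lam i1 j y1 n1) (lam i2 j y2 n2) ..< base i1 j + lam i1 j y1 n1}" for j
  define A2 where "A2 j = {base i2 j + k * min (lam i2 j y2 n2) (lam i1 j y1 n1) ..< base i2 j + lam i2 j y2 n2}" for j
  define A3 where "A3 j = {base i1 j ..< base i1 j + min (lam i1 j y1 n1) (lam i2 j y2 n2)}" for j
  have A1: "v \<in> A1 j \<longleftrightarrow> jmp z1 v = j \<and> jmp z2 v = 0" if "j \<in> XX - {i1}" for j v
  proof (cases "i1 = i2")
    case True
    have "jmp z1 v = j \<and> jmp z2 v = 0 \<longleftrightarrow> jmp z1 v = j \<and> jmp z2 v \<noteq> j"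
      using both(2)[of v] n0[OF that] by (cases "jmp z2 v = 0") auto
    also have "\<dots> \<longleftrightarrow> v \<in> A1 j"
      using True that l0(1)[OF that] l0'(1)[of j] j1[OF that, of v] j2[of j v] by (auto simp: A1_def k)
    finally show ?thesis by simp
  next
    case False
    then have "jmp z1 v = j \<and> jmp z2 v = 0 \<longleftrightarrow> jmp z1 v = j"
      using both(1)[of v] n0[OF that] by auto
    then show ?thesis using False that by (simp add: j1 A1_def k)
  qed
  have A2: "v \<in> A2 j \<longleftrightarrow> jmp z2 v = j \<and> jmp z1 v = 0" if "j \<in> XX - {i2}" for j v
  proof (cases "i1 = i2")
    case True
    have "jmp z2 v = j \<and> jmp z1 v = 0 \<longleftrightarrow> jmp z2 v = j \<and> jmp z1 v \<noteq> j"
      using both(2)[of v] n0[OF that] by (cases "jmp z1 v = 0") auto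
    also have "\<dots> \<longleftrightarrow> v \<in> A2 j"
      using True that l0(1)[of j] l0'(1)[OF that] j2[OF that, of v] j1[of j v] by (auto simp: A2_def k)
    finally show ?thesis by simp
  next
    case False
    then have "jmp z2 v = j \<and> jmp z1 v = 0 \<longleftrightarrow> jmp z2 v = j"
      using both(1)[of v] n0[OF that] by auto
    then show ?thesis using False that by (simp add: j2 A2_def k)
  qed
  have A3: "v \<in> A3 j \<longleftrightarrow> jmp z1 v = j \<and> jmp z2 v = j" if "j \<in> XX - {i1}" "i1 = i2" for j v
    using that j1[OF that(1), of v] j2[of j v] by (auto simp: A3_def)
  have nsum: "nrm i1 summable_on XX - {i1}" "nrm i2 summable_on XX - {i2}"
    using nrm_summable i by auto
  define m1 where "m1 j = max 0 (lam i1 j y1 n1 - k * lam i2 j y2 n2)" for j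
  define m2 where "m2 j = max 0 (lam i2 j y2 n2 - k * lam i1 j y1 n1)" for j
  define m3 where "m3 j = min (lam i1 j y1 n1) (lam i2 j y2 n2)" for j
  have m1le: "m1 j \<le> nrm i1 j" if "j \<in> XX - {i1}" for j
    using l0[OF that] l0'[of j] that by (cases "i1 = i2") (auto simp: m1_def k)
  have m2le: "m2 j \<le> nrm i2 j" if "j \<in> XX - {i2}" for j
    using l0'[OF that] l0[of j] that by (cases "i1 = i2") (auto simp: m2_def k)
  have bound: "\<bar>\<theta> (a, b) - \<theta> (z1, z2)\<bar> \<le> 2 * B" if "a \<in> states" "b \<in> states" for a b
    using bounded_on_states_diff[OF B that s] .
  note P1 = integral_countable_partition[of "XX - {i1}" A1 lborel m1 D1
     "\<lambda>j. \<theta> ((j, 0, n1 + 1), z2) - \<theta> (z1, z2)" "2 * B"]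
  note P2 = integral_countable_partition[of "XX - {i2}" A2 lborel m2 D2
     "\<lambda>j. \<theta> (z1, (j, 0, n2 + 1)) - \<theta> (z1, z2)" "2 * B"]
  note P3 = integral_countable_partition[of "XX - {i1}" A3 lborel m3 D3
     "\<lambda>j. \<theta> ((j, 0, n1 + 1), (j, 0, n2 + 1)) - \<theta> (z1, z2)" "2 * B"]
  have r1: "integrable lborel D1 \<and> (LINT v|lborel. D1 v) =
      (\<Sum>\<^sub>\<infinity>j\<in>XX - {i1}. m1 j * (\<theta> ((j, 0, n1 + 1), z2) - \<theta> (z1, z2)))"
  proof (rule P1)
    fix j assume j: "j \<in> XX - {i1}"
    show "emeasure lborel (A1 j) = ennreal (m1 j)"
      using l0[OF j] by (auto simp: A1_def m1_def k emeasure_lborel_Ico min_def max_def intro!: arg_cong[where f=ennreal])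
    show "D1 v = \<theta> ((j, 0, n1 + 1), z2) - \<theta> (z1, z2)" if "v \<in> A1 j" for v
      using that A1[OF j] n0[OF j] by (auto simp: D1_def jump_diff_def move_def z1_def)
  next
    show "disjoint_family_on A1 (XX - {i1})"
      using A1 by (force simp: disjoint_family_on_def)
    show "m1 summable_on XX - {i1}"
      by (rule summable_on_comparison_test[OF nsum(1)]) (use m1le in \<open>auto simp: m1_def\<close>)
  next
    fix v assume h: "\<And>j. j \<in> XX - {i1} \<Longrightarrow> v \<notin> A1 j"
    have "\<not> (jmp z1 v \<noteq> 0 \<and> jmp z2 v = 0)"
      using A1[OF jX(1), of v v] h[OF jX(1), of v] by blast
    then show "D1 v = 0" by (auto simp: D1_def)
  qed (use s in \<open>auto simp: A1_def m1_def intro!: bound\<close>)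
  have r2: "integrable lborel D2 \<and> (LINT v|lborel. D2 v) =
      (\<Sum>\<^sub>\<infinity>j\<in>XX - {i2}. m2 j * (\<theta> (z1, (j, 0, n2 + 1)) - \<theta> (z1, z2)))"
  proof (rule P2)
    fix j assume j: "j \<in> XX - {i2}"
    show "emeasure lborel (A2 j) = ennreal (m2 j)"
      using l0'[OF j] by (auto simp: A2_def m2_def k emeasure_lborel_Ico min_def max_def intro!: arg_cong[where f=ennreal])
    show "D2 v = \<theta> (z1, (j, 0, n2 + 1)) - \<theta> (z1, z2)" if "v \<in> A2 j" for v
      using that A2[OF j] n0[OF j] by (auto simp: D2_def jump_diff_def move_def z2_def)
  next
    show "disjoint_family_on A2 (XX - {i2})"
      using A2 by (force simp: disjoint_family_on_def)
    show "m2 summable_on XX - {i2}"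
      by (rule summable_on_comparison_test[OF nsum(2)]) (use m2le in \<open>auto simp: m2_def\<close>)
  next
    fix v assume h: "\<And>j. j \<in> XX - {i2} \<Longrightarrow> v \<notin> A2 j"
    have "\<not> (jmp z2 v \<noteq> 0 \<and> jmp z1 v = 0)"
      using A2[OF jX(2), of v v] h[OF jX(2), of v] by blast
    then show "D2 v = 0" by (auto simp: D2_def)
  qed (use s in \<open>auto simp: A2_def m2_def intro!: bound\<close>)
  \<comment> \<open>For \<open>i1 = i2\<close> the index set \<open>XX - {i1, i2}\<close> is
    \<open>XX - {i1}\<close>; otherwise simultaneous jumps are impossible and both sides
    vanish.\<close>
  have r3: "integrable lborel D3 \<and> (LINT v|lborel. D3 v) =
      k * (\<Sum>\<^sub>\<infinity>j\<in>XX - {i1, i2}. m3 j * (\<theta> ((j, 0, n1 + 1), (j, 0, n2 + 1)) - \<theta> (z1, z2)))"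
  proof (cases "i1 = i2")
    case True
    have "integrable lborel D3 \<and> (LINT v|lborel. D3 v) =
      (\<Sum>\<^sub>\<infinity>j\<in>XX - {i1}. m3 j * (\<theta> ((j, 0, n1 + 1), (j, 0, n2 + 1)) - \<theta> (z1, z2)))"
    proof (rule P3)
      fix j assume j: "j \<in> XX - {i1}"
      show "emeasure lborel (A3 j) = ennreal (m3 j)"
        using l0[OF j] l0'[of j] j True by (auto simp: A3_def m3_def emeasure_lborel_Ico)
      show "D3 v = \<theta> ((j, 0, n1 + 1), (j, 0, n2 + 1)) - \<theta> (z1, z2)" if "v \<in> A3 j" for v
        using that A3[OF j True] n0[OF j] by (auto simp: D3_def jump_diff_def move_def z1_def z2_def)
      show "0 \<le> m3 j" using l0[OF j] l0'[of j] j True by (auto simp: m3_def)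
    next
      show "disjoint_family_on A3 (XX - {i1})"
        using A3[OF _ True] by (force simp: disjoint_family_on_def)
      show "m3 summable_on XX - {i1}"
        by (rule summable_on_comparison_test[OF nsum(1)]) (use l0 l0' True in \<open>auto simp: m3_def intro: min.coboundedI1\<close>)
    next
      fix v assume h: "\<And>j. j \<in> XX - {i1} \<Longrightarrow> v \<notin> A3 j"
      have "\<not> (jmp z1 v \<noteq> 0 \<and> jmp z2 v \<noteq> 0)"
        using A3[OF jX(1) True, of v v] h[OF jX(1), of v] both(2)[of v] by metis
      then show "D3 v = 0" by (auto simp: D3_def)
    qed (use s in \<open>auto simp: A3_def m3_def intro!: bound\<close>)
    then show ?thesis using True by (simp add: k)
  next
    case False
    then have "D3 = (\<lambda>_. 0)" using both(1) unfolding D3_def by (intro ext) metis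
    then show ?thesis using False by (simp add: k)
  qed
  show "integrable lborel ?D" unfolding split using r1 r2 r3 by auto
  show "(LINT v|lborel. ?D v) =
     (\<Sum>\<^sub>\<infinity>j\<in>XX - {i1}. max 0 (lam i1 j y1 n1 - kron i1 i2 * lam i2 j y2 n2) *
        (\<theta> ((j, 0, n1 + 1), z2) - \<theta> (z1, z2))) +
     (\<Sum>\<^sub>\<infinity>j\<in>XX - {i2}. max 0 (lam i2 j y2 n2 - kron i1 i2 * lam i1 j y1 n1) *
        (\<theta> (z1, (j, 0, n2 + 1)) - \<theta> (z1, z2))) +
     kron i1 i2 * (\<Sum>\<^sub>\<infinity>j\<in>XX - {i1, i2}. min (lam i1 j y1 n1) (lam i2 j y2 n2) *
        (\<theta> ((j, 0, n1 + 1), (j, 0, n2 + 1)) - \<theta> (z1, z2)))"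
    unfolding split using r1 r2 r3 by (simp add: m1_def m2_def m3_def k_def)
qed

lemma gen_integral_eq:
  assumes "z1 \<in> states" "z2 \<in> states"
  shows "gen_integral lam prec \<phi> (z1, z2) =
    dy1 \<phi> (z1, z2) + dy2 \<phi> (z1, z2) + (LINT v|lborel. jump_diff \<phi> z1 z2 v)"
proof -
  have "(LINT v:{0..}|lborel. \<phi> (shift z1 (J lam prec z1 v), shift z2 (J lam prec z2 v)) - \<phi> (z1, z2))
     = (LINT v|lborel. jump_diff \<phi> z1 z2 v)"
    unfolding set_lebesgue_integral_def shift_J[OF assms(1)] shift_J[OF assms(2)]
    using jmp_nonneg_arg[of z1] jmp_nonneg_arg[of z2] jump_diff_no_hit[of z1 _ z2 \<phi>]
    by (intro Bochner_Integration.integral_cong) (auto simp: indicator_def jump_diff_def)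
  then show ?thesis by (simp add: gen_integral_def)
qed

lemma gen_sum_eq:
  assumes "z1 \<in> good_states" "z2 \<in> good_states" "bounded_on_states \<phi> B"
  shows "gen_sum lam \<phi> (z1, z2) = gen_integral lam prec \<phi> (z1, z2)"
proof -
  obtain i1 y1 n1 i2 y2 n2 where z: "z1 = (i1, y1, n1)" "z2 = (i2, y2, n2)"
    by (cases z1, cases z2)
  show ?thesis
    unfolding gen_integral_eq[OF good_states_subset[OF assms(1)] good_states_subset[OF assms(2)]]
    unfolding z jump_diff_integral(2)[OF assms(1,2)[unfolded z] assms(3)]
    by (simp add: gen_sum_def Let_def)
qed

text \<open>The difference is at most \<open>2 * B\<close> and vanishes unless one of the components
  is hit. Each is hit by marks of total length at most \<open>rate_bound\<close>, hence the factor
  4.\<close>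

lemma jump_diff_nn_integral:
  assumes "z1 \<in> good_states" "z2 \<in> good_states" "bounded_on_states \<theta> B"
  shows "(\<integral>\<^sup>+v. ennreal \<bar>jump_diff \<theta> z1 z2 v\<bar> \<partial>lborel) \<le> ennreal (4 * B * rate_bound)"
proof -
  note s = good_states_subset[OF assms(1)] good_states_subset[OF assms(2)]
  note [measurable] = jmp_section_measurable[OF s(1)] jmp_section_measurable[OF s(2)]
  have B0: "0 \<le> B" using bounded_on_statesD[OF assms(3) s] by linarith
  let ?H = "\<lambda>z. indicator {v. jmp z v \<noteq> 0} :: real \<Rightarrow> ennreal"
  have "(\<integral>\<^sup>+v. ennreal \<bar>jump_diff \<theta> z1 z2 v\<bar> \<partial>lborel) \<le> (\<integral>\<^sup>+v. ennreal (2 * B) * (?H z1 v + ?H z2 v) \<partial>lborel)"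
  proof (rule nn_integral_mono)
    fix v
    have 1: "ennreal \<bar>jump_diff \<theta> z1 z2 v\<bar> \<le> ennreal (2 * B)"
      by (intro ennreal_leI jump_diff_bound[OF assms(3) s])
    show "ennreal \<bar>jump_diff \<theta> z1 z2 v\<bar> \<le> ennreal (2 * B) * (?H z1 v + ?H z2 v)"
      using jump_diff_no_hit[of z1 v z2 \<theta>] order_trans[OF 1]
      by (auto simp: indicator_def mult_2_right intro: order_trans[OF 1])
  qed
  also have "\<dots> = ennreal (2 * B) * (emeasure lborel {v. jmp z1 v \<noteq> 0} + emeasure lborel {v. jmp z2 v \<noteq> 0})"
    by (subst nn_integral_cmult; (subst nn_integral_add)?) auto
  also have "\<dots> \<le> ennreal (2 * B) * (ennreal rate_bound + ennreal rate_bound)"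
    by (intro mult_left_mono add_mono emeasure_hit_le assms) auto
  also have "\<dots> = ennreal (4 * B * rate_bound)"
    using B0 rate_bound_nonneg
    by (simp flip: ennreal_plus ennreal_mult add: algebra_simps)
  finally show ?thesis .
qed

end

section \<open>Compensation of predictable integrals\<close>

lemma space_m2: "space m2 = {0..} \<times> UNIV"
  by (simp add: m2_def space_restrict_space)

lemma sets_m2: "A \<in> sets m2 \<longleftrightarrow> A \<in> sets borel \<and> A \<subseteq> {0..} \<times> UNIV"
  unfolding m2_def by (subst sets_restrict_space_iff) (auto simp flip: borel_prod)

lemma m2_Times: "0 \<le> a \<Longrightarrow> C \<in> sets borel \<Longrightarrow> {a<..b} \<times> C \<in> sets m2"
  unfolding sets_m2 by (auto simp flip: borel_prod)

lemma emeasure_m2_Times: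
  assumes "0 \<le> a" "a \<le> b" "C \<in> sets borel"
  shows "emeasure m2 ({a<..b} \<times> C) = ennreal (b - a) * emeasure lborel C"
proof -
  have "emeasure m2 ({a<..b} \<times> C) = emeasure (lborel \<Otimes>\<^sub>M lborel) ({a<..b} \<times> C)"
    unfolding m2_def lborel_prod using assms
    by (subst emeasure_restrict_space) (auto simp flip: borel_prod)
  also have "\<dots> = ennreal (b - a) * emeasure lborel C"
    using assms by (subst lborel.emeasure_pair_measure_Times) auto
  finally show ?thesis .
qed

section \<open>The Poisson random measure and its filtration\<close>

locale prm_space = prob_space M for M :: "'w measure" +
  fixes F :: "real \<Rightarrow> 'w measure" and P :: "'w \<Rightarrow> (real \<times> real) measure"
  assumes filtration: "usual_filtration M F"
    and adapted: "adapted_prm M F P"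
begin

lemma prm: "poisson_random_measure M m2 P"
  using adapted by (simp add: adapted_prm_def)

lemma F_subalgebra: "0 \<le> t \<Longrightarrow> subalgebra M (F t)"
  using filtration[unfolded usual_filtration_def, THEN conjunct1] by simp

lemma space_F: "0 \<le> t \<Longrightarrow> space (F t) = space M"
  using F_subalgebra by (simp add: subalgebra_def)

lemma F_subset_M: "0 \<le> t \<Longrightarrow> A \<in> sets (F t) \<Longrightarrow> A \<in> sets M"
  using F_subalgebra by (auto simp: subalgebra_def)

lemma F_mono: "0 \<le> s \<Longrightarrow> s \<le> t \<Longrightarrow> A \<in> sets (F s) \<Longrightarrow> A \<in> sets (F t)"
  using filtration unfolding usual_filtration_def by blast

lemma F_measurable_mono: "0 \<le> s \<Longrightarrow> s \<le> t \<Longrightarrow> f \<in> F s \<rightarrow>\<^sub>M N \<Longrightarrow> f \<in> F t \<rightarrow>\<^sub>M N"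
  using F_mono[of s t] space_F[of s] space_F[of t]
  by (intro measurable_from_subalg[of "F t" "F s"]) (auto simp: subalgebra_def)

lemma F_measurable_M: "0 \<le> t \<Longrightarrow> f \<in> F t \<rightarrow>\<^sub>M N \<Longrightarrow> f \<in> M \<rightarrow>\<^sub>M N"
  using F_subalgebra measurable_from_subalg by blast

lemma null_in_F:
  assumes "N \<in> null_sets M" "A \<subseteq> N" "0 \<le> t"
  shows "A \<in> sets (F t)" "A \<in> null_sets M"
proof -
  have "complete_measure M" "null_sets M \<subseteq> sets (F 0)"
    using filtration[unfolded usual_filtration_def, THEN conjunct2, THEN conjunct2, THEN conjunct2]
    by simp_all
  then show "A \<in> null_sets M"
    using assms complete_measure.complete2 by blast
  with \<open>null_sets M \<subseteq> sets (F 0)\<close> show "A \<in> sets (F t)"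
    using F_mono[of 0 t] assms by auto
qed

text \<open>The usual hypothesis puts every subset of a null set into \<open>F t\<close>, so a
  function may be altered on such a set without losing adaptedness. Differences of possibly infinite
  values and pathwise integrals are defined well only almost surely and rely on this.\<close>

lemma F_measurable_AE:
  assumes t: "0 \<le> t" and f: "f \<in> F t \<rightarrow>\<^sub>M N" and g: "\<And>w. w \<in> space M \<Longrightarrow> g w \<in> space N"
    and ae: "AE w in M. f w = g w"
  shows "g \<in> F t \<rightarrow>\<^sub>M N"
proof (rule measurableI)
  show "w \<in> space (F t) \<Longrightarrow> g w \<in> space N" for w using g space_F[OF t] by simp
  fix A assume A: "A \<in> sets N"
  obtain Z where Z: "Z \<in> null_sets M" "{w\<in>space M. f w \<noteq> g w} \<subseteq> Z"
    using ae by (auto elim!: AE_E simp: null_sets_def)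
  have "g -` A \<inter> space (F t) = (f -` A \<inter> space (F t) - {w\<in>space M. f w \<noteq> g w}) \<union>
     {w\<in>space M. f w \<noteq> g w \<and> g w \<in> A}"
    using space_F[OF t] by auto
  moreover have "{w\<in>space M. f w \<noteq> g w} \<in> sets (F t)" "{w\<in>space M. f w \<noteq> g w \<and> g w \<in> A} \<in> sets (F t)"
    using Z by (auto intro!: null_in_F[OF Z(1) _ t])
  ultimately show "g -` A \<inter> space (F t) \<in> sets (F t)"
    using measurable_sets[OF f A] by auto
qed

lemma sets_P: "w \<in> space M \<Longrightarrow> sets (P w) = sets m2"
  using prm by (simp add: poisson_random_measure_def)

lemma P_integer:
  "w \<in> space M \<Longrightarrow> B \<in> sets m2 \<Longrightarrow> emeasure (P w) B \<in> insert \<infinity> (range of_nat)"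
  using prm by (simp add: poisson_random_measure_def)

lemma P_measurable: "B \<in> sets m2 \<Longrightarrow> (\<lambda>w. emeasure (P w) B) \<in> borel_measurable M"
  using prm by (simp add: poisson_random_measure_def)

lemma P_prob:
  "B \<in> sets m2 \<Longrightarrow> emeasure m2 B < \<infinity> \<Longrightarrow>
    prob {w\<in>space M. emeasure (P w) B = of_nat k} = exp (- measure m2 B) * measure m2 B ^ k / fact k"
  using prm by (simp add: poisson_random_measure_def)

lemma P_indep:
  assumes "0 \<le> s" "A \<in> sets (F s)" "C \<in> sets m2" "C \<subseteq> {s<..} \<times> UNIV"
  shows "prob (A \<inter> {w\<in>space M. emeasure (P w) C = of_nat k}) =
    prob A * prob {w\<in>space M. emeasure (P w) C = of_nat k}"
proof -
  have "indep_set (sets (F s)) (sigma_sets (space M)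
          {{w\<in>space M. emeasure (P w) C \<in> A} | C A.
             C \<in> sets m2 \<and> C \<subseteq> {s<..} \<times> UNIV \<and> A \<in> sets borel})"
    using adapted assms(1) by (simp add: adapted_prm_def)
  moreover have "{w\<in>space M. emeasure (P w) C \<in> {of_nat k}} \<in> sigma_sets (space M)
          {{w\<in>space M. emeasure (P w) C \<in> A} | C A.
             C \<in> sets m2 \<and> C \<subseteq> {s<..} \<times> UNIV \<and> A \<in> sets borel}"
    using assms
    by (intro sigma_sets.Basic CollectI exI[of _ C] exI[of _ "{of_nat k}"] conjI refl) auto
  ultimately show ?thesis
    using assms(2) indep_setD by fastforce
qed

text \<open>The Poisson weights sum to 1, which leaves no probability for the value
  \<infinity>.\<close>

lemma P_finite:
  assumes "B \<in> sets m2" "emeasure m2 B < \<infinity>"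
  shows "AE w in M. emeasure (P w) B < \<infinity>"
proof -
  let ?m = "measure m2 B"
  let ?E = "\<lambda>k. {w\<in>space M. emeasure (P w) B = of_nat k}"
  have E: "?E k \<in> events" for k
    using P_measurable[OF assms(1)] by measurable
  have "(\<lambda>k. exp (- ?m) * (?m ^ k / fact k)) sums (exp (- ?m) * exp ?m)"
    using exp_converges[of ?m] by (intro sums_mult) (simp add: divide_inverse mult.commute)
  then have "(\<lambda>k. prob (?E k)) sums 1"
    by (simp add: P_prob[OF assms] exp_minus)
  moreover have "(\<lambda>k. prob (?E k)) sums prob (\<Union>k. ?E k)"
    by (rule finite_measure_UNION) (use E in \<open>auto simp: disjoint_family_on_def\<close>)
  ultimately have "prob (\<Union>k. ?E k) = 1"
    using sums_unique2 by blast
  then have "AE w in M. w \<in> (\<Union>k. ?E k)"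
    using E by (subst (asm) prob_eq_1) auto
  then show ?thesis
    by eventually_elim (auto simp: of_nat_less_top)
qed

text \<open>The integral is decomposed by the value \<open>k\<close> of the count; independence of
  the past factorises each term and the Poisson series sums to the mean.\<close>

lemma P_mean:
  assumes "0 \<le> s" "A \<in> sets (F s)" "C \<in> sets m2" "C \<subseteq> {s<..} \<times> UNIV" "emeasure m2 C < \<infinity>"
  shows "(\<integral>\<^sup>+w. indicator A w * emeasure (P w) C \<partial>M) = emeasure M A * emeasure m2 C"
proof -
  let ?m = "measure m2 C"
  let ?E = "\<lambda>k. {w\<in>space M. emeasure (P w) C = of_nat k}"
  have E [measurable]: "?E k \<in> events" for k
    using P_measurable[OF assms(3)] by measurable
  have A [measurable]: "A \<in> events" using F_subset_M assms by blast
  have "AE w in M. indicator A w * emeasure (P w) C = (\<Sum>k. of_nat k * indicator (A \<inter> ?E k) w)"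
    using P_finite[OF assms(3,5)] AE_space
  proof eventually_elim
    case (elim w)
    then obtain k where k: "emeasure (P w) C = of_nat k"
      using P_integer[OF _ assms(3), of w] by auto
    have "(\<lambda>j. of_nat j * indicator (A \<inter> ?E j) w :: ennreal) sums (\<Sum>j\<in>{k}. of_nat j * indicator (A \<inter> ?E j) w)"
      by (rule sums_finite) (auto simp: indicator_def k)
    then show ?case
      using elim k by (auto simp: sums_iff indicator_def)
  qed
  then have "(\<integral>\<^sup>+w. indicator A w * emeasure (P w) C \<partial>M) = (\<integral>\<^sup>+w. (\<Sum>k. of_nat k * indicator (A \<inter> ?E k) w) \<partial>M)"
    by (rule nn_integral_cong_AE)
  also have "\<dots> = (\<Sum>k. \<integral>\<^sup>+w. of_nat k * indicator (A \<inter> ?E k) w \<partial>M)"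
    by (rule nn_integral_suminf) measurable
  also have "\<dots> = (\<Sum>k. of_nat k * emeasure M (A \<inter> ?E k))"
    by (simp add: nn_integral_cmult_indicator)
  also have "\<dots> = (\<Sum>k. ennreal (prob A * (exp (- ?m) * (real k * ?m ^ k / fact k))))"
    using P_indep[OF assms(1-4)] P_prob[OF assms(3,5)]
    by (intro suminf_cong) (simp add: emeasure_eq_measure ennreal_of_nat_eq_real_of_nat ennreal_mult'[symmetric] mult_ac)
  also have "\<dots> = ennreal (prob A * ?m)"
  proof (rule suminf_ennreal_eq)
    have "(\<lambda>k. ?m * (?m ^ k / fact k)) sums (?m * exp ?m)"
      using exp_converges[of ?m] by (intro sums_mult) (simp add: divide_inverse mult.commute)
    \<comment> \<open>The factor \<open>k\<close> cancels against the factorial; shifting the index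
      loses nothing because the term at 0 vanishes.\<close>
    then have "(\<lambda>k. real (Suc k) * ?m ^ Suc k / fact (Suc k)) sums (?m * exp ?m)"
      by (rule sums_cong[THEN iffD1, rotated]) (simp add: divide_simps del: of_nat_Suc)
    then have "(\<lambda>k. real k * ?m ^ k / fact k) sums (?m * exp ?m)"
      using sums_Suc_iff[of "\<lambda>k. real k * ?m ^ k / fact k"] by simp
    then have "(\<lambda>k. prob A * (exp (- ?m) * (real k * ?m ^ k / fact k))) sums (prob A * (exp (- ?m) * (?m * exp ?m)))"
      by (intro sums_mult)
    then show "(\<lambda>k. prob A * (exp (- ?m) * (real k * ?m ^ k / fact k))) sums (prob A * ?m)"
      by (simp add: exp_minus field_simps)
  qed auto
  also have "\<dots> = emeasure M A * emeasure m2 C"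
    using assms(5) by (simp add: emeasure_eq_measure ennreal_mult emeasure_eq_ennreal_measure less_top)
  finally show ?thesis .
qed

text \<open>From \<open>exp (- m) \<ge> 1 - m\<close> one gets
  \<open>1 - exp (- m) * (1 + m) \<le> m^2\<close>. The quadratic order beats the linear number of
  strips in the union bound that follows.\<close>

lemma P_ge_2:
  assumes "B \<in> sets m2" "emeasure m2 B < \<infinity>"
  shows "prob {w\<in>space M. 2 \<le> emeasure (P w) B} \<le> (measure m2 B)\<^sup>2"
proof -
  let ?m = "measure m2 B"
  let ?E = "\<lambda>k. {w\<in>space M. emeasure (P w) B = of_nat k}"
  have E [measurable]: "?E k \<in> events" for k
    using P_measurable[OF assms(1)] by measurable
  have G: "{w\<in>space M. 2 \<le> emeasure (P w) B} \<in> events"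
    using P_measurable[OF assms(1)] by measurable
  have "{w\<in>space M. 2 \<le> emeasure (P w) B} = space M - (?E 0 \<union> ?E 1)"
  proof (intro set_eqI iffI)
    fix w assume w: "w \<in> space M - (?E 0 \<union> ?E 1)"
    then have "emeasure (P w) B = \<infinity> \<or> (\<exists>k. emeasure (P w) B = of_nat k)"
      using P_integer[OF _ assms(1), of w] by auto
    then show "w \<in> {w\<in>space M. 2 \<le> emeasure (P w) B}"
    proof
      assume "\<exists>k. emeasure (P w) B = of_nat k"
      then obtain k where k: "emeasure (P w) B = of_nat k" by blast
      then have "k \<noteq> 0" "k \<noteq> 1" using w by auto
      then have "2 \<le> k" by simp
      then have "of_nat 2 \<le> (of_nat k :: ennreal)" by (simp only: of_nat_le_iff)
      then show ?thesis using w k by simp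
    qed (use w in simp)
  qed auto
  then have "prob {w\<in>space M. 2 \<le> emeasure (P w) B} = 1 - prob (?E 0 \<union> ?E 1)"
    using prob_compl[OF sets.Un[OF E[of 0] E[of 1]]] by (simp only:)
  also have "prob (?E 0 \<union> ?E 1) = prob (?E 0) + prob (?E 1)"
    by (rule finite_measure_Union[OF E E]) auto
  also have "\<dots> = exp (- ?m) * (1 + ?m)"
    using P_prob[OF assms, of 0] P_prob[OF assms, of 1] by (simp add: algebra_simps)
  also have "1 - exp (- ?m) * (1 + ?m) \<le> 1 - (1 - ?m) * (1 + ?m)"
    using exp_ge_add_one_self[of "- ?m"] by (intro diff_left_mono mult_right_mono) auto
  also have "\<dots> = ?m\<^sup>2" by (simp add: power2_eq_square algebra_simps)
  finally show ?thesis .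
qed

text \<open>The time interval is divided into \<open>n + 1\<close> strips of equal width. Mass two
  on a slice forces mass two on some strip; a strip has intensity of order \<open>1/n\<close>, so
  this has probability of order \<open>1/n^2\<close>, and of order \<open>1/n\<close> for the union
  of the strips.\<close>

lemma simple_in_box:
  "AE w in M. \<forall>u\<in>{0<..real K}. \<not> 2 \<le> emeasure (P w) ({u} \<times> {-real K..real K})"
proof -
  define I where "I n k = {real k * (K / real (Suc n))<..real (Suc k) * (K / real (Suc n))} \<times> {-real K..real K}" for n k
  define U where "U n = (\<Union>k\<in>{..n}. {w\<in>space M. 2 \<le> emeasure (P w) (I n k)})" for n
  have I: "I n k \<in> sets m2" for n k unfolding I_def by (rule m2_Times) auto
  have eI: "emeasure m2 (I n k) = ennreal (2 * (real K)\<^sup>2 / real (Suc n))" for n k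
  proof -
    have d: "real (Suc k) * x - real k * x = x" for x by (simp add: algebra_simps)
    have "real k * (K / real (Suc n)) \<le> real (Suc k) * (K / real (Suc n))"
      by (intro mult_right_mono) auto
    then have "emeasure m2 (I n k) = ennreal (K / real (Suc n)) * ennreal (2 * real K)"
      unfolding I_def by (subst emeasure_m2_Times) (simp_all only: d, auto)
    then show ?thesis by (simp add: ennreal_mult'[symmetric] power2_eq_square mult_ac)
  qed
  have mI: "measure m2 (I n k) = 2 * (real K)\<^sup>2 / real (Suc n)" for n k
    using eI by (simp add: measure_def)
  have ev: "{w\<in>space M. 2 \<le> emeasure (P w) (I n k)} \<in> events" for n k
    using P_measurable[OF I] by measurable
  have Um: "U n \<in> events" for n unfolding U_def using ev by auto
  have U: "prob (U n) \<le> 4 * real K ^ 4 / real (Suc n)" for n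
  proof -
    have "prob (U n) \<le> (\<Sum>k\<in>{..n}. prob {w\<in>space M. 2 \<le> emeasure (P w) (I n k)})"
      unfolding U_def by (rule finite_measure_subadditive_finite) (use ev in auto)
    also have "\<dots> \<le> (\<Sum>k\<in>{..n}. (2 * (real K)\<^sup>2 / real (Suc n))\<^sup>2)"
    proof (rule sum_mono)
      fix k
      have "emeasure m2 (I n k) < \<infinity>" by (simp add: eI)
      from P_ge_2[OF I this] show "prob {w\<in>space M. 2 \<le> emeasure (P w) (I n k)} \<le> (2 * (real K)\<^sup>2 / real (Suc n))\<^sup>2"
        unfolding mI .
    qed
    also have "\<dots> = real (Suc n) * (2 * (real K)\<^sup>2 / real (Suc n))\<^sup>2" by simp
    also have "\<dots> = 4 * real K ^ 4 / real (Suc n)"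
    proof -
      have "N * (2 * x\<^sup>2 / N)\<^sup>2 = 4 * x ^ 4 / N" if "N > 0" for N x :: real
        using that by (simp add: power2_eq_square power4_eq_xxxx)
      then show ?thesis by simp
    qed
    finally show ?thesis .
  qed
  have "(\<lambda>n. 4 * real K ^ 4 / real (Suc n)) \<longlonglongrightarrow> 0"
    by (rule LIMSEQ_Suc) (rule lim_const_over_n)
  moreover have "prob (\<Inter>n. U n) \<le> 4 * real K ^ 4 / real (Suc n)" for n
    by (rule order_trans[OF finite_measure_mono U]) (use Um in auto)
  ultimately have "prob (\<Inter>n. U n) \<le> 0"
    using LIMSEQ_le_const by blast
  then have "(\<Inter>n. U n) \<in> null_sets M"
    using Um by (auto simp: null_sets_def emeasure_eq_measure measure_le_0_iff)
  then have "AE w in M. w \<notin> (\<Inter>n. U n)" by (rule AE_not_in)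
  then show ?thesis using AE_space
  proof eventually_elim
    case (elim w)
    then obtain n where n: "w \<notin> U n" by blast
    show ?case
    proof (intro ballI notI)
      fix u assume u: "u \<in> {0<..real K}" "2 \<le> emeasure (P w) ({u} \<times> {-real K..real K})"
      let ?d = "K / real (Suc n)"
      have d: "0 < ?d" using u by auto
      \<comment> \<open>Grid intervals are open on the left and closed on the right, so the index is
        the ceiling minus one; a floor would misplace grid points.\<close>
      define k where "k = nat (\<lceil>u / ?d\<rceil> - 1)"
      have "0 < u / ?d" using u d by simp
      then have k: "real k = of_int \<lceil>u / ?d\<rceil> - 1" unfolding k_def by (simp add: of_nat_nat) 
      have "real k < u / ?d" "u / ?d \<le> real (Suc k)" using k ceiling_correct[of "u / ?d"] by auto
      then have 1: "u \<in> {real k * ?d<..real (Suc k) * ?d}"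
        using d by (simp only: greaterThanAtMost_iff pos_less_divide_eq pos_divide_le_eq)
      have "real k < real (Suc n)"
      proof -
        have "u / ?d \<le> K / ?d" using u d by (intro divide_right_mono) auto
        also have "\<dots> = real (Suc n)" using u by (simp add: field_simps)
        finally show ?thesis using \<open>real k < u / ?d\<close> by linarith
      qed
      then have "k \<in> {..n}" by simp
      moreover have "2 \<le> emeasure (P w) (I n k)"
        using u(2) by (rule order_trans) (intro emeasure_mono, use 1 I sets_P elim in \<open>auto simp: I_def\<close>)
      ultimately show False using n elim by (auto simp: U_def)
    qed
  qed
qed

lemma at_most_one_point:
  "AE w in M. \<forall>u>0. emeasure (P w) ({u} \<times> UNIV) \<le> 1"
proof -
  have "AE w in M. \<forall>K. \<forall>u\<in>{0<..real K}. \<not> 2 \<le> emeasure (P w) ({u} \<times> {-real K..real K})"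
    using simple_in_box by (simp add: AE_all_countable)
  then show ?thesis using AE_space
  proof eventually_elim
    case (elim w)
    show ?case
    proof (intro allI impI)
      fix u :: real assume u: "0 < u"
      have S: "{u} \<times> {-real K..real K} \<in> sets m2" for K
        unfolding sets_m2 using u by (auto simp flip: borel_prod)
      have "(\<Union>K. {u} \<times> {-real K..real K}) = {u} \<times> UNIV"
      proof safe
        fix v :: real
        obtain K :: nat where "\<bar>v\<bar> \<le> real K" using real_arch_simple by blast
        then show "(u, v) \<in> (\<Union>K. {u} \<times> {-real K..real K})" by (auto intro!: exI[of _ K])
      qed auto
      then have "emeasure (P w) ({u} \<times> UNIV) = (SUP K. emeasure (P w) ({u} \<times> {-real K..real K}))"
        using S elim sets_P by (subst SUP_emeasure_incseq) (auto simp: incseq_def)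
      also have "\<dots> \<le> 1"
      proof (rule SUP_least)
        fix K :: nat
        \<comment> \<open>One number bounds both times and marks in \<open>simple_in_box\<close>, so
          the box is enlarged until it also reaches time \<open>u\<close>.\<close>
        obtain L :: nat where L: "max (real K) u \<le> real L" using real_arch_simple by blast
        have "emeasure (P w) ({u} \<times> {-real K..real K}) \<le> emeasure (P w) ({u} \<times> {-real L..real L})"
          using L S elim sets_P by (intro emeasure_mono) auto
        also have "\<dots> \<le> 1"
        proof -
          have "\<not> 2 \<le> emeasure (P w) ({u} \<times> {-real L..real L})" using elim(1) u L by auto
          moreover have "emeasure (P w) ({u} \<times> {-real L..real L}) \<in> insert \<infinity> (range of_nat)"
            using P_integer S elim by blast
          ultimately obtain k where k: "emeasure (P w) ({u} \<times> {-real L..real L}) = of_nat k" "\<not> 2 \<le> (of_nat k::ennreal)"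
            by auto
          then have "\<not> of_nat 2 \<le> (of_nat k::ennreal)" by simp
          then have "k \<le> 1" by (simp only: of_nat_le_iff)
          then have "of_nat k \<le> (of_nat 1::ennreal)" by (simp only: of_nat_le_iff)
          then show ?thesis using k by simp
        qed
        finally show "emeasure (P w) ({u} \<times> {-real K..real K}) \<le> 1" .
      qed
      finally show "emeasure (P w) ({u} \<times> UNIV) \<le> 1" .
    qed
  qed
qed

end

section \<open>Predictable sets and the compensation formula\<close>

definition predictable_rects :: "'w measure \<Rightarrow> (real \<Rightarrow> 'w measure) \<Rightarrow> ('w \<times> real \<times> real) set set" where
  "predictable_rects M F =
     {B \<times> ({a<..b} \<times> C) | B a b C. 0 \<le> a \<and> B \<in> sets (F a) \<and> C \<in> sets borel}"

text \<open>The usual predictable sigma-algebra on positive times, with a mark coordinate added: the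
  event of a generating rectangle is known at the excluded left end of its time interval.\<close>

definition predictable :: "'w measure \<Rightarrow> (real \<Rightarrow> 'w measure) \<Rightarrow> ('w \<times> real \<times> real) measure" where
  "predictable M F = sigma (space M \<times> ({0<..} \<times> UNIV)) (predictable_rects M F)"

context prm_space
begin

abbreviation "Pred \<equiv> predictable M F"

lemma predictable_rects_Pow: "predictable_rects M F \<subseteq> Pow (space M \<times> ({0<..} \<times> UNIV))"
  unfolding predictable_rects_def using F_subset_M sets.sets_into_space by fastforce

lemma space_Pred: "space Pred = space M \<times> ({0<..} \<times> UNIV)"
  unfolding predictable_def by (rule space_measure_of[OF predictable_rects_Pow])

lemma sets_Pred: "sets Pred = sigma_sets (space M \<times> ({0<..} \<times> UNIV)) (predictable_rects M F)"
  unfolding predictable_def by (rule sets_measure_of[OF predictable_rects_Pow])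

lemma rect_in_Pred:
  "0 \<le> a \<Longrightarrow> B \<in> sets (F a) \<Longrightarrow> C \<in> sets borel \<Longrightarrow> B \<times> ({a<..b} \<times> C) \<in> sets Pred"
  unfolding sets_Pred predictable_rects_def by (intro sigma_sets.Basic) blast

text \<open>The later of the two left end points works for the intersection, since monotonicity of
  the filtration carries both events there.\<close>

lemma Int_stable_predictable_rects: "Int_stable (predictable_rects M F)"
proof (rule Int_stableI)
  fix X Y assume "X \<in> predictable_rects M F" "Y \<in> predictable_rects M F"
  then obtain B a b C B' a' b' C' where
    X: "X = B \<times> ({a<..b} \<times> C)" "0 \<le> a" "B \<in> sets (F a)" "C \<in> sets borel" and
    Y: "Y = B' \<times> ({a'<..b'} \<times> C')" "0 \<le> a'" "B' \<in> sets (F a')" "C' \<in> sets borel"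
    unfolding predictable_rects_def by blast
  have "X \<inter> Y = (B \<inter> B') \<times> ({max a a'<..min b b'} \<times> (C \<inter> C'))"
    unfolding X Y by auto
  moreover have "B \<inter> B' \<in> sets (F (max a a'))"
    using F_mono[of a "max a a'" B] F_mono[of a' "max a a'" B'] X Y by auto
  ultimately show "X \<inter> Y \<in> predictable_rects M F"
    unfolding predictable_rects_def using X Y by (intro CollectI exI conjI) (assumption | auto)+
qed

text \<open>Adaptedness speaks of strips that start at time 0. Their difference is meaningful only
  where the subtracted value is finite, hence the finite length of \<open>C\<close> and the passage
  to an almost surely equal function.\<close>

lemma P_strip_measurable:
  assumes "0 \<le> a" "b \<le> T" "0 \<le> T" "C \<in> sets borel" "emeasure lborel C < \<infinity>"
  shows "(\<lambda>w. emeasure (P w) ({a<..b} \<times> C)) \<in> borel_measurable (F T)"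
proof (cases "a \<le> b")
  case True
  have *: "(\<lambda>w. emeasure (P w) ({0<..t} \<times> C)) \<in> borel_measurable (F T)" if "0 \<le> t" "t \<le> T" for t
    using adapted F_measurable_mono[OF that, of _ borel] that assms(4) unfolding adapted_prm_def by blast
  have fin: "AE w in M. emeasure (P w) ({0<..a} \<times> C) < \<infinity>"
    by (rule P_finite) (use assms in \<open>auto simp: m2_Times emeasure_m2_Times ennreal_mult_less_top\<close>)
  show ?thesis
  proof (rule F_measurable_AE[OF assms(3)])
    show "(\<lambda>w. emeasure (P w) ({0<..b} \<times> C) - emeasure (P w) ({0<..a} \<times> C)) \<in> borel_measurable (F T)"
      using assms True by (intro borel_measurable_minus_ennreal *) auto
    show "AE w in M. emeasure (P w) ({0<..b} \<times> C) - emeasure (P w) ({0<..a} \<times> C) = emeasure (P w) ({a<..b} \<times> C)"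
      using fin AE_space
    proof eventually_elim
      case (elim w)
      have "{a<..b} \<times> C = {0<..b} \<times> C - {0<..a} \<times> C" using assms True by auto
      moreover have "emeasure (P w) ({0<..b} \<times> C - {0<..a} \<times> C) =
          emeasure (P w) ({0<..b} \<times> C) - emeasure (P w) ({0<..a} \<times> C)"
        using elim assms True sets_P[of w] m2_Times[of 0 C b] m2_Times[of 0 C a]
        by (intro emeasure_Diff) auto
      ultimately show ?case by simp
    qed
  qed simp
qed simp

context
  fixes T K :: real
  assumes T: "0 \<le> T"
begin

private abbreviation bx :: "(real \<times> real) set" where "bx \<equiv> {0<..T} \<times> {-K..K}"

lemma box_m2: "bx \<in> sets m2" by (rule m2_Times) auto

lemma box_finite: "emeasure m2 bx < \<infinity>"
  by (subst emeasure_m2_Times) (use T in \<open>auto simp: ennreal_mult_less_top emeasure_lborel_Icc_eq\<close>)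

text \<open>A monotone class argument over the intersection-stable rectangles; for a rectangle the
  identity is \<open>P_mean\<close>. The bounded box makes all values almost surely finite, which
  the complement step needs in order to subtract. Measurability and the identity have to travel
  through the induction together.\<close>

lemma predictable_box_set:
  assumes "A \<in> sets Pred"
  shows "(\<forall>w\<in>space M. Pair w -` A \<in> sets m2) \<and>
    (\<lambda>w. emeasure (P w) (Pair w -` A \<inter> bx)) \<in> borel_measurable (F T) \<and>
    (\<lambda>w. emeasure m2 (Pair w -` A \<inter> bx)) \<in> borel_measurable (F T) \<and>
    (\<integral>\<^sup>+w. emeasure (P w) (Pair w -` A \<inter> bx) \<partial>M) = (\<integral>\<^sup>+w. emeasure m2 (Pair w -` A \<inter> bx) \<partial>M)"
    (is "?S A \<and> ?N A \<and> ?L A \<and> ?E A")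
proof -
  let ?\<Omega> = "space M \<times> ({0<..} \<times> UNIV) :: ('w \<times> real \<times> real) set"
  have rects: "?S A \<and> ?N A \<and> ?L A \<and> ?E A" if "A \<in> predictable_rects M F" for A
  proof -
    from that obtain B a b C where A: "A = B \<times> ({a<..b} \<times> C)" "0 \<le> a" "B \<in> sets (F a)" "C \<in> sets borel"
      unfolding predictable_rects_def by blast
    let ?D = "{a<..min b T} \<times> (C \<inter> {-K..K})"
    have sec: "Pair w -` A = (if w \<in> B then {a<..b} \<times> C else {})" for w
      unfolding A by auto
    have D: "Pair w -` A \<inter> bx = (if w \<in> B then ?D else {})" for w
      unfolding sec using A(2) by auto
    have eP: "emeasure (P w) (Pair w -` A \<inter> bx) = indicator B w * emeasure (P w) ?D"
      and em: "emeasure m2 (Pair w -` A \<inter> bx) = indicator B w * emeasure m2 ?D" for w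
      unfolding D by auto
    have S: "?S A" using A by (auto simp: sec m2_Times)
    show ?thesis
    proof (cases "a \<le> T")
      case True
      have B: "B \<in> sets (F T)" using A True F_mono by blast
      have Dsub: "?D \<subseteq> {a<..} \<times> UNIV" by auto
      have Dm: "?D \<in> sets m2" using A by (intro m2_Times) auto
      have "emeasure m2 ?D \<le> emeasure m2 bx"
        using A box_m2 by (intro emeasure_mono) auto
      then have Df: "emeasure m2 ?D < \<infinity>" using box_finite by (rule le_less_trans)
      have "emeasure lborel (C \<inter> {-K..K}) \<le> emeasure lborel {-K..K}"
        by (rule emeasure_mono) auto
      also have "\<dots> < \<infinity>" by (simp add: emeasure_lborel_Icc_eq)
      finally have Cf: "emeasure lborel (C \<inter> {-K..K}) < \<infinity>" .
      have "?N A" unfolding eP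
        using A T B Cf by (intro borel_measurable_times_ennreal borel_measurable_indicator P_strip_measurable) auto
      moreover have "?L A" unfolding em using B by measurable
      moreover have "?E A" unfolding eP em
        using P_mean[OF A(2,3) Dm Dsub Df] F_subset_M[OF A(2,3)]
        by (auto simp: nn_integral_cmult mult.commute nn_integral_multc)
      ultimately show ?thesis using S by blast
    next
      case False
      then have D0: "?D = {}" by auto
      have "?N A \<and> ?L A \<and> ?E A"
        unfolding eP em D0 by simp
      then show ?thesis using S by blast
    qed
  qed
  have \<Omega>: "?S ?\<Omega> \<and> ?N ?\<Omega> \<and> ?L ?\<Omega> \<and> ?E ?\<Omega>"
  proof -
    have *: "Pair w -` ?\<Omega> = (if w \<in> space M then {0<..} \<times> UNIV else {})" for w by auto
    \<comment> \<open>The whole space is not a rectangle, its time interval being unbounded, but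
      inside the box it agrees with one.\<close>
    let ?R = "space M \<times> ({0<..T} \<times> UNIV) :: ('w \<times> real \<times> real) set"
    have "?R \<in> predictable_rects M F"
      unfolding predictable_rects_def using sets.top[of "F 0"] space_F[of 0]
      by (intro CollectI exI[of _ "space M"] exI[of _ 0] exI[of _ T] exI[of _ UNIV]) simp
    from rects[OF this] have R: "?S ?R \<and> ?N ?R \<and> ?L ?R \<and> ?E ?R" .
    have eq: "Pair w -` ?\<Omega> \<inter> bx = Pair w -` ?R \<inter> bx" for w by auto
    have "{0<..} \<times> (UNIV::real set) \<in> sets m2"
      unfolding sets_m2 by (auto simp flip: borel_prod)
    then show ?thesis using R unfolding eq by (auto simp: *)
  qed
  from assms show ?thesis
    unfolding sets_Pred
  proof (induction rule: sigma_sets_induct_disjoint[OF Int_stable_predictable_rects predictable_rects_Pow, consumes 1, case_names basic empty compl union])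
    case (basic A)
    then show ?case by (rule rects)
  next
    case empty
    show ?case by simp
  next
    case (compl A)
    have sm: "Pair w -` (?\<Omega> - A) = {0<..} \<times> UNIV - Pair w -` A" if "w \<in> space M" for w
      using that by auto
    have fin: "AE w in M. emeasure (P w) bx < \<infinity>" by (rule P_finite[OF box_m2 box_finite])
    have sub: "Pair w -` A \<inter> bx \<in> sets m2" if "w \<in> space M" for w
      using compl that box_m2 by blast
    have Om: "Pair w -` ?\<Omega> \<inter> bx = bx" if "w \<in> space M" for w using that by auto
    have D: "Pair w -` (?\<Omega> - A) \<inter> bx = bx - Pair w -` A \<inter> bx" if "w \<in> space M" for w
      using sm[OF that] by auto
    have eP: "AE w in M. emeasure (P w) bx - emeasure (P w) (Pair w -` A \<inter> bx) = emeasure (P w) (Pair w -` (?\<Omega> - A) \<inter> bx)"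
      using fin AE_space
    proof eventually_elim
      case (elim w)
      have "emeasure (P w) (Pair w -` A \<inter> bx) \<le> emeasure (P w) bx"
        using elim sub box_m2 sets_P by (intro emeasure_mono) auto
      then show ?case unfolding D[OF elim(2)]
        using elim sub box_m2 sets_P by (subst emeasure_Diff) auto
    qed
    have em: "emeasure m2 (Pair w -` (?\<Omega> - A) \<inter> bx) = emeasure m2 bx - emeasure m2 (Pair w -` A \<inter> bx)" if "w \<in> space M" for w
    proof -
      have "emeasure m2 (Pair w -` A \<inter> bx) \<le> emeasure m2 bx"
        using that sub box_m2 by (intro emeasure_mono) auto
      then show ?thesis unfolding D[OF that]
        using that sub box_m2 box_finite by (subst emeasure_Diff) auto
    qed
    have box_N: "(\<lambda>w. emeasure (P w) bx) \<in> borel_measurable (F T)"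
      by (rule P_strip_measurable) (use T in \<open>auto simp: emeasure_lborel_Icc_eq\<close>)
    have S: "?S (?\<Omega> - A)"
    proof
      fix w assume w: "w \<in> space M"
      have "{0<..} \<times> (UNIV::real set) \<in> sets m2"
        unfolding sets_m2 by (auto simp flip: borel_prod)
      then show "Pair w -` (?\<Omega> - A) \<in> sets m2" unfolding sm[OF w] using compl w by auto
    qed
    have N: "?N (?\<Omega> - A)"
      by (rule F_measurable_AE[OF T _ _ eP]) (use compl box_N in \<open>auto intro!: borel_measurable_minus_ennreal\<close>)
    have L: "?L (?\<Omega> - A)"
    proof (rule F_measurable_AE[OF T])
      show "(\<lambda>w. emeasure m2 bx - emeasure m2 (Pair w -` A \<inter> bx)) \<in> borel_measurable (F T)"
        using compl by (intro borel_measurable_minus_ennreal) auto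
      show "AE w in M. emeasure m2 bx - emeasure m2 (Pair w -` A \<inter> bx) = emeasure m2 (Pair w -` (?\<Omega> - A) \<inter> bx)"
        using em by (intro AE_I2) simp
    qed simp
    have mM: "(\<lambda>w. emeasure (P w) (Pair w -` A \<inter> bx)) \<in> borel_measurable M"
       "(\<lambda>w. emeasure m2 (Pair w -` A \<inter> bx)) \<in> borel_measurable M"
      using compl F_measurable_M[OF T] by blast+
    have i1: "(\<integral>\<^sup>+w. emeasure m2 (Pair w -` A \<inter> bx) \<partial>M) < \<infinity>"
    proof -
      have "(\<integral>\<^sup>+w. emeasure m2 (Pair w -` A \<inter> bx) \<partial>M) \<le> (\<integral>\<^sup>+w. emeasure m2 bx \<partial>M)"
        using box_m2 by (intro nn_integral_mono emeasure_mono) auto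
      also have "\<dots> < \<infinity>" using box_finite by (simp add: emeasure_space_1)
      finally show ?thesis .
    qed
    have "(\<integral>\<^sup>+w. emeasure (P w) (Pair w -` (?\<Omega> - A) \<inter> bx) \<partial>M) =
       (\<integral>\<^sup>+w. emeasure (P w) bx - emeasure (P w) (Pair w -` A \<inter> bx) \<partial>M)"
      using eP by (intro nn_integral_cong_AE) auto
    also have "\<dots> = (\<integral>\<^sup>+w. emeasure (P w) bx \<partial>M) - (\<integral>\<^sup>+w. emeasure (P w) (Pair w -` A \<inter> bx) \<partial>M)"
    proof (rule nn_integral_diff)
      show "AE w in M. emeasure (P w) (Pair w -` A \<inter> bx) \<le> emeasure (P w) bx"
        using sub box_m2 sets_P by (intro AE_I2 emeasure_mono) auto
    qed (use mM i1 compl box_m2 P_measurable in auto)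
    also have "(\<integral>\<^sup>+w. emeasure (P w) bx \<partial>M) = (\<integral>\<^sup>+w. emeasure m2 bx \<partial>M)"
    proof -
      have "(\<integral>\<^sup>+w. emeasure (P w) bx \<partial>M) = (\<integral>\<^sup>+w. emeasure (P w) (Pair w -` ?\<Omega> \<inter> bx) \<partial>M)"
        by (rule nn_integral_cong) (simp only: Om)
      also have "\<dots> = (\<integral>\<^sup>+w. emeasure m2 (Pair w -` ?\<Omega> \<inter> bx) \<partial>M)" using \<Omega> by blast
      also have "\<dots> = (\<integral>\<^sup>+w. emeasure m2 bx \<partial>M)"
        by (rule nn_integral_cong) (simp only: Om)
      finally show ?thesis .
    qed
    also have "(\<integral>\<^sup>+w. emeasure (P w) (Pair w -` A \<inter> bx) \<partial>M) = (\<integral>\<^sup>+w. emeasure m2 (Pair w -` A \<inter> bx) \<partial>M)"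
      using compl by blast
    also have "(\<integral>\<^sup>+w. emeasure m2 bx \<partial>M) - (\<integral>\<^sup>+w. emeasure m2 (Pair w -` A \<inter> bx) \<partial>M) =
       (\<integral>\<^sup>+w. emeasure m2 bx - emeasure m2 (Pair w -` A \<inter> bx) \<partial>M)"
    proof (rule nn_integral_diff[symmetric])
      show "AE w in M. emeasure m2 (Pair w -` A \<inter> bx) \<le> emeasure m2 bx"
        using box_m2 by (intro AE_I2 emeasure_mono) auto
    qed (use mM i1 in auto)
    also have "\<dots> = (\<integral>\<^sup>+w. emeasure m2 (Pair w -` (?\<Omega> - A) \<inter> bx) \<partial>M)"
      by (rule nn_integral_cong) (simp only: em)
    finally have "?E (?\<Omega> - A)" .
    with S N L show ?case by blast
  next
    case (union A)
    have vim: "Pair w -` (\<Union>i. A i) \<inter> bx = (\<Union>i. Pair w -` A i \<inter> bx)" for w by auto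
    have dj: "disjoint_family (\<lambda>i. Pair w -` A i \<inter> bx)" for w
      using union(1) unfolding disjoint_family_on_def by auto
    have sub: "Pair w -` A i \<inter> bx \<in> sets m2" if "w \<in> space M" for w i
      using union(3) that box_m2 by blast
    have eP: "emeasure (P w) (Pair w -` (\<Union>i. A i) \<inter> bx) = (\<Sum>i. emeasure (P w) (Pair w -` A i \<inter> bx))"
      and em: "emeasure m2 (Pair w -` (\<Union>i. A i) \<inter> bx) = (\<Sum>i. emeasure m2 (Pair w -` A i \<inter> bx))" if "w \<in> space M" for w
      unfolding vim using sub[OF that] sets_P[OF that] dj
      by (intro suminf_emeasure[symmetric]; blast)+
    have mF: "(\<lambda>w. emeasure (P w) (Pair w -` A i \<inter> bx)) \<in> borel_measurable (F T)"
       "(\<lambda>w. emeasure m2 (Pair w -` A i \<inter> bx)) \<in> borel_measurable (F T)" for i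
      using union(3) by blast+
    have mM: "(\<lambda>w. emeasure (P w) (Pair w -` A i \<inter> bx)) \<in> borel_measurable M"
       "(\<lambda>w. emeasure m2 (Pair w -` A i \<inter> bx)) \<in> borel_measurable M" for i
      using mF F_measurable_M[OF T] by blast+
    have S: "?S (\<Union>i. A i)"
    proof
      fix w assume "w \<in> space M"
      then have "(\<Union>i. Pair w -` A i) \<in> sets m2" using union(3) by auto
      then show "Pair w -` (\<Union>i. A i) \<in> sets m2" by (simp add: vimage_UN)
    qed
    have N: "?N (\<Union>i. A i)"
      by (rule measurable_cong[THEN iffD2, OF eP]) (use mF space_F[OF T] in auto)
    have L: "?L (\<Union>i. A i)"
      by (rule measurable_cong[THEN iffD2, OF em]) (use mF space_F[OF T] in auto)
    have "(\<integral>\<^sup>+w. emeasure (P w) (Pair w -` (\<Union>i. A i) \<inter> bx) \<partial>M) =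
       (\<Sum>i. \<integral>\<^sup>+w. emeasure (P w) (Pair w -` A i \<inter> bx) \<partial>M)"
      using mM(1) by (subst nn_integral_suminf[symmetric]) (auto intro!: nn_integral_cong simp only: eP)
    also have "\<dots> = (\<Sum>i. \<integral>\<^sup>+w. emeasure m2 (Pair w -` A i \<inter> bx) \<partial>M)"
      using union(3) by (intro suminf_cong) blast
    also have "\<dots> = (\<integral>\<^sup>+w. emeasure m2 (Pair w -` (\<Union>i. A i) \<inter> bx) \<partial>M)"
      using mM(2) by (subst nn_integral_suminf[symmetric]) (auto intro!: nn_integral_cong simp only: em)
    finally show ?case using S N L by blast
  qed
qed

end

text \<open>The induction runs from sets to functions with measurability in \<open>F T\<close> as
  part of the claim, so that the integrals come out adapted and not merely as random
  variables.\<close>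

lemma predictable_nn_integral_box:
  fixes f :: "'w \<times> real \<times> real \<Rightarrow> ennreal" and T K :: real
  assumes f: "f \<in> borel_measurable Pred" and T: "0 \<le> T"
  defines "D \<equiv> {0<..T} \<times> {-K..K}"
  shows "(\<forall>w\<in>space M. (\<lambda>p. f (w, p) * indicator D p) \<in> borel_measurable m2) \<and>
    (\<lambda>w. \<integral>\<^sup>+p. f (w, p) * indicator D p \<partial>P w) \<in> borel_measurable (F T) \<and>
    (\<lambda>w. \<integral>\<^sup>+p. f (w, p) * indicator D p \<partial>m2) \<in> borel_measurable (F T) \<and>
    (\<integral>\<^sup>+w. \<integral>\<^sup>+p. f (w, p) * indicator D p \<partial>P w \<partial>M) =
    (\<integral>\<^sup>+w. \<integral>\<^sup>+p. f (w, p) * indicator D p \<partial>m2 \<partial>M)"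
  (is "?S f \<and> ?N f \<and> ?L f \<and> ?E f")
proof -
  have D: "D \<in> sets m2" unfolding D_def by (rule box_m2[OF T])
  have PD: "g \<in> borel_measurable (P w) \<longleftrightarrow> g \<in> borel_measurable m2" if "w \<in> space M" for w and g :: "real \<times> real \<Rightarrow> ennreal"
    using measurable_cong_sets[OF sets_P[OF that] refl] by blast
  have MF: "g \<in> borel_measurable (F T) \<Longrightarrow> g \<in> borel_measurable M" for g :: "'w \<Rightarrow> ennreal"
    using F_measurable_M[OF T] .
  show ?thesis using f
  proof (induction rule: borel_measurable_induct)
    case (cong f g)
    have "f (w, p) * indicator D p = g (w, p) * indicator D p" if "w \<in> space M" for w p
      using cong(3)[of "(w, p)"] that by (auto simp: space_Pred D_def indicator_def)
    then have eq: "w \<in> space M \<Longrightarrow> (\<lambda>p. f (w, p) * indicator D p) = (\<lambda>p. g (w, p) * indicator D p)" for w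
      by auto
    have "?S f" using cong(4) eq by simp
    moreover have "?N f" using cong(4) eq measurable_cong[of "F T" "\<lambda>w. \<integral>\<^sup>+p. f (w, p) * indicator D p \<partial>P w"
        "\<lambda>w. \<integral>\<^sup>+p. g (w, p) * indicator D p \<partial>P w"] space_F[OF T] by simp
    moreover have "?L f" using cong(4) eq measurable_cong[of "F T" "\<lambda>w. \<integral>\<^sup>+p. f (w, p) * indicator D p \<partial>m2"
        "\<lambda>w. \<integral>\<^sup>+p. g (w, p) * indicator D p \<partial>m2"] space_F[OF T] by simp
    moreover have "?E f"
    proof -
      have e: "(\<integral>\<^sup>+w. \<integral>\<^sup>+p. f (w, p) * indicator D p \<partial>\<kappa> w \<partial>M) = (\<integral>\<^sup>+w. \<integral>\<^sup>+p. g (w, p) * indicator D p \<partial>\<kappa> w \<partial>M)"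
        for \<kappa> :: "'w \<Rightarrow> (real \<times> real) measure"
        by (rule nn_integral_cong) (simp only: eq)
      show ?thesis using cong(4) unfolding e[of P] e[of "\<lambda>_. m2"] by blast
    qed
    ultimately show ?case by blast
  next
    case (set A)
    have S: "Pair w -` A \<inter> D \<in> sets m2" if "w \<in> space M" for w
      using predictable_box_set[OF T set, of K] that D by blast
    have eq: "(indicator A (w, p) * indicator D p :: ennreal) = indicator (Pair w -` A \<inter> D) p" for w p
      by (auto simp: indicator_def)
    have eP: "(\<integral>\<^sup>+p. indicator A (w, p) * indicator D p \<partial>P w) = emeasure (P w) (Pair w -` A \<inter> D)"
      and em: "(\<integral>\<^sup>+p. indicator A (w, p) * indicator D p \<partial>m2) = emeasure m2 (Pair w -` A \<inter> D)"
      if "w \<in> space M" for w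
      unfolding eq using S[OF that] sets_P[OF that] by (auto intro!: nn_integral_indicator)
    have p: "(\<forall>w\<in>space M. Pair w -` A \<in> sets m2) \<and>
      (\<lambda>w. emeasure (P w) (Pair w -` A \<inter> D)) \<in> borel_measurable (F T) \<and>
      (\<lambda>w. emeasure m2 (Pair w -` A \<inter> D)) \<in> borel_measurable (F T) \<and>
      (\<integral>\<^sup>+w. emeasure (P w) (Pair w -` A \<inter> D) \<partial>M) = (\<integral>\<^sup>+w. emeasure m2 (Pair w -` A \<inter> D) \<partial>M)"
      using predictable_box_set[OF T set, of K] unfolding D_def .
    have "?S (indicator A)" unfolding eq using S by auto
    moreover have "?N (indicator A)"
      using p by (subst measurable_cong[OF eP]) (auto simp: space_F[OF T])
    moreover have "?L (indicator A)"
      using p by (subst measurable_cong[OF em]) (auto simp: space_F[OF T])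
    moreover have "?E (indicator A)"
    proof -
      have "(\<integral>\<^sup>+w. \<integral>\<^sup>+p. indicator A (w, p) * indicator D p \<partial>P w \<partial>M) = (\<integral>\<^sup>+w. emeasure (P w) (Pair w -` A \<inter> D) \<partial>M)"
        by (rule nn_integral_cong) (rule eP)
      also have "\<dots> = (\<integral>\<^sup>+w. emeasure m2 (Pair w -` A \<inter> D) \<partial>M)" using p by blast
      also have "\<dots> = (\<integral>\<^sup>+w. \<integral>\<^sup>+p. indicator A (w, p) * indicator D p \<partial>m2 \<partial>M)"
        by (rule nn_integral_cong) (rule em[symmetric])
      finally show ?thesis .
    qed
    ultimately show ?case by blast
  next
    case (mult f c)
    have eP: "(\<integral>\<^sup>+p. c * f (w, p) * indicator D p \<partial>P w) = c * (\<integral>\<^sup>+p. f (w, p) * indicator D p \<partial>P w)"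
      and em: "(\<integral>\<^sup>+p. c * f (w, p) * indicator D p \<partial>m2) = c * (\<integral>\<^sup>+p. f (w, p) * indicator D p \<partial>m2)"
      if "w \<in> space M" for w
      using mult(4) that PD[OF that] by (auto simp: mult.assoc intro!: nn_integral_cmult)
    have "?S (\<lambda>x. c * f x)" using mult(4) by (auto simp: mult.assoc)
    moreover have "?N (\<lambda>x. c * f x)"
      using mult(4) by (subst measurable_cong[OF eP]) (auto simp: space_F[OF T])
    moreover have "?L (\<lambda>x. c * f x)"
      using mult(4) by (subst measurable_cong[OF em]) (auto simp: space_F[OF T])
    moreover have "?E (\<lambda>x. c * f x)"
    proof -
      have "(\<integral>\<^sup>+w. \<integral>\<^sup>+p. c * f (w, p) * indicator D p \<partial>P w \<partial>M) = (\<integral>\<^sup>+w. c * (\<integral>\<^sup>+p. f (w, p) * indicator D p \<partial>P w) \<partial>M)"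
        by (rule nn_integral_cong) (rule eP)
      also have "\<dots> = (\<integral>\<^sup>+w. c * (\<integral>\<^sup>+p. f (w, p) * indicator D p \<partial>m2) \<partial>M)"
        using mult(4) MF by (simp only: nn_integral_cmult)
      also have "\<dots> = (\<integral>\<^sup>+w. \<integral>\<^sup>+p. c * f (w, p) * indicator D p \<partial>m2 \<partial>M)"
        by (rule nn_integral_cong) (rule em[symmetric])
      finally show ?thesis .
    qed
    ultimately show ?case by blast
  next
    case (add f g)
    have eP: "(\<integral>\<^sup>+p. (g (w, p) + f (w, p)) * indicator D p \<partial>P w) =
        (\<integral>\<^sup>+p. g (w, p) * indicator D p \<partial>P w) + (\<integral>\<^sup>+p. f (w, p) * indicator D p \<partial>P w)"
      and em: "(\<integral>\<^sup>+p. (g (w, p) + f (w, p)) * indicator D p \<partial>m2) =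
        (\<integral>\<^sup>+p. g (w, p) * indicator D p \<partial>m2) + (\<integral>\<^sup>+p. f (w, p) * indicator D p \<partial>m2)"
      if "w \<in> space M" for w
      using add(3,6,7) that PD[OF that] by (auto simp: distrib_right intro!: nn_integral_add)
    have "?S (\<lambda>x. g x + f x)" using add(3,6,7) by (auto simp: distrib_right intro!: borel_measurable_add)
    moreover have "?N (\<lambda>x. g x + f x)"
      using add by (subst measurable_cong[OF eP]) (auto simp: space_F[OF T])
    moreover have "?L (\<lambda>x. g x + f x)"
      using add by (subst measurable_cong[OF em]) (auto simp: space_F[OF T])
    moreover have "?E (\<lambda>x. g x + f x)"
    proof -
      have "(\<integral>\<^sup>+w. \<integral>\<^sup>+p. (g (w, p) + f (w, p)) * indicator D p \<partial>P w \<partial>M) =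
        (\<integral>\<^sup>+w. (\<integral>\<^sup>+p. g (w, p) * indicator D p \<partial>P w) + (\<integral>\<^sup>+p. f (w, p) * indicator D p \<partial>P w) \<partial>M)"
        by (rule nn_integral_cong) (rule eP)
      also have "\<dots> = (\<integral>\<^sup>+w. (\<integral>\<^sup>+p. g (w, p) * indicator D p \<partial>m2) + (\<integral>\<^sup>+p. f (w, p) * indicator D p \<partial>m2) \<partial>M)"
        using add(3,6,7) MF by (simp only: nn_integral_add)
      also have "\<dots> = (\<integral>\<^sup>+w. \<integral>\<^sup>+p. (g (w, p) + f (w, p)) * indicator D p \<partial>m2 \<partial>M)"
        by (rule nn_integral_cong) (rule em[symmetric])
      finally show ?thesis .
    qed
    ultimately show ?case by blast
  next
    case (seq U)
    note IH = seq.IH and iU = \<open>incseq U\<close>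
    have sp: "(SUP i. U i) x * indicator D p = (SUP i. U i x * indicator D p)" for x p
      by (cases "p \<in> D") (simp_all add: image_image)
    have inc: "incseq (\<lambda>i p. U i (w, p) * indicator D p)" for w
      using iU by (auto simp: incseq_def le_fun_def indicator_def)
    have eP: "(\<integral>\<^sup>+p. (SUP i. U i) (w, p) * indicator D p \<partial>P w) = (SUP i. \<integral>\<^sup>+p. U i (w, p) * indicator D p \<partial>P w)"
      and em: "(\<integral>\<^sup>+p. (SUP i. U i) (w, p) * indicator D p \<partial>m2) = (SUP i. \<integral>\<^sup>+p. U i (w, p) * indicator D p \<partial>m2)"
      if "w \<in> space M" for w
      unfolding sp using IH that PD[OF that] inc
      by (auto intro!: nn_integral_monotone_convergence_SUP)
    have incP: "incseq (\<lambda>i w. \<integral>\<^sup>+p. U i (w, p) * indicator D p \<partial>P w)"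
      and incm: "incseq (\<lambda>i w. \<integral>\<^sup>+p. U i (w, p) * indicator D p \<partial>m2)"
      using inc by (auto simp: incseq_def le_fun_def intro!: nn_integral_mono)
    have "?S (SUP i. U i)" unfolding sp using IH by (auto intro!: borel_measurable_SUP)
    moreover have "?N (SUP i. U i)"
      using IH by (subst measurable_cong[OF eP]) (auto simp: space_F[OF T] intro!: borel_measurable_SUP)
    moreover have "?L (SUP i. U i)"
      using IH by (subst measurable_cong[OF em]) (auto simp: space_F[OF T] intro!: borel_measurable_SUP)
    moreover have "?E (SUP i. U i)"
    proof -
      have "(\<integral>\<^sup>+w. \<integral>\<^sup>+p. (SUP i. U i) (w, p) * indicator D p \<partial>P w \<partial>M) =
         (\<integral>\<^sup>+w. (SUP i. \<integral>\<^sup>+p. U i (w, p) * indicator D p \<partial>P w) \<partial>M)"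
        by (rule nn_integral_cong) (rule eP)
      also have "\<dots> = (SUP i. \<integral>\<^sup>+w. \<integral>\<^sup>+p. U i (w, p) * indicator D p \<partial>P w \<partial>M)"
        by (rule nn_integral_monotone_convergence_SUP[OF incP MF]) (use IH in blast)
      also have "\<dots> = (SUP i. \<integral>\<^sup>+w. \<integral>\<^sup>+p. U i (w, p) * indicator D p \<partial>m2 \<partial>M)"
        using IH by simp
      also have "\<dots> = (\<integral>\<^sup>+w. (SUP i. \<integral>\<^sup>+p. U i (w, p) * indicator D p \<partial>m2) \<partial>M)"
        by (rule nn_integral_monotone_convergence_SUP[OF incm MF, symmetric]) (use IH in blast)
      also have "\<dots> = (\<integral>\<^sup>+w. \<integral>\<^sup>+p. (SUP i. U i) (w, p) * indicator D p \<partial>m2 \<partial>M)"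
        by (rule nn_integral_cong) (rule em[symmetric])
      finally show ?thesis .
    qed
    ultimately show ?case by blast
  qed
qed

abbreviation strip :: "real \<Rightarrow> (real \<times> real) set" where "strip t \<equiv> {0<..t} \<times> UNIV"

lemma strip_m2: "strip t \<in> sets m2"
  by (rule m2_Times) auto

text \<open>Boxes with growing mark range exhaust the strip, and monotone convergence removes the
  bound on the marks. The strip itself has infinite intensity for positive \<open>T\<close>, so
  complements could not have been handled on it directly.\<close>

lemma
  fixes f :: "'w \<times> real \<times> real \<Rightarrow> ennreal"
  assumes f: "f \<in> borel_measurable Pred" and T: "0 \<le> T"
  shows predictable_section: "\<And>w. w \<in> space M \<Longrightarrow> (\<lambda>p. f (w, p) * indicator (strip T) p) \<in> borel_measurable m2"
    and predictable_P_measurable: "(\<lambda>w. \<integral>\<^sup>+p. f (w, p) * indicator (strip T) p \<partial>P w) \<in> borel_measurable (F T)"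
    and predictable_m2_measurable: "(\<lambda>w. \<integral>\<^sup>+p. f (w, p) * indicator (strip T) p \<partial>m2) \<in> borel_measurable (F T)"
    and predictable_compensation: "(\<integral>\<^sup>+w. \<integral>\<^sup>+p. f (w, p) * indicator (strip T) p \<partial>P w \<partial>M) =
    (\<integral>\<^sup>+w. \<integral>\<^sup>+p. f (w, p) * indicator (strip T) p \<partial>m2 \<partial>M)"
proof -
  let ?D = "\<lambda>K::nat. {0<..T} \<times> {-real K..real K}"
  let ?U = "\<lambda>K w p. f (w, p) * indicator (?D K) p"
  note B = predictable_nn_integral_box[OF f T]
  have PD: "g \<in> borel_measurable (P w) \<longleftrightarrow> g \<in> borel_measurable m2" if "w \<in> space M" for w and g :: "real \<times> real \<Rightarrow> ennreal"
    using measurable_cong_sets[OF sets_P[OF that] refl] by blast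
  have MF: "g \<in> borel_measurable (F T) \<Longrightarrow> g \<in> borel_measurable M" for g :: "'w \<Rightarrow> ennreal"
    using F_measurable_M[OF T] .
  have inc: "incseq (\<lambda>K. ?U K w)" for w
    by (auto simp: incseq_def le_fun_def indicator_def)
  have S: "(\<lambda>p. f (w, p) * indicator (strip T) p) = (\<lambda>p. SUP K. ?U K w p)" for w
  proof
    fix p :: "real \<times> real"
    have "(SUP K. ?U K w p) = f (w, p) * (SUP K. indicator (?D K) p)"
      by (rule SUP_mult_left_ennreal[symmetric])
    also have "(SUP K. indicator (?D K) p :: ennreal) = indicator (\<Union>K. ?D K) p"
    proof (cases "\<exists>K. p \<in> ?D K")
      case True
      then obtain K where K: "p \<in> ?D K" by blast
      then have "1 \<le> (SUP K. indicator (?D K) p :: ennreal)"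
        by (intro SUP_upper2[of K]) auto
      moreover have "(SUP K. indicator (?D K) p :: ennreal) \<le> 1"
        by (intro SUP_least) (simp add: indicator_def)
      ultimately show ?thesis using K by (simp add: antisym indicator_def) blast
    qed (simp add: indicator_def)
    also have "(\<Union>K. ?D K) = strip T"
    proof safe
      fix u v :: real assume "u \<in> {0<..T}"
      moreover obtain K :: nat where "\<bar>v\<bar> \<le> real K" using real_arch_simple by blast
      ultimately show "(u, v) \<in> (\<Union>K. ?D K)" by (auto intro!: exI[of _ K])
    qed auto
    finally show "f (w, p) * indicator (strip T) p = (SUP K. ?U K w p)" by simp
  qed
  have m: "?U K w \<in> borel_measurable m2" if "w \<in> space M" for K w
    using B[of "real K"] that by blast
  have eP: "(\<integral>\<^sup>+p. f (w, p) * indicator (strip T) p \<partial>P w) = (SUP K. \<integral>\<^sup>+p. ?U K w p \<partial>P w)"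
    and em: "(\<integral>\<^sup>+p. f (w, p) * indicator (strip T) p \<partial>m2) = (SUP K. \<integral>\<^sup>+p. ?U K w p \<partial>m2)"
    if "w \<in> space M" for w
    unfolding S using m[OF that] PD[OF that] inc
    by (auto intro!: nn_integral_monotone_convergence_SUP)
  have incP: "incseq (\<lambda>K w. \<integral>\<^sup>+p. ?U K w p \<partial>P w)" and incm: "incseq (\<lambda>K w. \<integral>\<^sup>+p. ?U K w p \<partial>m2)"
    using inc by (auto simp: incseq_def le_fun_def intro!: nn_integral_mono)
  have mP: "(\<lambda>w. \<integral>\<^sup>+p. ?U K w p \<partial>P w) \<in> borel_measurable (F T)"
    and mm: "(\<lambda>w. \<integral>\<^sup>+p. ?U K w p \<partial>m2) \<in> borel_measurable (F T)"
    and ee: "(\<integral>\<^sup>+w. \<integral>\<^sup>+p. ?U K w p \<partial>P w \<partial>M) = (\<integral>\<^sup>+w. \<integral>\<^sup>+p. ?U K w p \<partial>m2 \<partial>M)" for K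
    using B[of "real K"] by blast+
  show "(\<lambda>p. f (w, p) * indicator (strip T) p) \<in> borel_measurable m2" if "w \<in> space M" for w
    unfolding S using m[OF that] by (intro borel_measurable_SUP) auto
  show "(\<lambda>w. \<integral>\<^sup>+p. f (w, p) * indicator (strip T) p \<partial>P w) \<in> borel_measurable (F T)"
    using mP by (subst measurable_cong[OF eP]) (auto simp: space_F[OF T] intro!: borel_measurable_SUP)
  show "(\<lambda>w. \<integral>\<^sup>+p. f (w, p) * indicator (strip T) p \<partial>m2) \<in> borel_measurable (F T)"
    using mm by (subst measurable_cong[OF em]) (auto simp: space_F[OF T] intro!: borel_measurable_SUP)
  have "(\<integral>\<^sup>+w. \<integral>\<^sup>+p. f (w, p) * indicator (strip T) p \<partial>P w \<partial>M) = (\<integral>\<^sup>+w. (SUP K. \<integral>\<^sup>+p. ?U K w p \<partial>P w) \<partial>M)"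
    by (rule nn_integral_cong) (rule eP)
  also have "\<dots> = (SUP K. \<integral>\<^sup>+w. \<integral>\<^sup>+p. ?U K w p \<partial>P w \<partial>M)"
    by (rule nn_integral_monotone_convergence_SUP[OF incP MF[OF mP]])
  also have "\<dots> = (SUP K. \<integral>\<^sup>+w. \<integral>\<^sup>+p. ?U K w p \<partial>m2 \<partial>M)" using ee by simp
  also have "\<dots> = (\<integral>\<^sup>+w. (SUP K. \<integral>\<^sup>+p. ?U K w p \<partial>m2) \<partial>M)"
    by (rule nn_integral_monotone_convergence_SUP[OF incm MF[OF mm], symmetric])
  also have "\<dots> = (\<integral>\<^sup>+w. \<integral>\<^sup>+p. f (w, p) * indicator (strip T) p \<partial>m2 \<partial>M)"
    by (rule nn_integral_cong) (rule em[symmetric])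
  finally show "(\<integral>\<^sup>+w. \<integral>\<^sup>+p. f (w, p) * indicator (strip T) p \<partial>P w \<partial>M) =
    (\<integral>\<^sup>+w. \<integral>\<^sup>+p. f (w, p) * indicator (strip T) p \<partial>m2 \<partial>M)" .
qed

section \<open>Signed integrands and the compensated martingale\<close>

definition jump_integral :: "('w \<times> real \<times> real \<Rightarrow> real) \<Rightarrow> real \<Rightarrow> 'w \<Rightarrow> real" where
  "jump_integral f t w = (LINT p:strip t|P w. f (w, p))"

definition compensator :: "('w \<times> real \<times> real \<Rightarrow> real) \<Rightarrow> real \<Rightarrow> 'w \<Rightarrow> real" where
  "compensator f t w = (LINT p:strip t|m2. f (w, p))"

definition finite_intensity :: "('w \<times> real \<times> real \<Rightarrow> real) \<Rightarrow> real \<Rightarrow> bool" where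
  "finite_intensity f t \<longleftrightarrow> (\<integral>\<^sup>+w. \<integral>\<^sup>+p. ennreal \<bar>f (w, p)\<bar> * indicator (strip t) p \<partial>m2 \<partial>M) < \<infinity>"

lemma predictable_section_real:
  fixes f :: "'w \<times> real \<times> real \<Rightarrow> real"
  assumes f: "f \<in> borel_measurable Pred" and t: "0 \<le> t" and w: "w \<in> space M"
  shows "(\<lambda>p. indicator (strip t) p *\<^sub>R f (w, p)) \<in> borel_measurable m2"
proof -
  have "(\<lambda>p. ennreal (f (w, p)) * indicator (strip t) p) \<in> borel_measurable m2"
    "(\<lambda>p. ennreal (- f (w, p)) * indicator (strip t) p) \<in> borel_measurable m2"
    by (intro predictable_section[of "\<lambda>x. ennreal (f x)"] predictable_section[of "\<lambda>x. ennreal (- f x)"] t w; use f in measurable)+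
  then have "(\<lambda>p. enn2real (ennreal (f (w, p)) * indicator (strip t) p) - enn2real (ennreal (- f (w, p)) * indicator (strip t) p))
      \<in> borel_measurable m2"
    by measurable
  moreover have "enn2real (ennreal (f (w, p)) * indicator (strip t) p) - enn2real (ennreal (- f (w, p)) * indicator (strip t) p)
    = indicator (strip t) p *\<^sub>R f (w, p)" for p
    by (cases "0 \<le> f (w, p)") (auto simp: indicator_def ennreal_neg)
  ultimately show ?thesis by simp
qed

text \<open>An arbitrary kernel is allowed so that one argument serves \<open>P\<close> and the
  constant kernel \<open>m2\<close>. The expectation is expressed through the integrals of the
  positive and negative parts, exactly the quantities that the compensation formula identifies for
  the two kernels.\<close>

lemma kernel_integral:
  fixes f :: "'w \<times> real \<times> real \<Rightarrow> real" and \<kappa> :: "'w \<Rightarrow> (real \<times> real) measure"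
  assumes f: "f \<in> borel_measurable Pred" and t: "0 \<le> t"
    and \<kappa>: "\<And>w. w \<in> space M \<Longrightarrow> sets (\<kappa> w) = sets m2"
    and meas: "\<And>g::'w \<times> real \<times> real \<Rightarrow> ennreal. g \<in> borel_measurable Pred \<Longrightarrow>
        (\<lambda>w. \<integral>\<^sup>+p. g (w, p) * indicator (strip t) p \<partial>\<kappa> w) \<in> borel_measurable (F t)"
    and fin: "(\<integral>\<^sup>+w. \<integral>\<^sup>+p. ennreal \<bar>f (w, p)\<bar> * indicator (strip t) p \<partial>\<kappa> w \<partial>M) < \<infinity>"
  shows "AE w in M. set_integrable (\<kappa> w) (strip t) (\<lambda>p. f (w, p))"
    and "(\<lambda>w. LINT p:strip t|\<kappa> w. f (w, p)) \<in> borel_measurable (F t)"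
    and "integrable M (\<lambda>w. LINT p:strip t|\<kappa> w. f (w, p))"
    and "(LINT w|M. (LINT p:strip t|\<kappa> w. f (w, p))) =
      enn2real (\<integral>\<^sup>+w. \<integral>\<^sup>+p. ennreal (f (w, p)) * indicator (strip t) p \<partial>\<kappa> w \<partial>M) -
      enn2real (\<integral>\<^sup>+w. \<integral>\<^sup>+p. ennreal (- f (w, p)) * indicator (strip t) p \<partial>\<kappa> w \<partial>M)"
proof -
  let ?A = "\<lambda>w. \<integral>\<^sup>+p. ennreal \<bar>f (w, p)\<bar> * indicator (strip t) p \<partial>\<kappa> w"
  let ?p = "\<lambda>w. \<integral>\<^sup>+p. ennreal (f (w, p)) * indicator (strip t) p \<partial>\<kappa> w"
  let ?n = "\<lambda>w. \<integral>\<^sup>+p. ennreal (- f (w, p)) * indicator (strip t) p \<partial>\<kappa> w"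
  have mA: "?A \<in> borel_measurable (F t)" and mp: "?p \<in> borel_measurable (F t)" and mn: "?n \<in> borel_measurable (F t)"
    by (intro meas; use f in measurable)+
  note mM = F_measurable_M[OF t mA] F_measurable_M[OF t mp] F_measurable_M[OF t mn]
  have fm: "(\<lambda>p. indicator (strip t) p *\<^sub>R f (w, p)) \<in> borel_measurable (\<kappa> w)" if w: "w \<in> space M" for w
    using predictable_section_real[OF f t w] by (subst measurable_cong_sets[OF \<kappa>[OF w] refl])
  have eA: "(\<integral>\<^sup>+p. ennreal (norm (indicator (strip t) p *\<^sub>R f (w, p))) \<partial>\<kappa> w) = ?A w" for w
    by (intro nn_integral_cong) (auto simp: indicator_def)
  have "AE w in M. ?A w \<noteq> \<infinity>"
    by (rule nn_integral_PInf_AE[OF mM(1)]) (use fin in simp)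
  then have A1: "AE w in M. set_integrable (\<kappa> w) (strip t) (\<lambda>p. f (w, p)) \<and> ?A w < \<infinity>"
    using AE_space
  proof eventually_elim
    case (elim w)
    then show ?case using fm[OF elim(2)] eA[of w]
      unfolding set_integrable_def integrable_iff_bounded by (simp add: less_top)
  qed
  then show "AE w in M. set_integrable (\<kappa> w) (strip t) (\<lambda>p. f (w, p))" by eventually_elim simp
  have le: "?p w \<le> ?A w" "?n w \<le> ?A w" for w
    by (intro nn_integral_mono mult_right_mono ennreal_leI; simp)+
  have A2: "AE w in M. enn2real (?p w) - enn2real (?n w) = (LINT p:strip t|\<kappa> w. f (w, p)) \<and>
     ?p w < \<infinity> \<and> ?n w < \<infinity>"
    using A1
  proof eventually_elim
    case (elim w)
    then have i: "integrable (\<kappa> w) (\<lambda>p. indicator (strip t) p *\<^sub>R f (w, p))"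
      by (simp add: set_integrable_def)
    have "(LINT p:strip t|\<kappa> w. f (w, p)) = enn2real (?p w) - enn2real (?n w)"
      unfolding set_lebesgue_integral_def
      by (subst real_lebesgue_integral_def[OF i])
         (intro arg_cong2[where f="(-)"] arg_cong[where f=enn2real] nn_integral_cong; auto simp: indicator_def)
    then show ?case using le[of w] elim by (auto intro: le_less_trans)
  qed
  show mI: "(\<lambda>w. LINT p:strip t|\<kappa> w. f (w, p)) \<in> borel_measurable (F t)"
    by (rule F_measurable_AE[OF t, of "\<lambda>w. enn2real (?p w) - enn2real (?n w)"])
       (use mp mn A2 in \<open>auto elim: eventually_mono\<close>)
  have fp: "(\<integral>\<^sup>+w. ?p w \<partial>M) < \<infinity>" "(\<integral>\<^sup>+w. ?n w \<partial>M) < \<infinity>"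
    by (rule le_less_trans[OF nn_integral_mono fin], rule le)+
  have aux: "integrable M (\<lambda>w. enn2real (u w)) \<and> (LINT w|M. enn2real (u w)) = enn2real (\<integral>\<^sup>+w. u w \<partial>M)"
    if u: "u \<in> borel_measurable M" and ae: "AE w in M. u w < \<infinity>" and fu: "(\<integral>\<^sup>+w. u w \<partial>M) < \<infinity>" for u
  proof -
    have e: "(\<integral>\<^sup>+w. ennreal (enn2real (u w)) \<partial>M) = (\<integral>\<^sup>+w. u w \<partial>M)"
      by (rule nn_integral_cong_AE) (use ae in \<open>auto elim!: eventually_mono\<close>)
    have m: "(\<lambda>w. enn2real (u w)) \<in> borel_measurable M" using u by measurable
    have "integrable M (\<lambda>w. enn2real (u w))"
      by (rule integrableI_nonneg[OF m]) (use fu in \<open>auto simp: e\<close>)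
    moreover have "(LINT w|M. enn2real (u w)) = enn2real (\<integral>\<^sup>+w. u w \<partial>M)"
      by (subst integral_eq_nn_integral[OF m]) (simp_all add: e)
    ultimately show ?thesis by blast
  qed
  have fin_ae: "AE w in M. ?p w < \<infinity>" "AE w in M. ?n w < \<infinity>"
    by (rule eventually_mono[OF A2], simp)+
  have ip: "integrable M (\<lambda>w. enn2real (?p w))" "integrable M (\<lambda>w. enn2real (?n w))"
    and Lp: "(LINT w|M. enn2real (?p w)) = enn2real (\<integral>\<^sup>+w. ?p w \<partial>M)"
    "(LINT w|M. enn2real (?n w)) = enn2real (\<integral>\<^sup>+w. ?n w \<partial>M)"
    using aux[OF mM(2) fin_ae(1) fp(1)] aux[OF mM(3) fin_ae(2) fp(2)] by blast+
  have "integrable M (\<lambda>w. enn2real (?p w) - enn2real (?n w))" using ip by auto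
  then show "integrable M (\<lambda>w. LINT p:strip t|\<kappa> w. f (w, p))"
    by (rule integrable_cong_AE_imp) (use F_measurable_M[OF t mI] A2 in \<open>auto elim: eventually_mono\<close>)
  have "(LINT w|M. (LINT p:strip t|\<kappa> w. f (w, p))) = (LINT w|M. enn2real (?p w) - enn2real (?n w))"
    by (rule integral_cong_AE) (use F_measurable_M[OF t mI] mM A2 in \<open>auto elim: eventually_mono\<close>)
  then show "(LINT w|M. (LINT p:strip t|\<kappa> w. f (w, p))) = enn2real (\<integral>\<^sup>+w. ?p w \<partial>M) - enn2real (\<integral>\<^sup>+w. ?n w \<partial>M)"
    using ip Lp by simp
qed

text \<open>Finiteness is assumed for the intensity only; the compensation formula applied to the
  absolute value transfers it to the random measure, and applied to both parts it equates the
  expectations.\<close>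

lemma
  fixes f :: "'w \<times> real \<times> real \<Rightarrow> real"
  assumes f: "f \<in> borel_measurable Pred" and t: "0 \<le> t" and fin: "finite_intensity f t"
  shows jump_set_integrable: "AE w in M. set_integrable (P w) (strip t) (\<lambda>p. f (w, p))"
    and jump_integral_measurable: "jump_integral f t \<in> borel_measurable (F t)"
    and jump_integral_integrable: "integrable M (jump_integral f t)"
    and compensator_set_integrable: "AE w in M. set_integrable m2 (strip t) (\<lambda>p. f (w, p))"
    and compensator_measurable: "compensator f t \<in> borel_measurable (F t)"
    and compensator_integrable: "integrable M (compensator f t)"
    and expectation_jump_integral: "(LINT w|M. jump_integral f t w) = (LINT w|M. compensator f t w)"
proof -
  have c: "(\<integral>\<^sup>+w. \<integral>\<^sup>+p. g (w, p) * indicator (strip t) p \<partial>P w \<partial>M) =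
    (\<integral>\<^sup>+w. \<integral>\<^sup>+p. g (w, p) * indicator (strip t) p \<partial>m2 \<partial>M)" if "g \<in> borel_measurable Pred"
    for g :: "'w \<times> real \<times> real \<Rightarrow> ennreal"
    using predictable_compensation[OF that t] .
  have fin2: "(\<integral>\<^sup>+w. \<integral>\<^sup>+p. ennreal \<bar>f (w, p)\<bar> * indicator (strip t) p \<partial>m2 \<partial>M) < \<infinity>"
    using fin by (simp add: finite_intensity_def)
  have "(\<lambda>x. ennreal \<bar>f x\<bar>) \<in> borel_measurable Pred" using f by measurable
  from c[OF this] fin2 have fin1: "(\<integral>\<^sup>+w. \<integral>\<^sup>+p. ennreal \<bar>f (w, p)\<bar> * indicator (strip t) p \<partial>P w \<partial>M) < \<infinity>"
    by simp
  note K1 = kernel_integral[where \<kappa>=P, OF f t sets_P predictable_P_measurable[OF _ t] fin1]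
  note K2 = kernel_integral[where \<kappa>="\<lambda>_. m2", OF f t refl predictable_m2_measurable[OF _ t] fin2]
  show "AE w in M. set_integrable (P w) (strip t) (\<lambda>p. f (w, p))" using K1(1) .
  show "AE w in M. set_integrable m2 (strip t) (\<lambda>p. f (w, p))" using K2(1) .
  show "jump_integral f t \<in> borel_measurable (F t)" "integrable M (jump_integral f t)"
    using K1(2,3) by (simp_all add: jump_integral_def[abs_def])
  show "compensator f t \<in> borel_measurable (F t)" "integrable M (compensator f t)"
    using K2(2,3) by (simp_all add: compensator_def[abs_def])
  have "(\<lambda>x. ennreal (f x)) \<in> borel_measurable Pred" "(\<lambda>x. ennreal (- f x)) \<in> borel_measurable Pred"
    using f by measurable
  note cc = c[OF this(1)] c[OF this(2)]
  show "(LINT w|M. jump_integral f t w) = (LINT w|M. compensator f t w)"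
    unfolding jump_integral_def compensator_def
  proof -
    have 1: "(LINT w|M. (LINT p:strip t|P w. f (w, p))) =
      enn2real (\<integral>\<^sup>+w. \<integral>\<^sup>+p. ennreal (f (w, p)) * indicator (strip t) p \<partial>P w \<partial>M) -
      enn2real (\<integral>\<^sup>+w. \<integral>\<^sup>+p. ennreal (- f (w, p)) * indicator (strip t) p \<partial>P w \<partial>M)"
      by (rule K1(4))
    have 2: "(LINT w|M. (LINT p:strip t|m2. f (w, p))) =
      enn2real (\<integral>\<^sup>+w. \<integral>\<^sup>+p. ennreal (f (w, p)) * indicator (strip t) p \<partial>m2 \<partial>M) -
      enn2real (\<integral>\<^sup>+w. \<integral>\<^sup>+p. ennreal (- f (w, p)) * indicator (strip t) p \<partial>m2 \<partial>M)"
      by (rule K2(4))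
    show "(LINT w|M. (LINT p:strip t|P w. f (w, p))) = (LINT w|M. (LINT p:strip t|m2. f (w, p)))"
      unfolding 1 2 cc ..
  qed
qed

text \<open>Cutting the integrand down to the predictable set \<open>A \<times> (s,t] \<times> \<real>\<close> turns the compensation
  formula into the martingale property.\<close>

lemma compensated_martingale:
  fixes f :: "'w \<times> real \<times> real \<Rightarrow> real"
  assumes f: "f \<in> borel_measurable Pred" and fin: "\<And>t. 0 \<le> t \<Longrightarrow> finite_intensity f t"
  shows "martingale M F (\<lambda>t w. jump_integral f t w - compensator f t w)"
  unfolding martingale_def
proof (intro conjI allI impI)
  fix t :: real assume t: "0 \<le> t"
  note r = f t fin[OF t]
  show "(\<lambda>w. jump_integral f t w - compensator f t w) \<in> borel_measurable (F t)"
    using jump_integral_measurable[OF r] compensator_measurable[OF r] by simp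
  show "integrable M (\<lambda>w. jump_integral f t w - compensator f t w)"
    using jump_integral_integrable[OF r] compensator_integrable[OF r] by simp
next
  fix s t :: real assume s: "0 \<le> s" "s \<le> t"
  then have t: "0 \<le> t" by simp
  interpret S: finite_measure_subalgebra M "F s"
    by unfold_locales (rule F_subalgebra[OF s(1)])
  note rs = f s(1) fin[OF s(1)] and rt = f t fin[OF t]
  let ?V = "\<lambda>t w. jump_integral f t w - compensator f t w"
  have iV: "integrable M (?V s)" "integrable M (?V t)"
    using jump_integral_integrable[OF rs] compensator_integrable[OF rs]
      jump_integral_integrable[OF rt] compensator_integrable[OF rt] by simp_all
  show "AE w in M. real_cond_exp M (F s) (?V t) w = ?V s w"
  proof (rule S.real_cond_exp_charact)
    show "?V s \<in> borel_measurable (F s)"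
      using jump_integral_measurable[OF rs] compensator_measurable[OF rs] by simp
    fix A assume A: "A \<in> sets (F s)"
    let ?R = "A \<times> ({s<..t} \<times> UNIV) :: ('w \<times> real \<times> real) set"
    define g where "g x = indicator ?R x * f x" for x
    have R: "?R \<in> sets Pred" using s A by (intro rect_in_Pred) auto
    have g: "g \<in> borel_measurable Pred"
      unfolding g_def using f R by (intro borel_measurable_times borel_measurable_indicator)
    have "finite_intensity g t"
      using fin[OF t] unfolding finite_intensity_def
      by (rule le_less_trans[rotated])
         (intro nn_integral_mono mult_right_mono ennreal_leI, auto simp: g_def indicator_def)
    note rg = g t this
    \<comment> \<open>The measure is kept arbitrary so that the identity serves both
      \<open>P w\<close> and \<open>m2\<close>.\<close>
    have split: "(LINT p:strip t|\<kappa>. g (w, p)) = indicator A w * ((LINT p:strip t|\<kappa>. f (w, p)) - (LINT p:strip s|\<kappa>. f (w, p)))"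
      if "set_integrable \<kappa> (strip t) (\<lambda>p. f (w, p))" "sets \<kappa> = sets m2" for \<kappa> w
    proof -
      have i: "set_integrable \<kappa> (strip s) (\<lambda>p. f (w, p))" "set_integrable \<kappa> ({s<..t} \<times> UNIV) (\<lambda>p. f (w, p))"
        by (rule set_integrable_subset[OF that(1)]; use s that(2) m2_Times[of s UNIV t] strip_m2 in auto)+
      have "strip t = strip s \<union> {s<..t} \<times> UNIV" using s by auto
      then have "(LINT p:strip t|\<kappa>. f (w, p)) = (LINT p:strip s|\<kappa>. f (w, p)) + (LINT p:{s<..t} \<times> UNIV|\<kappa>. f (w, p))"
        using i by (simp only:) (rule set_integral_Un, auto)
      moreover have "(LINT p:strip t|\<kappa>. g (w, p)) = indicator A w * (LINT p:{s<..t} \<times> UNIV|\<kappa>. f (w, p))"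
        unfolding set_lebesgue_integral_def
        by (subst integral_mult_right_zero[symmetric], intro Bochner_Integration.integral_cong)
           (use s in \<open>auto simp: g_def indicator_def\<close>)
      ultimately show ?thesis by simp
    qed
    have jP: "AE w in M. jump_integral g t w = indicator A w * (jump_integral f t w - jump_integral f s w)"
      using jump_set_integrable[OF rt] AE_space
      by eventually_elim (auto simp: jump_integral_def split sets_P)
    have jm: "AE w in M. compensator g t w = indicator A w * (compensator f t w - compensator f s w)"
      using compensator_set_integrable[OF rt]
      by eventually_elim (auto simp: compensator_def split)
    have Am: "A \<in> events" using F_subset_M s A by blast
    have ii: "integrable M (\<lambda>w. indicator A w * (jump_integral f t w - jump_integral f s w))"
      "integrable M (\<lambda>w. indicator A w * (compensator f t w - compensator f s w))"
      using jump_integral_integrable[OF rs] compensator_integrable[OF rs]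
        jump_integral_integrable[OF rt] compensator_integrable[OF rt] Am
      by (auto intro!: integrable_real_mult_indicator simp: mult.commute[of "indicator A _"])
    have "(LINT w|M. indicator A w * (jump_integral f t w - jump_integral f s w)) =
       (LINT w|M. jump_integral g t w)"
      by (rule integral_cong_AE) (use jump_integral_integrable[OF rg] ii(1) jP in \<open>auto elim: eventually_mono\<close>)
    also have "\<dots> = (LINT w|M. compensator g t w)" by (rule expectation_jump_integral[OF rg])
    also have "\<dots> = (LINT w|M. indicator A w * (compensator f t w - compensator f s w))"
      by (rule integral_cong_AE) (use compensator_integrable[OF rg] ii(2) jm in \<open>auto elim: eventually_mono\<close>)
    finally have "(LINT w|M. indicator A w * (jump_integral f t w - jump_integral f s w) -
        indicator A w * (compensator f t w - compensator f s w)) = 0"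
      using ii by simp
    then have "(LINT w|M. indicator A w * ?V t w - indicator A w * ?V s w) = 0"
      by (simp add: algebra_simps)
    moreover have "integrable M (\<lambda>w. indicator A w * ?V t w)" "integrable M (\<lambda>w. indicator A w * ?V s w)"
      using iV Am by (auto intro!: integrable_real_mult_indicator simp: mult.commute[of "indicator A _"])
    ultimately have "(LINT w|M. indicator A w * ?V t w) = (LINT w|M. indicator A w * ?V s w)"
      by simp
    then show "(LINT w:A|M. ?V t w) = (LINT w:A|M. ?V s w)"
      unfolding set_lebesgue_integral_def by simp
  qed (use iV in auto)
qed

end

section \<open>Paths driven by an atomic measure\<close>

definition flow :: "real \<Rightarrow> state \<Rightarrow> state" where
  "flow r = (\<lambda>(i, y, n). (i, y + r, n))"

lemma flow_states: "0 \<le> r \<Longrightarrow> z \<in> states \<Longrightarrow> flow r z \<in> states"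
  by (cases z) (auto simp: flow_def)

lemma flow_0 [simp]: "flow 0 z = z"
  by (cases z) (simp add: flow_def)

lemma flow_flow: "flow r (flow s z) = flow (s + r) z"
  by (cases z) (simp add: flow_def)

lemma tendsto_flow: "((\<lambda>r. flow (r - s) z) \<longlongrightarrow> flow (t - s) z) (at t within S)"
  unfolding flow_def by (cases z) (auto intro!: tendsto_intros)

lemma set_integral_singleton:
  fixes f :: "real \<Rightarrow> real"
  shows "set_integrable lebesgue {x} f" "(LINT u:{x}|lebesgue. f u) = 0"
proof -
  have eq: "(\<lambda>u. indicator {x} u *\<^sub>R f u) = (\<lambda>u. indicator {x} u * f x)"
    by (auto simp: indicator_def)
  show "set_integrable lebesgue {x} f"
    unfolding set_integrable_def eq by (intro integrable_mult_left integrable_real_indicator) auto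
  show "(LINT u:{x}|lebesgue. f u) = 0"
    unfolding set_lebesgue_integral_def eq by simp
qed

lemma set_integral_AE_zero:
  assumes "AE p in Q. p \<in> A \<longrightarrow> f p = (0::real)"
  shows "(LINT p:A|Q. f p) = 0"
  unfolding set_lebesgue_integral_def
  by (rule integral_eq_zero_AE) (use assms in \<open>auto elim!: eventually_mono simp: indicator_def\<close>)

section \<open>Integer-valued measures with simple time slices\<close>

locale atomic_measure =
  fixes Q :: "(real \<times> real) measure"
  assumes sets_Q: "sets Q = sets m2"
    and Q_integer: "\<And>B. B \<in> sets m2 \<Longrightarrow> emeasure Q B \<in> insert \<infinity> (range of_nat)"
    and simple: "\<And>u. 0 < u \<Longrightarrow> emeasure Q ({u} \<times> UNIV) \<le> 1"
begin

lemma slice_Q: "0 < u \<Longrightarrow> C \<in> sets borel \<Longrightarrow> {u} \<times> C \<in> sets Q"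
  unfolding sets_Q sets_m2 by (auto simp flip: borel_prod)

lemma strip_Q: "0 \<le> s \<Longrightarrow> {s<..t} \<times> UNIV \<in> sets Q"
  unfolding sets_Q by (rule m2_Times) auto

lemma open_strip_Q: "0 \<le> s \<Longrightarrow> {s<..<t} \<times> UNIV \<in> sets Q"
  unfolding sets_Q sets_m2 by (auto simp flip: borel_prod)

text \<open>Since \<open>Q\<close> takes integer values and charges a time slice by at most one, it is carried on
  that slice by a single fibre of any countably-valued mark.\<close>

lemma slice_dichotomy:
  fixes m :: "real \<Rightarrow> 'c::countable"
  assumes u: "0 < u" and m: "m \<in> borel \<rightarrow>\<^sub>M count_space UNIV"
  obtains (null) "AE p in Q. p \<notin> {u} \<times> UNIV"
    | (atom) v where "emeasure Q ({u} \<times> UNIV) = 1" "AE p in Q. p \<in> {u} \<times> UNIV \<longrightarrow> m (snd p) = m v"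
proof (cases "emeasure Q ({u} \<times> UNIV) = 0")
  case True
  then have "{u} \<times> UNIV \<in> null_sets Q" using slice_Q[OF u] by auto
  then show ?thesis using null AE_not_in by blast
next
  case False
  have mC: "m -` C \<in> sets borel" for C
    using measurable_sets[OF m, of C] by simp
  have int: "emeasure Q ({u} \<times> C) = 0 \<or> 1 \<le> emeasure Q ({u} \<times> C)" if "C \<in> sets borel" for C
  proof -
    have "emeasure Q ({u} \<times> C) \<in> insert \<infinity> (range of_nat)"
      using slice_Q[OF u that] by (intro Q_integer) (simp add: sets_Q)
    then show ?thesis
    proof
      assume "emeasure Q ({u} \<times> C) \<in> range of_nat"
      then obtain k :: nat where k: "emeasure Q ({u} \<times> C) = of_nat k" by blast
      show ?thesis
      proof (cases "k = 0")
        case False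
        then have "of_nat 1 \<le> (of_nat k :: ennreal)" by (simp only: of_nat_le_iff)
        then show ?thesis using k by simp
      qed (use k in simp)
    qed simp
  qed
  have one: "emeasure Q ({u} \<times> UNIV) = 1"
    using int[of UNIV] False simple[OF u] by auto
  \<comment> \<open>Countability of the values of \<open>m\<close> enters here: a slice of mass one
    cannot be a countable union of null fibres.\<close>
  have "\<exists>c. emeasure Q ({u} \<times> m -` {c}) \<noteq> 0"
  proof (rule ccontr)
    assume "\<not> ?thesis"
    then have "(\<Union>c. {u} \<times> m -` {c}) \<in> null_sets Q"
      using slice_Q[OF u mC] by (intro null_sets_UN') (auto simp: null_sets_def)
    moreover have "(\<Union>c. {u} \<times> m -` {c}) = {u} \<times> UNIV" by auto
    ultimately show False using False by auto
  qed
  then obtain c where c: "emeasure Q ({u} \<times> m -` {c}) \<noteq> 0" by blast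
  then have c1: "1 \<le> emeasure Q ({u} \<times> m -` {c})" using int[OF mC, of "{c}"] by blast
  have "emeasure Q ({u} \<times> m -` {c}) + emeasure Q ({u} \<times> m -` (- {c})) = emeasure Q ({u} \<times> m -` {c} \<union> {u} \<times> m -` (- {c}))"
    by (rule plus_emeasure) (use slice_Q[OF u mC] in auto)
  also have "{u} \<times> m -` {c} \<union> {u} \<times> m -` (- {c}) = {u} \<times> UNIV" by auto
  finally have s: "emeasure Q ({u} \<times> m -` {c}) + emeasure Q ({u} \<times> m -` (- {c})) = 1"
    using one by simp
  have "emeasure Q ({u} \<times> m -` (- {c})) = 0"
  proof (rule ccontr)
    assume "\<not> ?thesis"
    then have "1 \<le> emeasure Q ({u} \<times> m -` (- {c}))" using int[OF mC, of "- {c}"] by blast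
    then have "1 + 1 \<le> (1::ennreal)" using add_mono[OF c1] s by metis
    moreover have "(1::ennreal) < 1 + 1" using ennreal_less_iff[of 1 2] by simp
    ultimately show False by simp
  qed
  then have "{u} \<times> m -` (- {c}) \<in> null_sets Q" using slice_Q[OF u mC] by auto
  then have ae: "AE p in Q. p \<notin> {u} \<times> m -` (- {c})" by (rule AE_not_in)
  have "m -` {c} \<noteq> {}" using c by force
  then obtain v where v: "m v = c" by blast
  show ?thesis
    by (rule atom[of v, OF one]) (use ae v in \<open>auto elim!: eventually_mono\<close>)
qed

lemma slice_integral:
  fixes f :: "real \<times> real \<Rightarrow> real"
  assumes "0 < u" "emeasure Q ({u} \<times> UNIV) = 1" "AE p in Q. p \<in> {u} \<times> UNIV \<longrightarrow> f p = c"
    "(\<lambda>p. indicator ({u} \<times> UNIV) p *\<^sub>R f p) \<in> borel_measurable Q"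
  shows "(LINT p:{u} \<times> UNIV|Q. f p) = c"
proof -
  have "(LINT p:{u} \<times> UNIV|Q. f p) = (LINT p|Q. indicator ({u} \<times> UNIV) p * c)"
    unfolding set_lebesgue_integral_def
    by (rule integral_cong_AE)
       (use assms slice_Q[OF assms(1), of UNIV] in \<open>auto elim!: eventually_mono simp: indicator_def intro!: borel_measurable_times borel_measurable_indicator\<close>)
  also have "\<dots> = c"
    using assms(2) slice_Q[OF assms(1), of UNIV] by (simp add: measure_def sets.Int_space_eq2)
  finally show ?thesis .
qed

end

section \<open>A single deterministic path solving the equation\<close>

locale jump_path = jump_rates lam prec + atomic_measure Q
  for lam prec Q +
  fixes \<zeta> :: "real \<Rightarrow> state"
  assumes path_states: "\<And>t. 0 \<le> t \<Longrightarrow> \<zeta> t \<in> states"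
    and path_cadlag: "cadlag \<zeta>"
    and path_eq: "\<And>t. 0 \<le> t \<Longrightarrow> (let D = {0<..t} \<times> UNIV;
           H = (\<lambda>(u, v). h_Lam lam prec (Lim (at_left u) \<zeta>) v);
           G = (\<lambda>(u, v). g_Lam lam prec (Lim (at_left u) \<zeta>) v);
           K = (\<lambda>(u, v). fst (snd (Lim (at_left u) \<zeta>)) * g_Lam lam prec (Lim (at_left u) \<zeta>) v)
       in set_integrable Q D H \<and> set_integrable Q D G \<and> set_integrable Q D K \<and>
          real (fst (\<zeta> t)) = real (fst (\<zeta> 0)) + (LINT p:D|Q. H p) \<and>
          fst (snd (\<zeta> t)) = fst (snd (\<zeta> 0)) + t - (LINT p:D|Q. K p) \<and>
          real (snd (snd (\<zeta> t))) = real (snd (snd (\<zeta> 0))) + (LINT p:D|Q. G p))"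
begin

definition zl :: "real \<Rightarrow> state" where "zl u = Lim (at_left u) \<zeta>"

abbreviation "cnt t \<equiv> snd (snd (\<zeta> t))"

definition hG :: "real \<times> real \<Rightarrow> real" where "hG p = g_Lam lam prec (zl (fst p)) (snd p)"
definition hH :: "real \<times> real \<Rightarrow> real" where "hH p = h_Lam lam prec (zl (fst p)) (snd p)"
definition hK :: "real \<times> real \<Rightarrow> real" where "hK p = fst (snd (zl (fst p))) * g_Lam lam prec (zl (fst p)) (snd p)"

lemma path_eqs:
  assumes "0 \<le> t"
  shows "set_integrable Q ({0<..t} \<times> UNIV) hH" "set_integrable Q ({0<..t} \<times> UNIV) hG" "set_integrable Q ({0<..t} \<times> UNIV) hK"
    "real (fst (\<zeta> t)) = real (fst (\<zeta> 0)) + (LINT p:{0<..t} \<times> UNIV|Q. hH p)"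
    "fst (snd (\<zeta> t)) = fst (snd (\<zeta> 0)) + t - (LINT p:{0<..t} \<times> UNIV|Q. hK p)"
    "real (cnt t) = real (cnt 0) + (LINT p:{0<..t} \<times> UNIV|Q. hG p)"
  using path_eq[OF assms] unfolding Let_def hG_def[abs_def] hH_def[abs_def] hK_def[abs_def] zl_def split_beta
  by blast+

lemma tendsto_zl: "0 < u \<Longrightarrow> (\<zeta> \<longlongrightarrow> zl u) (at_left u)"
  unfolding zl_def using path_cadlag tendsto_Lim[OF trivial_limit_at_left_real]
  unfolding cadlag_def by metis

lemma zl_eqI: "0 < u \<Longrightarrow> (\<zeta> \<longlongrightarrow> z) (at_left u) \<Longrightarrow> zl u = z"
  unfolding zl_def by (rule tendsto_Lim[OF trivial_limit_at_left_real])

lemma eventually_left_nonneg: "0 < u \<Longrightarrow> \<forall>\<^sub>F s in at_left (u::real). 0 \<le> s"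
  unfolding eventually_at_left_field by (intro exI[of _ 0]) auto

lemma zl_discrete:
  assumes "0 < u"
  shows "\<forall>\<^sub>F s in at_left u. fst (\<zeta> s) = fst (zl u)" "\<forall>\<^sub>F s in at_left u. cnt s = snd (snd (zl u))"
proof -
  note t = tendsto_zl[OF assms]
  show "\<forall>\<^sub>F s in at_left u. fst (\<zeta> s) = fst (zl u)"
    using topological_tendstoD[OF tendsto_fst[OF t] discrete_topology_class.open_discrete[of "{fst (zl u)}"]] by simp
  show "\<forall>\<^sub>F s in at_left u. cnt s = snd (snd (zl u))"
    using topological_tendstoD[OF tendsto_snd[OF tendsto_snd[OF t]] discrete_topology_class.open_discrete[of "{snd (snd (zl u))}"]] by simp
qed

lemma zl_states:
  assumes "0 < u"
  shows "zl u \<in> states"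
proof -
  have st: "\<forall>\<^sub>F s in at_left u. \<zeta> s \<in> states"
    using eventually_left_nonneg[OF assms] by eventually_elim (rule path_states)
  have "\<forall>\<^sub>F s in at_left u. fst (zl u) \<in> XX"
    using zl_discrete(1)[OF assms] st by eventually_elim (auto simp: states_def)
  then have 1: "fst (zl u) \<in> XX" by simp
  have "\<forall>\<^sub>F s in at_left u. 0 \<le> fst (snd (\<zeta> s))"
    using st by eventually_elim (auto simp: states_def)
  then have "0 \<le> fst (snd (zl u))"
    by (rule tendsto_lowerbound[OF tendsto_fst[OF tendsto_snd[OF tendsto_zl[OF assms]]]]) simp
  with 1 show ?thesis by (cases "zl u") simp
qed

lemma hG_eq: "0 < fst p \<Longrightarrow> hG p = (if jmp (zl (fst p)) (snd p) = 0 then 0 else 1)"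
  unfolding hG_def by (rule g_Lam_eq[OF zl_states])

lemma hH_eq: "0 < fst p \<Longrightarrow> hH p = (if jmp (zl (fst p)) (snd p) = 0 then 0
    else real (jmp (zl (fst p)) (snd p)) - real (fst (zl (fst p))))"
  unfolding hH_def by (rule h_Lam_eq[OF zl_states])

lemma hK_eq: "hK p = fst (snd (zl (fst p))) * hG p"
  by (simp add: hK_def hG_def)

lemma increments:
  assumes "0 \<le> s" "s \<le> t"
  shows "set_integrable Q ({s<..t} \<times> UNIV) hH" "set_integrable Q ({s<..t} \<times> UNIV) hG" "set_integrable Q ({s<..t} \<times> UNIV) hK"
    "real (fst (\<zeta> t)) = real (fst (\<zeta> s)) + (LINT p:{s<..t} \<times> UNIV|Q. hH p)"
    "fst (snd (\<zeta> t)) = fst (snd (\<zeta> s)) + (t - s) - (LINT p:{s<..t} \<times> UNIV|Q. hK p)"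
    "real (cnt t) = real (cnt s) + (LINT p:{s<..t} \<times> UNIV|Q. hG p)"
proof -
  have t: "0 \<le> t" using assms by simp
  have un: "{0<..t} \<times> (UNIV::real set) = {0<..s} \<times> UNIV \<union> {s<..t} \<times> UNIV" using assms by auto
  have i: "set_integrable Q ({s<..t} \<times> UNIV) f"
    and e: "(LINT p:{0<..t} \<times> UNIV|Q. f p) = (LINT p:{0<..s} \<times> UNIV|Q. f p) + (LINT p:{s<..t} \<times> UNIV|Q. f p)"
    if "set_integrable Q ({0<..t} \<times> UNIV) f" for f :: "real \<times> real \<Rightarrow> real"
  proof -
    show 1: "set_integrable Q ({s<..t} \<times> UNIV) f"
      by (rule set_integrable_subset[OF that strip_Q[OF assms(1)]]) (use assms in auto)
    have 2: "set_integrable Q ({0<..s} \<times> UNIV) f"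
      by (rule set_integrable_subset[OF that strip_Q]) (use assms in auto)
    show "(LINT p:{0<..t} \<times> UNIV|Q. f p) = (LINT p:{0<..s} \<times> UNIV|Q. f p) + (LINT p:{s<..t} \<times> UNIV|Q. f p)"
      unfolding un by (rule set_integral_Un[OF _ 2 1]) auto
  qed
  note P = path_eqs[OF t] and S = path_eqs[OF assms(1)]
  show "set_integrable Q ({s<..t} \<times> UNIV) hH" "set_integrable Q ({s<..t} \<times> UNIV) hG" "set_integrable Q ({s<..t} \<times> UNIV) hK"
    using i P by blast+
  show "real (fst (\<zeta> t)) = real (fst (\<zeta> s)) + (LINT p:{s<..t} \<times> UNIV|Q. hH p)"
    using P(4) S(4) e[OF P(1)] by linarith
  show "fst (snd (\<zeta> t)) = fst (snd (\<zeta> s)) + (t - s) - (LINT p:{s<..t} \<times> UNIV|Q. hK p)"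
    using P(5) S(5) e[OF P(3)] by linarith
  show "real (cnt t) = real (cnt s) + (LINT p:{s<..t} \<times> UNIV|Q. hG p)"
    using P(6) S(6) e[OF P(2)] by linarith
qed

lemma cnt_mono:
  assumes "0 \<le> s" "s \<le> t" shows "cnt s \<le> cnt t"
proof -
  have "0 \<le> (LINT p:{s<..t} \<times> UNIV|Q. hG p)"
    unfolding set_lebesgue_integral_def
    by (rule integral_nonneg_AE) (use assms hG_eq in \<open>auto simp: indicator_def\<close>)
  then show ?thesis using increments(6)[OF assms] by linarith
qed

text \<open>The counter grows by the integral of the nonnegative \<open>hG\<close>, so no growth
  forces \<open>hG\<close>, the indicator of a hit, to vanish almost everywhere.\<close>

lemma no_hit:
  assumes "0 \<le> s" "s \<le> t" "cnt s = cnt t"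
  shows "AE p in Q. p \<in> {s<..t} \<times> UNIV \<longrightarrow> jmp (zl (fst p)) (snd p) = 0"
proof -
  let ?f = "\<lambda>p. indicator ({s<..t} \<times> UNIV) p *\<^sub>R hG p"
  have "(LINT p|Q. ?f p) = 0"
    using increments(6)[OF assms(1,2)] assms(3) by (simp add: set_lebesgue_integral_def)
  moreover have "integrable Q ?f"
    using increments(2)[OF assms(1,2)] by (simp add: set_integrable_def)
  moreover have "AE p in Q. 0 \<le> ?f p"
    using assms hG_eq by (auto simp: indicator_def)
  ultimately have "AE p in Q. ?f p = 0"
    using integral_nonneg_eq_0_iff_AE by blast
  then show ?thesis
  proof eventually_elim
    case (elim p)
    show ?case using elim hG_eq[of p] assms by (auto split: if_splits)
  qed
qed

lemma no_hit_integrals: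
  assumes "AE p in Q. p \<in> A \<longrightarrow> jmp (zl (fst p)) (snd p) = 0" "A \<subseteq> {0<..} \<times> UNIV"
  shows "(LINT p:A|Q. hG p) = 0" "(LINT p:A|Q. hH p) = 0" "(LINT p:A|Q. hK p) = 0"
proof -
  have "AE p in Q. p \<in> A \<longrightarrow> hG p = 0 \<and> hH p = 0 \<and> hK p = 0"
    using assms(1)
  proof eventually_elim
    case (elim p)
    show ?case
    proof
      assume p: "p \<in> A"
      then have "0 < fst p" using assms(2) by auto
      then show "hG p = 0 \<and> hH p = 0 \<and> hK p = 0" using elim p by (simp add: hG_eq hH_eq hK_eq)
    qed
  qed
  then show "(LINT p:A|Q. hG p) = 0" "(LINT p:A|Q. hH p) = 0" "(LINT p:A|Q. hK p) = 0"
    by (auto intro!: set_integral_AE_zero elim!: eventually_mono)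
qed

lemma flow_between:
  assumes "0 \<le> s" "s \<le> t" "cnt s = cnt t"
  shows "\<zeta> t = flow (t - s) (\<zeta> s)"
proof -
  have "{s<..t} \<times> (UNIV::real set) \<subseteq> {0<..} \<times> UNIV" using assms by auto
  note z = no_hit_integrals[OF no_hit[OF assms] this]
  have "fst (\<zeta> t) = fst (\<zeta> s)" "fst (snd (\<zeta> t)) = fst (snd (\<zeta> s)) + (t - s)"
    using increments(4,5)[OF assms(1,2)] z by simp_all
  then show ?thesis using assms(3)
    by (cases "\<zeta> s"; cases "\<zeta> t") (simp add: flow_def)
qed

lemma zl_flow:
  assumes "0 \<le> s" "s < t" "\<And>r. s \<le> r \<Longrightarrow> r < t \<Longrightarrow> cnt r = cnt s"
  shows "zl t = flow (t - s) (\<zeta> s)"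
proof (rule zl_eqI)
  have "flow (r - s) (\<zeta> s) = \<zeta> r" if "s < r" "r < t" for r
    using flow_between[of s r] assms(3)[of r] that assms(1) by simp
  then have "\<forall>\<^sub>F r in at_left t. flow (r - s) (\<zeta> s) = \<zeta> r"
    unfolding eventually_at_left_field using assms(2) by blast
  then show "(\<zeta> \<longlongrightarrow> flow (t - s) (\<zeta> s)) (at_left t)"
    by (rule Lim_transform_eventually[OF tendsto_flow])
qed (use assms in simp)

text \<open>Equal counters exclude a jump at \<open>t\<close> itself, so the left limit and the
  value continue the same flow line.\<close>

lemma zl_eq_path:
  assumes "0 \<le> s" "s < t" "cnt s = cnt t"
  shows "zl t = \<zeta> t"
proof -
  have "cnt r = cnt s" if "s \<le> r" "r < t" for r
    using cnt_mono[of s r] cnt_mono[of r t] assms that by simp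
  then show ?thesis
    using zl_flow[of s t] flow_between[of s t] assms by simp
qed

text \<open>The counter lives in a discrete space, so right continuity makes it constant on a short
  interval. On the left only a limit exists, and the corresponding interval excludes the point
  itself, where a jump may occur.\<close>

lemma right_constant:
  assumes "0 \<le> x"
  obtains d where "0 < d" "\<And>b. x \<le> b \<Longrightarrow> b < x + d \<Longrightarrow> cnt x = cnt b"
proof -
  have t: "(\<zeta> \<longlongrightarrow> \<zeta> x) (at_right x)"
    using path_cadlag assms unfolding cadlag_def continuous_within by blast
  have "\<forall>\<^sub>F b in at_right x. cnt b = cnt x"
    using topological_tendstoD[OF tendsto_snd[OF tendsto_snd[OF t]] discrete_topology_class.open_discrete[of "{cnt x}"]] by simp
  then obtain e where e: "x < e" "\<And>b. x < b \<Longrightarrow> b < e \<Longrightarrow> cnt b = cnt x"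
    unfolding eventually_at_right_field by blast
  show ?thesis
  proof (rule that[of "e - x"])
    fix b assume "x \<le> b" "b < x + (e - x)"
    then show "cnt x = cnt b" using e(2)[of b] by (cases "x = b") auto
  qed (use e in simp)
qed

lemma left_constant:
  assumes "0 < x"
  obtains d where "0 < d" "\<And>s r. 0 \<le> s \<Longrightarrow> x - d < s \<Longrightarrow> s \<le> r \<Longrightarrow> r < x \<Longrightarrow> cnt r = cnt s"
proof -
  obtain e where e: "e < x" "\<And>b. e < b \<Longrightarrow> b < x \<Longrightarrow> cnt b = snd (snd (zl x))"
    using zl_discrete(2)[OF assms] unfolding eventually_at_left_field by blast
  show ?thesis
    by (rule that[of "x - e"]) (use e in auto)
qed

text \<open>At \<open>x\<close> the counter may jump, so \<open>no_hit\<close> is applied on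
  half-open intervals \<open>(s, r n]\<close> that increase to the open one.\<close>

lemma no_hit_open:
  assumes "0 \<le> s" "\<And>r. s \<le> r \<Longrightarrow> r < x \<Longrightarrow> cnt r = cnt s"
  shows "AE p in Q. p \<in> {s<..<x} \<times> UNIV \<longrightarrow> jmp (zl (fst p)) (snd p) = 0"
proof -
  show ?thesis
  proof (cases "s < x")
    case sx: True
  define r where "r n = x - (x - s) / real (Suc n)" for n
  have "AE p in Q. p \<in> {s<..r n} \<times> UNIV \<longrightarrow> jmp (zl (fst p)) (snd p) = 0" for n
  proof (cases "s \<le> r n")
    case True
    have "r n < x" using sx by (simp add: r_def)
    then show ?thesis using no_hit[of s "r n"] assms(2)[of "r n"] True assms(1) by simp
  qed auto
  then have "AE p in Q. \<forall>n. p \<in> {s<..r n} \<times> UNIV \<longrightarrow> jmp (zl (fst p)) (snd p) = 0"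
    unfolding AE_all_countable by blast
  then show ?thesis
  proof eventually_elim
    case (elim p)
    show ?case
    proof
      assume p: "p \<in> {s<..<x} \<times> UNIV"
      then have f: "s < fst p" "fst p < x" by auto
      have "(\<lambda>n. x - (x - s) / real (Suc n)) \<longlonglongrightarrow> x - 0"
        by (intro tendsto_diff tendsto_const LIMSEQ_Suc lim_const_over_n)
      then have "\<forall>\<^sub>F n in sequentially. fst p < r n"
        unfolding r_def using f(2) by (intro order_tendstoD) auto
      then obtain n where "fst p < r n" using eventually_happens by fastforce
      then have "p \<in> {s<..r n} \<times> UNIV" using f by (cases p) auto
      then show "jmp (zl (fst p)) (snd p) = 0" by (rule elim[rule_format])
    qed
  qed
  qed auto
qed

text \<open>Shortly before \<open>x\<close> the path follows the flow and is not hit. In the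
  increment over \<open>(s, x]\<close> only the slice at \<open>x\<close> contributes, and the drift
  is already contained in the left limit.\<close>

lemma jump_at:
  assumes x: "0 < x"
  shows "set_integrable Q ({x} \<times> UNIV) hH" "set_integrable Q ({x} \<times> UNIV) hG" "set_integrable Q ({x} \<times> UNIV) hK"
    "real (fst (\<zeta> x)) = real (fst (zl x)) + (LINT p:{x} \<times> UNIV|Q. hH p)"
    "fst (snd (\<zeta> x)) = fst (snd (zl x)) - (LINT p:{x} \<times> UNIV|Q. hK p)"
    "real (cnt x) = real (snd (snd (zl x))) + (LINT p:{x} \<times> UNIV|Q. hG p)"
proof -
  obtain d where d: "0 < d" "\<And>s r. 0 \<le> s \<Longrightarrow> x - d < s \<Longrightarrow> s \<le> r \<Longrightarrow> r < x \<Longrightarrow> cnt r = cnt s"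
    using left_constant[OF x] by blast
  define s where "s = max 0 (x - d / 2)"
  have s: "0 \<le> s" "s < x" "x - d < s" using d x by (auto simp: s_def)
  have c: "cnt r = cnt s" if "s \<le> r" "r < x" for r using d(2)[of s r] s that by blast
  have z: "zl x = flow (x - s) (\<zeta> s)" by (rule zl_flow[OF s(1,2) c])
  note ae = no_hit_open[OF s(1) c]
  have sub: "{s<..<x} \<times> (UNIV::real set) \<subseteq> {0<..} \<times> UNIV" using s by auto
  note zero = no_hit_integrals[OF ae sub]
  have un: "{s<..x} \<times> (UNIV::real set) = {s<..<x} \<times> UNIV \<union> {x} \<times> UNIV" using s by auto
  have i: "set_integrable Q ({x} \<times> UNIV) f"
    and e: "(LINT p:{s<..x} \<times> UNIV|Q. f p) = (LINT p:{s<..<x} \<times> UNIV|Q. f p) + (LINT p:{x} \<times> UNIV|Q. f p)"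
    if "set_integrable Q ({s<..x} \<times> UNIV) f" for f :: "real \<times> real \<Rightarrow> real"
  proof -
    show 1: "set_integrable Q ({x} \<times> UNIV) f"
      by (rule set_integrable_subset[OF that slice_Q[OF x]]) (use s in auto)
    have 2: "set_integrable Q ({s<..<x} \<times> UNIV) f"
      by (rule set_integrable_subset[OF that open_strip_Q[OF s(1)]]) (use s in auto)
    show "(LINT p:{s<..x} \<times> UNIV|Q. f p) = (LINT p:{s<..<x} \<times> UNIV|Q. f p) + (LINT p:{x} \<times> UNIV|Q. f p)"
      unfolding un by (rule set_integral_Un[OF _ 2 1]) auto
  qed
  note I = increments[of s x]
  have I': "set_integrable Q ({s<..x} \<times> UNIV) hH" "set_integrable Q ({s<..x} \<times> UNIV) hG" "set_integrable Q ({s<..x} \<times> UNIV) hK"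
    using I s by simp_all
  show "set_integrable Q ({x} \<times> UNIV) hH" "set_integrable Q ({x} \<times> UNIV) hG" "set_integrable Q ({x} \<times> UNIV) hK"
    using i I' by blast+
  have f: "fst (zl x) = fst (\<zeta> s)" "fst (snd (zl x)) = fst (snd (\<zeta> s)) + (x - s)" "snd (snd (zl x)) = cnt s"
    unfolding z by (cases "\<zeta> s"; simp add: flow_def)+
  show "real (fst (\<zeta> x)) = real (fst (zl x)) + (LINT p:{x} \<times> UNIV|Q. hH p)"
    "fst (snd (\<zeta> x)) = fst (snd (zl x)) - (LINT p:{x} \<times> UNIV|Q. hK p)"
    "real (cnt x) = real (snd (snd (zl x))) + (LINT p:{x} \<times> UNIV|Q. hG p)"
    unfolding f using I(4-6) s e[OF I'(1)] e[OF I'(2)] e[OF I'(3)] zero by simp_all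
qed

lemma jump_at_null:
  assumes "0 < x" "AE p in Q. p \<notin> {x} \<times> UNIV"
  shows "\<zeta> x = zl x"
proof -
  have "(LINT p:{x} \<times> UNIV|Q. f p) = 0" for f :: "real \<times> real \<Rightarrow> real"
    by (rule set_integral_AE_zero) (use assms(2) in \<open>auto elim!: eventually_mono\<close>)
  then show ?thesis
    using jump_at(4-6)[OF assms(1)] by (cases "\<zeta> x"; cases "zl x") simp
qed

text \<open>The three integrands depend on the mark only through \<open>jmp\<close>, so a
  representative mark \<open>v\<close> evaluates all integrals over a slice of unit mass.\<close>

lemma jump_at_atom:
  assumes x: "0 < x" and one: "emeasure Q ({x} \<times> UNIV) = 1"
    and v: "AE p in Q. p \<in> {x} \<times> UNIV \<longrightarrow> jmp (zl x) (snd p) = jmp (zl x) v"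
  shows "\<zeta> x = move (zl x) v"
proof -
  have e: "(LINT p:{x} \<times> UNIV|Q. f p) = f (x, v)"
    if i: "set_integrable Q ({x} \<times> UNIV) f" and f: "\<And>v'. jmp (zl x) v' = jmp (zl x) v \<Longrightarrow> f (x, v') = f (x, v)"
    for f :: "real \<times> real \<Rightarrow> real"
  proof (rule slice_integral[OF x one])
    show "AE p in Q. p \<in> {x} \<times> UNIV \<longrightarrow> f p = f (x, v)"
      using v
    proof eventually_elim
      case (elim p)
      show ?case using elim f[of "snd p"] by (cases p) simp
    qed
    show "(\<lambda>p. indicator ({x} \<times> UNIV) p *\<^sub>R f p) \<in> borel_measurable Q"
      using i unfolding set_integrable_def by (rule borel_measurable_integrable)
  qed
  note J = jump_at[OF x]
  have "(LINT p:{x} \<times> UNIV|Q. hH p) = hH (x, v)" "(LINT p:{x} \<times> UNIV|Q. hG p) = hG (x, v)"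
    "(LINT p:{x} \<times> UNIV|Q. hK p) = hK (x, v)"
    by (intro e J; use x in \<open>simp add: hH_eq hG_eq hK_eq\<close>)+
  then have "real (fst (\<zeta> x)) = real (fst (zl x)) + hH (x, v)" "fst (snd (\<zeta> x)) = fst (snd (zl x)) - hK (x, v)"
    "real (cnt x) = real (snd (snd (zl x))) + hG (x, v)"
    using J by simp_all
  then show ?thesis
    using x by (cases "\<zeta> x"; cases "zl x") (auto simp: hH_eq hG_eq hK_eq move_def split: if_splits)
qed

lemma no_jump_path:
  assumes "0 \<le> u" "u \<le> t" "cnt t = cnt 0"
  shows "\<zeta> u = flow u (\<zeta> 0)" "0 < u \<Longrightarrow> zl u = flow u (\<zeta> 0)"
proof -
  have "cnt 0 = cnt u" using cnt_mono[of 0 u] cnt_mono[of u t] assms by simp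
  then show "\<zeta> u = flow u (\<zeta> 0)" "0 < u \<Longrightarrow> zl u = flow u (\<zeta> 0)"
    using flow_between[of 0 u] zl_eq_path[of 0 u] assms by simp_all
qed

text \<open>Along a piece of flow the age is time plus a constant, so translation invariance turns
  the null set \<open>E\<close> of ages into a null set of times. Near any time the path consists of
  two such pieces and one point, and \<open>Bolzano\<close> adds the local statements up.\<close>

lemma path_AE:
  assumes E: "E \<in> null_sets lborel" and T: "0 \<le> T"
  shows "AE u in lborel. u \<in> {0<..T} \<longrightarrow> zl u = \<zeta> u \<and> fst (snd (\<zeta> u)) \<notin> E"
proof -
  let ?G = "\<lambda>u. zl u = \<zeta> u \<and> fst (snd (\<zeta> u)) \<notin> E"
  \<comment> \<open>The local part of the bisection quantifies over all short intervals around a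
    point, including those that reach negative times; the premise on \<open>a\<close> makes the
    claim vacuous there.\<close>
  define R where "R a b \<longleftrightarrow> (0 \<le> a \<longrightarrow> (AE u in lborel. u \<in> {a<..b} \<longrightarrow> ?G u))" for a b
  have null: "AE u in lborel. u + c \<notin> E" for c
  proof -
    have "{u. u - (- c) \<in> E} \<in> null_sets lborel" by (rule null_sets_translation[OF E])
    then have "AE u in lborel. u \<notin> {u. u - (- c) \<in> E}" by (rule AE_not_in)
    then show ?thesis by simp
  qed
  have piece: "AE u in lborel. u \<in> {a<..<b} \<longrightarrow> ?G u"
    if a: "0 \<le> a" and c: "\<And>u. a \<le> u \<Longrightarrow> u < b \<Longrightarrow> cnt a = cnt u" for a b
    using null[of "fst (snd (\<zeta> a)) - a"]
  proof eventually_elim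
    case (elim u)
    show ?case
    proof
      assume u: "u \<in> {a<..<b}"
      then have "\<zeta> u = flow (u - a) (\<zeta> a)" using flow_between[of a u] a c[of u] by auto
      then have "fst (snd (\<zeta> u)) = u + (fst (snd (\<zeta> a)) - a)" by (cases "\<zeta> a") (simp add: flow_def)
      then show "?G u" using elim zl_eq_path[of a u] u a c[of u] by simp
    qed
  qed
  have point: "AE u in lborel. u \<noteq> (x::real)" for x by (rule AE_lborel_singleton)
  have "R 0 T"
    using T
  proof (induction rule: Bolzano)
    case (trans a b c)
    show ?case unfolding R_def
    proof
      assume a: "0 \<le> a"
      then have "AE u in lborel. u \<in> {a<..b} \<longrightarrow> ?G u" "AE u in lborel. u \<in> {b<..c} \<longrightarrow> ?G u" using trans by (simp_all add: R_def)
      then show "AE u in lborel. u \<in> {a<..c} \<longrightarrow> ?G u"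
        by eventually_elim auto
    qed
  next
    case (local x)
    obtain d1 where d1: "0 < d1" "\<And>b. x \<le> b \<Longrightarrow> b < x + d1 \<Longrightarrow> cnt x = cnt b"
      using right_constant[of x] local by blast
    have "\<exists>d2>0. \<forall>s r. 0 \<le> s \<longrightarrow> x - d2 < s \<longrightarrow> s \<le> r \<longrightarrow> r < x \<longrightarrow> cnt r = cnt s"
    proof (cases "x = 0")
      case False
      then have "0 < x" using local by simp
      then obtain d where "0 < d" "\<And>s r. 0 \<le> s \<Longrightarrow> x - d < s \<Longrightarrow> s \<le> r \<Longrightarrow> r < x \<Longrightarrow> cnt r = cnt s"
        using left_constant by blast
      then show ?thesis by blast
    qed (auto intro!: exI[of _ 1])
    then obtain d2 where d2: "0 < d2" "\<And>s r. 0 \<le> s \<Longrightarrow> x - d2 < s \<Longrightarrow> s \<le> r \<Longrightarrow> r < x \<Longrightarrow> cnt r = cnt s"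
      by blast
    show ?case unfolding R_def
    proof (intro exI[of _ "min d1 d2"] conjI allI impI)
      fix a b assume ab: "a \<le> x \<and> x \<le> b \<and> b - a < min d1 d2" and a: "0 \<le> a"
      have "AE u in lborel. u \<in> {a<..<x} \<longrightarrow> ?G u"
        by (rule piece[OF a], rule d2(2)[symmetric]) (use a ab in \<open>linarith+\<close>)
      moreover have "AE u in lborel. u \<in> {x<..<x + d1} \<longrightarrow> ?G u"
        by (rule piece[OF _ d1(2)]) (use a ab in linarith)
      ultimately show "AE u in lborel. u \<in> {a<..b} \<longrightarrow> ?G u"
        using point[of x]
      proof eventually_elim
        case (elim u)
        then show ?case using ab by (cases u x rule: linorder_cases) auto
      qed
    qed (use d1 d2 in simp)
  qed
  then show ?thesis by (simp add: R_def)
qed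

end

section \<open>Two paths driven by the same measure\<close>

locale two_paths = p1: jump_path lam prec Q \<zeta>1 + p2: jump_path lam prec Q \<zeta>2
  for lam prec Q \<zeta>1 \<zeta>2
begin

lemma right_flow:
  assumes "0 \<le> x"
  obtains d where "0 < d" "\<And>b. x \<le> b \<Longrightarrow> b < x + d \<Longrightarrow> p1.cnt x = p1.cnt b \<and> p2.cnt x = p2.cnt b"
proof -
  obtain d1 where d1: "0 < d1" "\<And>b. x \<le> b \<Longrightarrow> b < x + d1 \<Longrightarrow> p1.cnt x = p1.cnt b"
    using p1.right_constant[OF assms] by blast
  obtain d2 where d2: "0 < d2" "\<And>b. x \<le> b \<Longrightarrow> b < x + d2 \<Longrightarrow> p2.cnt x = p2.cnt b"
    using p2.right_constant[OF assms] by blast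
  show ?thesis
    by (rule that[of "min d1 d2"]) (use d1(1) d2(1) d1(2) d2(2) in \<open>simp_all\<close>)
qed

lemma left_flow:
  assumes "0 \<le> x"
  obtains d where "0 < d" "\<And>s r. 0 \<le> s \<Longrightarrow> x - d < s \<Longrightarrow> s \<le> r \<Longrightarrow> r < x \<Longrightarrow> p1.cnt r = p1.cnt s \<and> p2.cnt r = p2.cnt s"
proof (cases "x = 0")
  case True
  show ?thesis by (rule that[of 1]) (use True in auto)
next
  case False
  then have x: "0 < x" using assms by simp
  obtain d1 where d1: "0 < d1" "\<And>s r. 0 \<le> s \<Longrightarrow> x - d1 < s \<Longrightarrow> s \<le> r \<Longrightarrow> r < x \<Longrightarrow> p1.cnt r = p1.cnt s"
    using p1.left_constant[OF x] by blast
  obtain d2 where d2: "0 < d2" "\<And>s r. 0 \<le> s \<Longrightarrow> x - d2 < s \<Longrightarrow> s \<le> r \<Longrightarrow> r < x \<Longrightarrow> p2.cnt r = p2.cnt s"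
    using p2.left_constant[OF x] by blast
  show ?thesis
  proof (rule that[of "min d1 d2"])
    fix s r assume a: "0 \<le> s" "x - min d1 d2 < s" "s \<le> r" "r < x"
    have "x - d1 < s" "x - d2 < s" using a(2) by (auto simp: min_def split: if_splits)
    then show "p1.cnt r = p1.cnt s \<and> p2.cnt r = p2.cnt s" using d1(2)[of s r] d2(2)[of s r] a by blast
  qed (use d1(1) d2(1) in simp)
qed

definition jumps :: "(real \<Rightarrow> state \<times> state \<Rightarrow> real) \<Rightarrow> real \<times> real \<Rightarrow> real" where
  "jumps \<theta> p = p1.jump_diff (\<theta> (fst p)) (p1.zl (fst p)) (p2.zl (fst p)) (snd p)"

text \<open>\<open>\<theta>\<close> is absolutely continuous along the deterministic flow with density \<open>q\<close>; at an atom of \<open>Q\<close>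
  both paths move simultaneously.  Additivity and the local statement combine to the global one
  by a bisection argument.\<close>

lemma path_formula:
  fixes \<theta> q :: "real \<Rightarrow> state \<times> state \<Rightarrow> real"
  assumes T: "0 \<le> T"
    and bound: "\<And>u. 0 \<le> u \<Longrightarrow> u \<le> T \<Longrightarrow> bounded_on_states (\<theta> u) B"
    and flow: "\<And>u u' z1 z2. 0 \<le> u \<Longrightarrow> u \<le> u' \<Longrightarrow> u' \<le> T \<Longrightarrow> z1 \<in> states \<Longrightarrow> z2 \<in> states \<Longrightarrow>
      set_integrable lebesgue {u..u'} (\<lambda>x. q x (flow (x - u) z1, flow (x - u) z2)) \<and>
      \<theta> u' (flow (u' - u) z1, flow (u' - u) z2) - \<theta> u (z1, z2) =
        (LINT x:{u..u'}|lebesgue. q x (flow (x - u) z1, flow (x - u) z2))"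
    and meas: "(\<lambda>p. indicator ({0<..T} \<times> UNIV) p *\<^sub>R jumps \<theta> p) \<in> borel_measurable Q"
  shows "set_integrable Q ({0<..T} \<times> UNIV) (jumps \<theta>)"
    and "set_integrable lebesgue {0..T} (\<lambda>u. q u (\<zeta>1 u, \<zeta>2 u))"
    and "\<theta> T (\<zeta>1 T, \<zeta>2 T) - \<theta> 0 (\<zeta>1 0, \<zeta>2 0) =
      (LINT u:{0..T}|lebesgue. q u (\<zeta>1 u, \<zeta>2 u)) + (LINT p:{0<..T} \<times> UNIV|Q. jumps \<theta> p)"
proof -
  let ?S = "{0<..T} \<times> (UNIV :: real set)"
  let ?hit = "\<lambda>p. p1.jmp (p1.zl (fst p)) (snd p) \<noteq> 0 \<or> p1.jmp (p2.zl (fst p)) (snd p) \<noteq> 0"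
  have B0: "0 \<le> B"
    using bounded_on_statesD[OF bound[OF order_refl T] p1.path_states[OF order_refl] p2.path_states[OF order_refl]] by linarith
  \<comment> \<open>Each counter has a finite increment, so the hits of both paths are integrable up
    to \<open>T\<close>. Since jumps vanish without a hit, \<open>2 * B\<close> times the hits
    dominates them.\<close>
  have jb: "\<bar>jumps \<theta> p\<bar> \<le> 2 * B * (p1.hG p + p2.hG p)" if "p \<in> ?S" for p
  proof -
    have u: "0 < fst p" "fst p \<le> T" using that by auto
    have 1: "\<bar>jumps \<theta> p\<bar> \<le> 2 * B"
      unfolding jumps_def using u by (intro p1.jump_diff_bound bound p1.zl_states p2.zl_states) auto
    show ?thesis
      using 1 B0 p1.jump_diff_no_hit u unfolding p1.hG_eq[OF u(1)] p2.hG_eq[OF u(1)]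
      by (auto simp: jumps_def)
  qed
  have iS: "set_integrable Q ?S (\<lambda>p. 2 * B * (p1.hG p + p2.hG p))"
    by (intro set_integrable_mult_right set_integral_add(1)[OF p1.path_eqs(2)[OF T] p2.path_eqs(2)[OF T]])
  show I: "set_integrable Q ?S (jumps \<theta>)"
    unfolding set_integrable_def
    by (rule Bochner_Integration.integrable_bound[OF iS[unfolded set_integrable_def] meas])
       (use jb in \<open>auto simp: indicator_def intro: order_trans[OF _ abs_ge_self]\<close>)
  have sub: "set_integrable Q A (jumps \<theta>)" if "A \<in> sets Q" "A \<subseteq> ?S" for A
    by (rule set_integrable_subset[OF I that])
  define R where "R a b \<longleftrightarrow> (0 \<le> a \<longrightarrow> b \<le> T \<longrightarrow>
     set_integrable lebesgue {a..b} (\<lambda>u. q u (\<zeta>1 u, \<zeta>2 u)) \<and>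
     \<theta> b (\<zeta>1 b, \<zeta>2 b) - \<theta> a (\<zeta>1 a, \<zeta>2 a) =
      (LINT u:{a..b}|lebesgue. q u (\<zeta>1 u, \<zeta>2 u)) + (LINT p:{a<..b} \<times> UNIV|Q. jumps \<theta> p))" for a b
  have trans: "R a c" if ab: "R a b" and bc: "R b c" and o: "a \<le> b" "b \<le> c" for a b c
    unfolding R_def
  proof (intro impI)
    assume a: "0 \<le> a" and c: "c \<le> T"
    let ?q = "\<lambda>u. q u (\<zeta>1 u, \<zeta>2 u)"
    have 1: "set_integrable lebesgue {a..b} ?q" "set_integrable lebesgue {b..c} ?q"
      using ab bc a c o by (auto simp: R_def)
    have e: "{a..c} = {a..b} \<union> {b..c}" using o by auto
    have 2: "set_integrable lebesgue {a..c} ?q"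
      unfolding e using 1 by (intro set_integrable_Un) auto
    have 3: "(LINT u:{a..c}|lebesgue. ?q u) = (LINT u:{a..b}|lebesgue. ?q u) + (LINT u:{b..c}|lebesgue. ?q u)"
    proof -
      have "{a..c} = {a..b} \<union> {b<..c}" using o by auto
      moreover have "set_integrable lebesgue {b<..c} ?q"
        by (rule set_integrable_subset[OF 1(2)]) auto
      ultimately have "(LINT u:{a..c}|lebesgue. ?q u) = (LINT u:{a..b}|lebesgue. ?q u) + (LINT u:{b<..c}|lebesgue. ?q u)"
        using 1(1) by (simp only:) (rule set_integral_Un, auto)
      moreover have "(LINT u:{b..c}|lebesgue. ?q u) = (LINT u:{b}|lebesgue. ?q u) + (LINT u:{b<..c}|lebesgue. ?q u)"
      proof -
        have "{b..c} = {b} \<union> {b<..c}" using o by auto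
        then show ?thesis
          using set_integral_singleton(1) \<open>set_integrable lebesgue {b<..c} ?q\<close>
          by (simp only:) (rule set_integral_Un, auto)
      qed
      ultimately show ?thesis by (simp add: set_integral_singleton)
    qed
    have 4: "(LINT p:{a<..c} \<times> UNIV|Q. jumps \<theta> p) = (LINT p:{a<..b} \<times> UNIV|Q. jumps \<theta> p) + (LINT p:{b<..c} \<times> UNIV|Q. jumps \<theta> p)"
    proof -
      have "{a<..c} \<times> (UNIV::real set) = {a<..b} \<times> UNIV \<union> {b<..c} \<times> UNIV" using o by auto
      moreover have "set_integrable Q ({a<..b} \<times> UNIV) (jumps \<theta>)" "set_integrable Q ({b<..c} \<times> UNIV) (jumps \<theta>)"
        using a c o by (auto intro!: sub p1.strip_Q)
      ultimately show ?thesis by (simp only:) (rule set_integral_Un, auto)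
    qed
    show "set_integrable lebesgue {a..c} ?q \<and> \<theta> c (\<zeta>1 c, \<zeta>2 c) - \<theta> a (\<zeta>1 a, \<zeta>2 a) =
      (LINT u:{a..c}|lebesgue. ?q u) + (LINT p:{a<..c} \<times> UNIV|Q. jumps \<theta> p)"
      using ab bc a c o 2 3 4 unfolding R_def by simp
  qed
  have nohit: "AE p in Q. p \<in> A \<longrightarrow> jumps \<theta> p = 0"
    if "AE p in Q. p \<in> A \<longrightarrow> p1.jmp (p1.zl (fst p)) (snd p) = 0" "AE p in Q. p \<in> A \<longrightarrow> p1.jmp (p2.zl (fst p)) (snd p) = 0" for A
    using that by eventually_elim (auto simp: jumps_def p1.jump_diff_no_hit)
  have right: "R x b" if x: "0 \<le> x" "x \<le> b" and c: "p1.cnt x = p1.cnt b" "p2.cnt x = p2.cnt b" for x b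
    unfolding R_def
  proof (intro impI)
    assume b: "b \<le> T"
    have fl: "\<zeta>1 u = flow (u - x) (\<zeta>1 x)" "\<zeta>2 u = flow (u - x) (\<zeta>2 x)" if "x \<le> u" "u \<le> b" for u
      using p1.flow_between[of x u] p2.flow_between[of x u] that x c
        p1.cnt_mono[of x u] p1.cnt_mono[of u b] p2.cnt_mono[of x u] p2.cnt_mono[of u b] by auto
    have fq: "q u (\<zeta>1 u, \<zeta>2 u) = q u (flow (u - x) (\<zeta>1 x), flow (u - x) (\<zeta>2 x))" if "u \<in> {x..b}" for u
      using fl[of u] that by simp
    have cong: "set_integrable lebesgue {x..b} (\<lambda>u. q u (\<zeta>1 u, \<zeta>2 u)) =
       set_integrable lebesgue {x..b} (\<lambda>u. q u (flow (u - x) (\<zeta>1 x), flow (u - x) (\<zeta>2 x)))"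
      "(LINT u:{x..b}|lebesgue. q u (\<zeta>1 u, \<zeta>2 u)) = (LINT u:{x..b}|lebesgue. q u (flow (u - x) (\<zeta>1 x), flow (u - x) (\<zeta>2 x)))"
      by (rule set_integrable_cong[OF refl refl fq], assumption)
         (rule set_lebesgue_integral_cong, simp, intro allI impI fq)
    have z: "(LINT p:{x<..b} \<times> UNIV|Q. jumps \<theta> p) = 0"
      by (rule set_integral_AE_zero[OF nohit[OF p1.no_hit[OF x c(1)] p2.no_hit[OF x c(2)]]])
    show "set_integrable lebesgue {x..b} (\<lambda>u. q u (\<zeta>1 u, \<zeta>2 u)) \<and>
     \<theta> b (\<zeta>1 b, \<zeta>2 b) - \<theta> x (\<zeta>1 x, \<zeta>2 x) =
      (LINT u:{x..b}|lebesgue. q u (\<zeta>1 u, \<zeta>2 u)) + (LINT p:{x<..b} \<times> UNIV|Q. jumps \<theta> p)"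
      unfolding cong z
      using flow[OF x b p1.path_states[OF x(1)] p2.path_states[OF x(1)]] fl[OF x(2) order_refl] by simp
  qed
  \<comment> \<open>Here \<open>x\<close> may be a jump time: on \<open>[a, x)\<close> both paths
    flow, which accounts for the change of \<open>\<theta>\<close> up to the left limits, and the
    slice at \<open>x\<close> accounts for the rest.\<close>
  have left: "R a x" if a: "0 \<le> a" "a < x" and c: "\<And>r. a \<le> r \<Longrightarrow> r < x \<Longrightarrow> p1.cnt r = p1.cnt a \<and> p2.cnt r = p2.cnt a" for a x
    unfolding R_def
  proof (intro impI)
    assume xT: "x \<le> T"
    have x: "0 < x" using a by simp
    let ?q = "\<lambda>u. q u (\<zeta>1 u, \<zeta>2 u)" and ?f = "\<lambda>u. q u (flow (u - a) (\<zeta>1 a), flow (u - a) (\<zeta>2 a))"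
    have z: "p1.zl x = flow (x - a) (\<zeta>1 a)" "p2.zl x = flow (x - a) (\<zeta>2 a)"
      using p1.zl_flow[OF a] p2.zl_flow[OF a] c by blast+
    have fl: "?q u = ?f u" if "u \<in> {a..<x}" for u
      using p1.flow_between[of a u] p2.flow_between[of a u] that a c[of u] by simp
    note F = flow[OF a(1) less_imp_le[OF a(2)] xT p1.path_states[OF a(1)] p2.path_states[OF a(1)]]
    have un: "{a..x} = {a..<x} \<union> {x}" using a by auto
    have f1: "set_integrable lebesgue {a..<x} ?f"
      by (rule set_integrable_subset[OF F[THEN conjunct1]]) auto
    have "set_integrable lebesgue {a..<x} ?q = set_integrable lebesgue {a..<x} ?f"
      by (rule set_integrable_cong[OF refl refl fl])
    with f1 have q1: "set_integrable lebesgue {a..<x} ?q" by blast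
    have q2: "set_integrable lebesgue {a..x} ?q"
      unfolding un by (intro set_integrable_Un q1 set_integral_singleton) auto
    have "(LINT u:{a..x}|lebesgue. ?q u) = (LINT u:{a..<x}|lebesgue. ?q u)"
      unfolding un by (subst set_integral_Un[OF _ q1 set_integral_singleton(1)]) (auto simp: set_integral_singleton)
    also have "\<dots> = (LINT u:{a..<x}|lebesgue. ?f u)"
      by (rule set_lebesgue_integral_cong) (simp, intro allI impI fl)
    also have "\<dots> = (LINT u:{a..x}|lebesgue. ?f u)"
      unfolding un by (subst set_integral_Un[OF _ f1 set_integral_singleton(1)]) (auto simp: set_integral_singleton)
    finally have q3: "(LINT u:{a..x}|lebesgue. ?q u) = \<theta> x (p1.zl x, p2.zl x) - \<theta> a (\<zeta>1 a, \<zeta>2 a)"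
      using F z by simp
    have s1: "set_integrable Q ({a<..<x} \<times> UNIV) (jumps \<theta>)"
      by (rule sub[OF p1.open_strip_Q[OF a(1)]]) (use a xT in auto)
    have s2: "set_integrable Q ({x} \<times> UNIV) (jumps \<theta>)"
      by (rule sub[OF p1.slice_Q[OF x]]) (use x xT in auto)
    have un2: "{a<..x} \<times> (UNIV::real set) = {a<..<x} \<times> UNIV \<union> {x} \<times> UNIV" using a by auto
    have "(LINT p:{a<..x} \<times> UNIV|Q. jumps \<theta> p) = (LINT p:{a<..<x} \<times> UNIV|Q. jumps \<theta> p) + (LINT p:{x} \<times> UNIV|Q. jumps \<theta> p)"
      unfolding un2 by (rule set_integral_Un[OF _ s1 s2]) auto
    also have "(LINT p:{a<..<x} \<times> UNIV|Q. jumps \<theta> p) = 0"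
      by (rule set_integral_AE_zero[OF nohit[OF p1.no_hit_open[OF a(1)] p2.no_hit_open[OF a(1)]]]) (use c in blast)+
    finally have j1: "(LINT p:{a<..x} \<times> UNIV|Q. jumps \<theta> p) = (LINT p:{x} \<times> UNIV|Q. jumps \<theta> p)" by simp
    have j2: "(LINT p:{x} \<times> UNIV|Q. jumps \<theta> p) = \<theta> x (\<zeta>1 x, \<zeta>2 x) - \<theta> x (p1.zl x, p2.zl x)"
    proof -
      \<comment> \<open>Both targets are combined into one countably valued mark, so that a single
        \<open>v\<close> represents the slice for the two paths at once.\<close>
      let ?m = "\<lambda>v. (p1.jmp (p1.zl x) v, p1.jmp (p2.zl x) v)"
      have m: "?m \<in> borel \<rightarrow>\<^sub>M count_space UNIV"
      proof -
        have "?m \<in> borel \<rightarrow>\<^sub>M count_space UNIV \<Otimes>\<^sub>M count_space UNIV"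
          by (intro measurable_Pair p1.jmp_section_measurable p1.zl_states p2.zl_states x)
        then show ?thesis by (simp add: pair_measure_countable)
      qed
      from x m show ?thesis
      proof (cases rule: p1.slice_dichotomy)
        case null
        have "(LINT p:{x} \<times> UNIV|Q. jumps \<theta> p) = 0"
          by (rule set_integral_AE_zero) (use null in \<open>auto elim!: eventually_mono\<close>)
        then show ?thesis using p1.jump_at_null[OF x null] p2.jump_at_null[OF x null] by simp
      next
        case (atom v)
        have "AE p in Q. p \<in> {x} \<times> UNIV \<longrightarrow> p1.jmp (p1.zl x) (snd p) = p1.jmp (p1.zl x) v"
          "AE p in Q. p \<in> {x} \<times> UNIV \<longrightarrow> p1.jmp (p2.zl x) (snd p) = p1.jmp (p2.zl x) v"
          using atom(2) by (auto elim!: eventually_mono)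
        then have z': "\<zeta>1 x = p1.move (p1.zl x) v" "\<zeta>2 x = p1.move (p2.zl x) v"
          using p1.jump_at_atom[OF x atom(1)] p2.jump_at_atom[OF x atom(1)] by blast+
        have "(LINT p:{x} \<times> UNIV|Q. jumps \<theta> p) = jumps \<theta> (x, v)"
        proof (rule p1.slice_integral[OF x atom(1)])
          show "AE p in Q. p \<in> {x} \<times> UNIV \<longrightarrow> jumps \<theta> p = jumps \<theta> (x, v)"
            using atom(2)
          proof eventually_elim
            case (elim p)
            show ?case using elim by (cases p) (auto simp: jumps_def p1.jump_diff_def p1.move_def)
          qed
          show "(\<lambda>p. indicator ({x} \<times> UNIV) p *\<^sub>R jumps \<theta> p) \<in> borel_measurable Q"
            using s2 unfolding set_integrable_def by (rule borel_measurable_integrable)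
        qed
        then show ?thesis unfolding z' by (simp add: jumps_def p1.jump_diff_def)
      qed
    qed
    show "set_integrable lebesgue {a..x} ?q \<and> \<theta> x (\<zeta>1 x, \<zeta>2 x) - \<theta> a (\<zeta>1 a, \<zeta>2 a) =
      (LINT u:{a..x}|lebesgue. ?q u) + (LINT p:{a<..x} \<times> UNIV|Q. jumps \<theta> p)"
      using q2 q3 j1 j2 by simp
  qed
  have "R 0 T" using T
  proof (induction rule: Bolzano)
    case (trans a b c)
    then show ?case using \<open>\<And>a b c. R a b \<Longrightarrow> R b c \<Longrightarrow> a \<le> b \<Longrightarrow> b \<le> c \<Longrightarrow> R a c\<close> by blast
  next
    case (local x)
    obtain d1 where d1: "0 < d1" "\<And>b. x \<le> b \<Longrightarrow> b < x + d1 \<Longrightarrow> p1.cnt x = p1.cnt b \<and> p2.cnt x = p2.cnt b"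
      using right_flow[of x] local by blast
    obtain d2 where d2: "0 < d2" "\<And>s r. 0 \<le> s \<Longrightarrow> x - d2 < s \<Longrightarrow> s \<le> r \<Longrightarrow> r < x \<Longrightarrow> p1.cnt r = p1.cnt s \<and> p2.cnt r = p2.cnt s"
      using left_flow[of x] local by blast
    show ?case
    proof (intro exI[of _ "min d1 d2"] conjI allI impI)
      fix a b assume ab: "a \<le> x \<and> x \<le> b \<and> b - a < min d1 d2"
      have rx: "R x b"
        by (rule right) (use d1(2)[of b] ab local in auto)
      show "R a b"
      proof (cases "0 \<le> a")
        case a: True
        show ?thesis
        proof (cases "a = x")
          case False
          have "R a x"
          proof (rule left)
            fix r assume "a \<le> r" "r < x"
            then show "p1.cnt r = p1.cnt a \<and> p2.cnt r = p2.cnt a"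
              using ab a by (intro d2(2)) auto
          qed (use a ab False in auto)
          from this rx show ?thesis by (rule \<open>\<And>a b c. R a b \<Longrightarrow> R b c \<Longrightarrow> a \<le> b \<Longrightarrow> b \<le> c \<Longrightarrow> R a c\<close>) (use ab in auto)
        qed (use rx in simp)
      qed (simp add: R_def)
    qed (use d1(1) d2(1) in simp)
  qed
  then show "set_integrable lebesgue {0..T} (\<lambda>u. q u (\<zeta>1 u, \<zeta>2 u))"
    "\<theta> T (\<zeta>1 T, \<zeta>2 T) - \<theta> 0 (\<zeta>1 0, \<zeta>2 0) =
      (LINT u:{0..T}|lebesgue. q u (\<zeta>1 u, \<zeta>2 u)) + (LINT p:{0<..T} \<times> UNIV|Q. jumps \<theta> p)"
    by (simp_all add: R_def)
qed

end

section \<open>Fubini for the intensity and measurability in the state\<close>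

lemma m2_nn_integral:
  assumes "g \<in> borel_measurable borel"
  shows "(\<integral>\<^sup>+p. g p * indicator ({0<..t} \<times> UNIV) p \<partial>m2) =
    (\<integral>\<^sup>+u. (\<integral>\<^sup>+v. g (u, v) \<partial>lborel) * indicator {0<..t} u \<partial>lborel)"
proof -
  have g: "g \<in> borel_measurable (lborel \<Otimes>\<^sub>M lborel)" using assms by (simp add: lborel_prod)
  have "(\<integral>\<^sup>+p. g p * indicator ({0<..t} \<times> UNIV) p \<partial>m2) =
    (\<integral>\<^sup>+p. g p * indicator ({0<..t} \<times> UNIV) p * indicator ({0..} \<times> UNIV) p \<partial>lborel)"
    unfolding m2_def by (rule nn_integral_restrict_space) (auto simp flip: borel_prod)
  also have "\<dots> = (\<integral>\<^sup>+p. g p * indicator ({0<..t} \<times> UNIV) p \<partial>(lborel \<Otimes>\<^sub>M lborel))"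
    unfolding lborel_prod by (rule nn_integral_cong) (auto simp: indicator_def)
  also have "\<dots> = (\<integral>\<^sup>+u. \<integral>\<^sup>+v. g (u, v) * indicator ({0<..t} \<times> UNIV) (u, v) \<partial>lborel \<partial>lborel)"
    by (intro lborel.nn_integral_fst[symmetric] borel_measurable_times_ennreal borel_measurable_indicator g) auto
  also have "\<dots> = (\<integral>\<^sup>+u. (\<integral>\<^sup>+v. g (u, v) \<partial>lborel) * indicator {0<..t} u \<partial>lborel)"
    by (rule nn_integral_cong) (auto simp: indicator_def)
  finally show ?thesis .
qed

text \<open>Fubini yields \<open>{0<..t}\<close> and \<open>lborel\<close>, whereas
  \<open>extended_generator\<close> integrates over \<open>{0..t}\<close> with the completed
  measure; completion and one null point bridge the difference.\<close>

lemma m2_set_integral: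
  fixes g :: "real \<times> real \<Rightarrow> real"
  assumes i: "set_integrable m2 ({0<..t} \<times> UNIV) g" and t: "0 \<le> t"
  shows "set_integrable lebesgue {0..t} (\<lambda>u. LINT v|lborel. g (u, v))"
    and "(LINT p:{0<..t} \<times> UNIV|m2. g p) = (LINT u:{0..t}|lebesgue. (LINT v|lborel. g (u, v)))"
proof -
  let ?S = "{0<..t} \<times> (UNIV::real set)"
  let ?h = "\<lambda>p. indicator ?S p *\<^sub>R g p"
  let ?k = "\<lambda>u. LINT v|lborel. g (u, v)"
  have om: "{0..} \<times> UNIV \<inter> space lborel \<in> sets (lborel :: (real \<times> real) measure)"
    by (auto simp flip: borel_prod)
  have eqh: "indicator ({0..} \<times> UNIV) p *\<^sub>R ?h p = ?h p" for p
    by (auto simp: indicator_def)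
  have 1: "integrable (lborel \<Otimes>\<^sub>M lborel) ?h"
    using i unfolding set_integrable_def m2_def lborel_prod integrable_restrict_space[OF om] eqh .
  have 2: "(LINT p:?S|m2. g p) = (LINT p|(lborel \<Otimes>\<^sub>M lborel). ?h p)"
    unfolding set_lebesgue_integral_def m2_def lborel_prod integral_restrict_space[OF om] eqh ..
  have sec: "(LINT v|lborel. ?h (u, v)) = indicator {0<..t} u *\<^sub>R ?k u" for u
    by (cases "u \<in> {0<..t}") auto
  have 3: "integrable lborel (\<lambda>u. indicator {0<..t} u *\<^sub>R ?k u)"
    using lborel_pair.integrable_fst'[OF 1] unfolding sec .
  have 4: "(LINT p|(lborel \<Otimes>\<^sub>M lborel). ?h p) = (LINT u|lborel. indicator {0<..t} u *\<^sub>R ?k u)"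
    using lborel_pair.integral_fst'[OF 1] unfolding sec by simp
  have b: "(\<lambda>u. indicator {0<..t} u *\<^sub>R ?k u) \<in> borel_measurable lborel"
    using 3 by (rule borel_measurable_integrable)
  have 5: "set_integrable lebesgue {0<..t} ?k"
    unfolding set_integrable_def using 3 integrable_completion[OF b] by simp
  have 6: "(LINT u|lborel. indicator {0<..t} u *\<^sub>R ?k u) = (LINT u:{0<..t}|lebesgue. ?k u)"
    unfolding set_lebesgue_integral_def using integral_completion[OF b] by simp
  have un: "{0..t} = {0} \<union> {0<..t}" using t by auto
  show "set_integrable lebesgue {0..t} ?k"
    unfolding un by (intro set_integrable_Un 5 set_integral_singleton) auto
  show "(LINT p:?S|m2. g p) = (LINT u:{0..t}|lebesgue. ?k u)"
    unfolding 2 4 6 un by (subst set_integral_Un[OF _ set_integral_singleton(1) 5]) (auto simp: set_integral_singleton)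
qed

lemma flow_measurable [measurable]:
  "(\<lambda>(r, z). flow r z) \<in> borel \<Otimes>\<^sub>M state_space \<rightarrow>\<^sub>M state_space"
  unfolding flow_def split_beta' by measurable

definition continuous_in_ages :: "(state \<times> state \<Rightarrow> real) \<Rightarrow> bool" where
  "continuous_in_ages \<theta> \<longleftrightarrow> (\<forall>i1\<in>XX. \<forall>i2\<in>XX. \<forall>n1 n2.
     continuous_on ({0..} \<times> {0..}) (\<lambda>(y1, y2). \<theta> ((i1, y1, n1), (i2, y2, n2))))"

text \<open>For frozen discrete coordinates the function is continuous in the two ages; the four
  discrete coordinates are then substituted one at a time by countable composition.\<close>

lemma continuous_in_ages_measurable:
  assumes "continuous_in_ages \<theta>"
  shows "(\<lambda>(z1, z2). \<theta> (clean z1, clean z2)) \<in> borel_measurable (state_space \<Otimes>\<^sub>M state_space)"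
proof -
  let ?S = "state_space \<Otimes>\<^sub>M state_space"
  define f where "f i1 n1 i2 n2 x = \<theta> ((max 1 i1, max 0 (fst (snd (fst x))), n1), (max 1 i2, max 0 (fst (snd (snd x))), n2))"
    for i1 n1 i2 n2 and x :: "state \<times> state"
  have 1: "f i1 n1 i2 n2 \<in> borel_measurable ?S" for i1 n1 i2 n2
  proof -
    have "max 1 i1 \<in> XX" "max 1 i2 \<in> XX" by (auto simp: XX_def)
    then have c: "continuous_on ({0..} \<times> {0..}) (\<lambda>(y1, y2). \<theta> ((max 1 i1, y1, n1), (max 1 i2, y2, n2)))"
      using assms unfolding continuous_in_ages_def by blast
    have "continuous_on UNIV (\<lambda>p::real \<times> real. (max 0 (fst p), max 0 (snd p)))"
      by (intro continuous_intros)
    from continuous_on_compose2[OF c this]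
    have "continuous_on UNIV (\<lambda>p::real \<times> real. \<theta> ((max 1 i1, max 0 (fst p), n1), (max 1 i2, max 0 (snd p), n2)))"
      by (simp add: image_subset_iff)
    then have b: "(\<lambda>p::real \<times> real. \<theta> ((max 1 i1, max 0 (fst p), n1), (max 1 i2, max 0 (snd p), n2))) \<in> borel_measurable borel"
      by (rule borel_measurable_continuous_onI)
    have "(\<lambda>x. (fst (snd (fst x)), fst (snd (snd x)))) \<in> ?S \<rightarrow>\<^sub>M (borel \<Otimes>\<^sub>M borel :: (real \<times> real) measure)"
      by measurable
    then have "(\<lambda>x. (fst (snd (fst x)), fst (snd (snd x)))) \<in> ?S \<rightarrow>\<^sub>M (borel :: (real \<times> real) measure)"
      by (simp add: borel_prod)
    from measurable_compose[OF this b] show ?thesis by (simp add: f_def[abs_def])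
  qed
  have 2: "(\<lambda>x. f (fst (fst x)) n1 i2 n2 x) \<in> borel_measurable ?S" for n1 i2 n2
    by (rule measurable_compose_countable[OF 1]) measurable
  have 3: "(\<lambda>x. f (fst (fst x)) (snd (snd (fst x))) i2 n2 x) \<in> borel_measurable ?S" for i2 n2
    by (rule measurable_compose_countable[OF 2]) measurable
  have 4: "(\<lambda>x. f (fst (fst x)) (snd (snd (fst x))) (fst (snd x)) n2 x) \<in> borel_measurable ?S" for n2
    by (rule measurable_compose_countable[OF 3]) measurable
  have 5: "(\<lambda>x. f (fst (fst x)) (snd (snd (fst x))) (fst (snd x)) (snd (snd (snd x))) x) \<in> borel_measurable ?S"
    by (rule measurable_compose_countable[OF 4]) measurable
  then show ?thesis by (simp add: f_def clean_def split_beta')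
qed

section \<open>The martingale problem\<close>

locale prm_jumps = prm_space M F P + jump_rates lam prec
  for M :: "'w measure" and F P lam prec
begin

definition regular :: "'w process \<Rightarrow> 'w \<Rightarrow> bool" where
  "regular Z w \<longleftrightarrow> w \<in> space M \<and> jump_path lam prec (P w) (\<lambda>t. Z t w)"

lemma regular_AE:
  assumes "strong_solution M F lam prec P Z0 Z"
  shows "AE w in M. regular Z w \<and> Z 0 w = Z0 w"
proof -
  have sol: "AE w in M. cadlag (\<lambda>t. Z t w) \<and> solves_equation lam prec P Z0 Z w"
    and st: "\<And>t w. 0 \<le> t \<Longrightarrow> w \<in> space M \<Longrightarrow> Z t w \<in> states"
    using assms unfolding strong_solution_def by auto
  show ?thesis using sol at_most_one_point AE_space
  proof eventually_elim
    case (elim w)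
    obtain x0 y0 n0 where z0: "Z0 w = (x0, y0, n0)" by (cases "Z0 w")
    have eq: "let D = {0<..t} \<times> UNIV;
           H = (\<lambda>(u, v). h_Lam lam prec (left_lim Z u w) v);
           G = (\<lambda>(u, v). g_Lam lam prec (left_lim Z u w) v);
           K = (\<lambda>(u, v). fst (snd (left_lim Z u w)) * g_Lam lam prec (left_lim Z u w) v)
       in set_integrable (P w) D H \<and> set_integrable (P w) D G \<and> set_integrable (P w) D K \<and>
          real (fst (Z t w)) = real x0 + (LINT p:D|P w. H p) \<and>
          fst (snd (Z t w)) = y0 + t - (LINT p:D|P w. K p) \<and>
          real (snd (snd (Z t w))) = real n0 + (LINT p:D|P w. G p)" if "0 \<le> t" for t
      using elim(1) that unfolding solves_equation_def z0 by (auto simp: split_beta)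
    \<comment> \<open>At time 0 the domain of integration is empty, so the equation itself yields
      the initial value.\<close>
    have Z0: "Z 0 w = Z0 w"
      using eq[of 0] unfolding z0 Let_def by (cases "Z 0 w") (simp add: set_lebesgue_integral_def)
    have "jump_path lam prec (P w) (\<lambda>t. Z t w)"
    proof
      show "sets (P w) = sets m2" using sets_P elim by blast
      show "emeasure (P w) B \<in> insert \<infinity> (range of_nat)" if "B \<in> sets m2" for B
        using P_integer elim(3) that by blast
      show "0 < u \<Longrightarrow> emeasure (P w) ({u} \<times> UNIV) \<le> 1" for u using elim(2) by blast
      show "0 \<le> t \<Longrightarrow> Z t w \<in> states" for t using st elim(3) by blast
      show "cadlag (\<lambda>t. Z t w)" using elim(1) by blast
      show "0 \<le> t \<Longrightarrow> let D = {0<..t} \<times> UNIV;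
           H = (\<lambda>(u, v). h_Lam lam prec (Lim (at_left u) (\<lambda>t. Z t w)) v);
           G = (\<lambda>(u, v). g_Lam lam prec (Lim (at_left u) (\<lambda>t. Z t w)) v);
           K = (\<lambda>(u, v). fst (snd (Lim (at_left u) (\<lambda>t. Z t w))) * g_Lam lam prec (Lim (at_left u) (\<lambda>t. Z t w)) v)
       in set_integrable (P w) D H \<and> set_integrable (P w) D G \<and> set_integrable (P w) D K \<and>
          real (fst (Z t w)) = real (fst (Z 0 w)) + (LINT p:D|P w. H p) \<and>
          fst (snd (Z t w)) = fst (snd (Z 0 w)) + t - (LINT p:D|P w. K p) \<and>
          real (snd (snd (Z t w))) = real (snd (snd (Z 0 w))) + (LINT p:D|P w. G p)" for t
        using eq[of t] unfolding Z0 z0 left_lim_def by simp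
    qed
    then show ?case using Z0 elim by (simp add: regular_def)
  qed
qed

text \<open>The default \<open>(1, 0, 0)\<close> is a state, so the values remain in
  \<open>states\<close> on the whole predictable space and no exceptional set has to be carried
  along.\<close>

definition pre :: "'w process \<Rightarrow> 'w \<times> real \<times> real \<Rightarrow> state" where
  "pre Z x = (if regular Z (fst x) then left_lim Z (fst (snd x)) (fst x) else (1, 0, 0))"

lemma pre_zl:
  assumes "regular Z w"
  shows "pre Z (w, u, v) = jump_path.zl (\<lambda>t. Z t w) u"
  using assms jump_path.zl_def[of lam prec "P w" "\<lambda>t. Z t w" u]
  by (simp add: pre_def regular_def left_lim_def)

lemma pre_states: "x \<in> space Pred \<Longrightarrow> pre Z x \<in> states"
proof -
  assume x: "x \<in> space Pred"
  obtain w u v where w: "x = (w, u, v)" by (cases x)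
  show ?thesis
  proof (cases "regular Z w")
    case True
    then interpret jump_path lam prec "P w" "\<lambda>t. Z t w" by (simp add: regular_def)
    show ?thesis using zl_states[of u] x pre_zl[OF True] w by (simp add: space_Pred)
  qed (simp add: pre_def w XX_def)
qed

lemma Pred_rect_UN:
  assumes "0 \<le> a" "B \<in> sets (F a)" "C \<in> sets borel"
  shows "B \<times> ({a<..} \<times> C) \<in> sets Pred"
proof -
  have "B \<times> ({a<..} \<times> C) = (\<Union>n::nat. B \<times> ({a<..real n} \<times> C))"
  proof (intro equalityI subsetI)
    fix x assume x: "x \<in> B \<times> ({a<..} \<times> C)"
    obtain n :: nat where "fst (snd x) \<le> real n" using real_arch_simple by blast
    with x show "x \<in> (\<Union>n::nat. B \<times> ({a<..real n} \<times> C))" by auto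
  qed auto
  then show ?thesis using rect_in_Pred[OF assms] by auto
qed

lemma time_measurable [measurable]: "(\<lambda>x. fst (snd x)) \<in> borel_measurable Pred"
proof (rule borel_measurableI_greater)
  fix a :: real
  have "{x \<in> space Pred. a < fst (snd x)} = space M \<times> ({max 0 a<..} \<times> UNIV)"
    by (auto simp: space_Pred)
  then show "{x \<in> space Pred. a < fst (snd x)} \<in> sets Pred"
    using Pred_rect_UN[of "max 0 a" "space M" UNIV] sets.top[of "F (max 0 a)"] space_F[of "max 0 a"] by simp
qed

lemma mark_measurable [measurable]: "(\<lambda>x. snd (snd x)) \<in> borel_measurable Pred"
proof (rule measurableI)
  fix C :: "real set" assume "C \<in> sets borel"
  moreover have "(\<lambda>x. snd (snd x)) -` C \<inter> space Pred = space M \<times> ({0<..} \<times> C)"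
    by (auto simp: space_Pred)
  ultimately show "(\<lambda>x. snd (snd x)) -` C \<inter> space Pred \<in> sets Pred"
    using Pred_rect_UN[of 0 "space M" C] sets.top[of "F 0"] space_F[of 0] by simp
qed simp

text \<open>\<open>Z\<close> at the last grid point before \<open>u\<close> is predictable and converges to the left limit.\<close>

lemma pre_measurable [measurable]:
  assumes sol: "strong_solution M F lam prec P Z0 Z"
  shows "pre Z \<in> Pred \<rightarrow>\<^sub>M state_space"
proof -
  \<comment> \<open>The largest multiple of \<open>1 / (n + 1)\<close> strictly below
    \<open>u\<close>. Ceiling minus one keeps it to the left of \<open>u\<close> even at grid
    points, as convergence to the left limit requires.\<close>
  define \<tau> where "\<tau> n u = (of_int \<lceil>u * real (Suc n)\<rceil> - 1) / real (Suc n)" for n and u :: real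
  define st where "st n x = Z (\<tau> n (fst (snd x))) (fst x)" for n and x :: "'w \<times> real \<times> real"
  \<comment> \<open>Irregular paths lie in a null set, so their complement is an event of
    \<open>F 0\<close>; redefining the process off it preserves predictability.\<close>
  define G where "G = {w\<in>space M. regular Z w}"
  have Zm: "Z t \<in> F t \<rightarrow>\<^sub>M state_space" if "0 \<le> t" for t
    using sol that unfolding strong_solution_def by blast
  have G: "G \<in> sets (F 0)"
  proof -
    have ae: "AE w in M. regular Z w" using regular_AE[OF sol] by eventually_elim simp
    obtain N where N: "N \<in> null_sets M" "{w\<in>space M. \<not> regular Z w} \<subseteq> N"
      using ae by (auto elim!: AE_E simp: null_sets_def)
    have "G = space (F 0) - {w\<in>space M. \<not> regular Z w}" using space_F[of 0] by (auto simp: G_def)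
    then show ?thesis using null_in_F(1)[OF N order_refl] by auto
  qed
  have GP: "{x\<in>space Pred. fst x \<in> G} \<in> sets Pred"
  proof -
    have "{x\<in>space Pred. fst x \<in> G} = G \<times> ({0<..} \<times> UNIV)" by (auto simp: space_Pred G_def)
    then show ?thesis using Pred_rect_UN[OF order_refl G, of UNIV] by simp
  qed
  have stm: "st n \<in> Pred \<rightarrow>\<^sub>M state_space" for n
  proof (rule measurableI)
    fix A assume A: "A \<in> sets state_space"
    let ?N = "real (Suc n)"
    have "st n -` A \<inter> space Pred = (\<Union>k::nat. (Z (real k / ?N) -` A \<inter> space M) \<times> ({real k / ?N<..real (Suc k) / ?N} \<times> UNIV))"
      (is "_ = ?R")
    proof (intro set_eqI iffI)
      fix x assume x: "x \<in> st n -` A \<inter> space Pred"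
      obtain w u v where w: "x = (w, u, v)" by (cases x)
      have u: "0 < u" "w \<in> space M" using x w by (auto simp: space_Pred)
      define k where "k = nat (\<lceil>u * ?N\<rceil> - 1)"
      have "0 < u * ?N" using u by simp
      then have k: "real k = of_int \<lceil>u * ?N\<rceil> - 1" unfolding k_def by (simp add: of_nat_nat)
      then have "real k < u * ?N" "u * ?N \<le> real (Suc k)" using ceiling_correct[of "u * ?N"] by auto
      then have "u \<in> {real k / ?N<..real (Suc k) / ?N}"
        by (simp only: greaterThanAtMost_iff pos_le_divide_eq pos_divide_less_eq of_nat_0_less_iff zero_less_Suc)
      moreover have "\<tau> n u = real k / ?N" by (simp add: \<tau>_def k)
      ultimately show "x \<in> ?R" using x u by (auto simp: w st_def intro!: exI[of _ k])
    next
      fix x assume "x \<in> ?R"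
      then obtain k where kx: "x \<in> (Z (real k / ?N) -` A \<inter> space M) \<times> ({real k / ?N<..real (Suc k) / ?N} \<times> UNIV)"
        by blast
      obtain w u v where w: "x = (w, u, v)" by (cases x)
      have k: "Z (real k / ?N) w \<in> A" "w \<in> space M" "real k / ?N < u" "u \<le> real (Suc k) / ?N"
        using kx unfolding w by (simp_all del: of_nat_Suc)
      have "real k < u * ?N" "u * ?N \<le> real (Suc k)"
        using k(3,4) by (simp_all only: pos_le_divide_eq pos_divide_less_eq of_nat_0_less_iff zero_less_Suc)
      then have "\<lceil>u * ?N\<rceil> = int k + 1" by (intro ceiling_unique) auto
      then have "\<tau> n u = real k / ?N" by (simp add: \<tau>_def)
      moreover have "0 < u" using k(3) by (rule le_less_trans[rotated]) simp
      ultimately show "x \<in> st n -` A \<inter> space Pred" using k by (simp add: w st_def space_Pred)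
    qed
    moreover have "(Z (real k / ?N) -` A \<inter> space M) \<times> ({real k / ?N<..real (Suc k) / ?N} \<times> UNIV) \<in> sets Pred" for k
      using measurable_sets[OF Zm A, of "real k / ?N"] space_F[of "real k / ?N"] by (intro rect_in_Pred) auto
    ultimately show "st n -` A \<inter> space Pred \<in> sets Pred" by auto
  qed (auto simp: space_pair_measure)
  define s where "s n x = (if fst x \<in> G then st n x else (1, 0, 0))" for n and x :: "'w \<times> real \<times> real"
  have sm: "s n \<in> Pred \<rightarrow>\<^sub>M state_space" for n
    unfolding s_def by (rule measurable_If[OF stm _ GP]) (auto simp: space_pair_measure)
  have lim: "(\<lambda>n. s n x) \<longlonglongrightarrow> pre Z x" if x: "x \<in> space Pred" for x
  proof -
    obtain w u v where w: "x = (w, u, v)" by (cases x)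
    have u: "0 < u" "w \<in> space M" using x w by (auto simp: space_Pred)
    show ?thesis
    proof (cases "regular Z w")
      case True
      then interpret jump_path lam prec "P w" "\<lambda>t. Z t w" by (simp add: regular_def)
      have bd: "u - 1 / real (Suc n) \<le> \<tau> n u" "\<tau> n u < u" for n
      proof -
        have c: "of_int \<lceil>u * real (Suc n)\<rceil> - 1 < u * real (Suc n)" "u * real (Suc n) \<le> of_int \<lceil>u * real (Suc n)\<rceil>"
          using ceiling_correct[of "u * real (Suc n)"] by auto
        show "\<tau> n u < u" unfolding \<tau>_def using c(1) by (subst pos_divide_less_eq) auto
        have "u - 1 / real (Suc n) = (u * real (Suc n) - 1) / real (Suc n)" by (simp add: diff_divide_distrib del: of_nat_Suc)
        also have "\<dots> \<le> \<tau> n u" unfolding \<tau>_def using c(2) by (intro divide_right_mono) auto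
        finally show "u - 1 / real (Suc n) \<le> \<tau> n u" .
      qed
      have "(\<lambda>n. \<tau> n u) \<longlonglongrightarrow> u"
      proof (rule tendsto_sandwich[of "\<lambda>n. u - 1 / real (Suc n)" _ _ "\<lambda>_. u"])
        have "(\<lambda>n. u - 1 / real (Suc n)) \<longlonglongrightarrow> u - 0"
          by (intro tendsto_diff tendsto_const LIMSEQ_Suc lim_const_over_n)
        then show "(\<lambda>n. u - 1 / real (Suc n)) \<longlonglongrightarrow> u" by simp
      qed (use bd less_imp_le in \<open>auto intro!: always_eventually\<close>)
      then have "filterlim (\<lambda>n. \<tau> n u) (at_left u) sequentially"
        using bd(2) less_imp_neq[OF bd(2)] unfolding filterlim_at by auto
      from filterlim_compose[OF tendsto_zl[OF u(1)] this]
      show ?thesis using True u by (simp add: s_def G_def st_def w pre_zl)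
    next
      case False
      then show ?thesis by (simp add: s_def G_def w pre_def)
    qed
  qed
  \<comment> \<open>In a discrete space convergence means being eventually constant; viewed in the
    reals, the discrete coordinates become limits to which the measurability of real limits
    applies.\<close>
  have real_lim: "(\<lambda>n. real (f n)) \<longlonglongrightarrow> real l" if "f \<longlonglongrightarrow> l" for f and l :: nat
  proof (rule tendsto_eventually)
    show "\<forall>\<^sub>F n in sequentially. real (f n) = real l"
      using topological_tendstoD[OF that discrete_topology_class.open_discrete[of "{l}"]] by simp
  qed
  have c1: "(\<lambda>x. real (fst (pre Z x))) \<in> borel_measurable Pred"
    by (rule borel_measurable_LIMSEQ_real[of _ "\<lambda>n x. real (fst (s n x))"])
       (rule real_lim[OF tendsto_fst[OF lim]], assumption, use sm in measurable)
  have c2: "(\<lambda>x. fst (snd (pre Z x))) \<in> borel_measurable Pred"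
    by (rule borel_measurable_LIMSEQ_real[of _ "\<lambda>n x. fst (snd (s n x))"])
       (rule tendsto_fst[OF tendsto_snd[OF lim]], assumption, use sm in measurable)
  have c3: "(\<lambda>x. real (snd (snd (pre Z x)))) \<in> borel_measurable Pred"
    by (rule borel_measurable_LIMSEQ_real[of _ "\<lambda>n x. real (snd (snd (s n x)))"])
       (rule real_lim[OF tendsto_snd[OF tendsto_snd[OF lim]]], assumption, use sm in measurable)
  have nat: "f \<in> Pred \<rightarrow>\<^sub>M count_space UNIV" if "(\<lambda>x. real (f x)) \<in> borel_measurable Pred" for f :: "_ \<Rightarrow> nat"
  proof -
    have "(\<lambda>x. nat \<lfloor>real (f x)\<rfloor>) \<in> Pred \<rightarrow>\<^sub>M count_space UNIV" using that by measurable
    then show ?thesis by simp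
  qed
  have "(\<lambda>x. (fst (pre Z x), fst (snd (pre Z x)), snd (snd (pre Z x)))) \<in> Pred \<rightarrow>\<^sub>M state_space"
    by (intro measurable_Pair nat c1 c2 c3)
  then show ?thesis by simp
qed

end

section \<open>Test functions along the deterministic flow\<close>

lemma test_bounded:
  assumes "\<phi> \<in> test_functions"
  obtains B where "bounded_on_states \<phi> B"
  using assms unfolding test_functions_def bounded_on_states_def by blast

text \<open>One partial derivative and a continuous second one give the total derivative. It is the
  total derivative that matters, since the flow moves both ages together along the diagonal.\<close>

lemma test_derivative:
  assumes "\<phi> \<in> test_functions" "i1 \<in> XX" "i2 \<in> XX" "0 \<le> y1" "0 \<le> y2"
  shows "((\<lambda>(y1, y2). \<phi> ((i1, y1, n1), (i2, y2, n2))) has_derivative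
    (\<lambda>(h1, h2). h1 * dy1 \<phi> ((i1, y1, n1), (i2, y2, n2)) + h2 * dy2 \<phi> ((i1, y1, n1), (i2, y2, n2))))
    (at (y1, y2) within {0..} \<times> {0..})"
proof -
  have d: "(\<lambda>y. \<phi> ((i1, y, n1), (i2, y2, n2))) differentiable (at y1 within {0..})"
       "(\<lambda>y. \<phi> ((i1, y1, n1), (i2, y, n2))) differentiable (at y2 within {0..})"
    if "0 \<le> y1" "0 \<le> y2" for y1 y2
    using assms(1-3) that unfolding test_functions_def by blast+
  have c: "continuous_on ({0..} \<times> {0..}) (\<lambda>(y1, y2). dy2 \<phi> ((i1, y1, n1), (i2, y2, n2)))"
    using assms(1-3) unfolding test_functions_def by blast
  let ?c = "\<lambda>y1 y2. dy2 \<phi> ((i1, y1, n1), (i2, y2, n2))"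
  have "((\<lambda>(y1, y2). \<phi> ((i1, y1, n1), (i2, y2, n2))) has_derivative
    (\<lambda>(h1, h2). (\<lambda>h. h * dy1 \<phi> ((i1, y1, n1), (i2, y2, n2))) h1 + blinfun_apply (?c y1 y2 *\<^sub>R id_blinfun) h2))
    (at (y1, y2) within {0..} \<times> {0..})"
  proof (rule has_derivative_partialsI[where fy="\<lambda>y1 y2. ?c y1 y2 *\<^sub>R id_blinfun"])
    show "((\<lambda>y1. \<phi> ((i1, y1, n1), (i2, y2, n2))) has_derivative (\<lambda>h. h * dy1 \<phi> ((i1, y1, n1), (i2, y2, n2)))) (at y1 within {0..})"
      using d(1)[OF assms(4,5)] unfolding vector_derivative_works has_vector_derivative_def by (simp add: dy1_def)
    show "((\<lambda>y2. \<phi> ((i1, x, n1), (i2, y2, n2))) has_derivative blinfun_apply (?c x y *\<^sub>R id_blinfun)) (at y within {0..})"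
      if "x \<in> {0..}" "y \<in> {0..}" for x y
    proof -
      have e: "blinfun_apply (?c x y *\<^sub>R id_blinfun) = (\<lambda>h. h *\<^sub>R ?c x y)"
        by (auto simp: blinfun.scaleR_left)
      show ?thesis
        using d(2)[of x y] that unfolding e vector_derivative_works has_vector_derivative_def by (simp add: dy2_def)
    qed
    have "continuous (at (y1, y2) within {0..} \<times> {0..}) (\<lambda>(y1, y2). ?c y1 y2)"
      using c assms(4,5) by (auto simp: continuous_on_eq_continuous_within)
    then show "continuous (at (y1, y2) within {0..} \<times> {0..}) (\<lambda>(x, y). ?c x y *\<^sub>R id_blinfun)"
      unfolding split_beta by (intro continuous_intros)
  qed (use assms in auto)
  then show ?thesis by (simp add: blinfun.scaleR_left mult.commute)
qed

lemma test_continuous: "\<phi> \<in> test_functions \<Longrightarrow> continuous_in_ages \<phi>"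
  unfolding continuous_in_ages_def continuous_on_eq_continuous_within
  by (auto intro!: has_derivative_continuous[OF test_derivative])

lemma test_flow_derivative:
  assumes \<phi>: "\<phi> \<in> test_functions" and z: "z1 \<in> states" "z2 \<in> states" and x: "x \<in> {u..u'}"
  shows "((\<lambda>x. \<phi> (flow (x - u) z1, flow (x - u) z2)) has_vector_derivative
    dy1 \<phi> (flow (x - u) z1, flow (x - u) z2) + dy2 \<phi> (flow (x - u) z1, flow (x - u) z2)) (at x within {u..u'})"
proof -
  obtain i1 y1 n1 i2 y2 n2 where z12: "z1 = (i1, y1, n1)" "z2 = (i2, y2, n2)"
    by (cases z1, cases z2)
  have i: "i1 \<in> XX" "i2 \<in> XX" "0 \<le> y1" "0 \<le> y2" using z z12 by auto
  let ?k = "\<lambda>x. (y1 + (x - u), y2 + (x - u))"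
  let ?f = "\<lambda>(y1, y2). \<phi> ((i1, y1, n1), (i2, y2, n2))"
  have k: "?k ` {u..u'} \<subseteq> {0..} \<times> {0..}" using i by auto
  have f: "(?f has_derivative (\<lambda>(h1, h2). h1 * dy1 \<phi> ((i1, y1 + (x - u), n1), (i2, y2 + (x - u), n2)) +
      h2 * dy2 \<phi> ((i1, y1 + (x - u), n1), (i2, y2 + (x - u), n2)))) (at (?k x) within ?k ` {u..u'})"
    by (rule has_derivative_subset[OF test_derivative[OF \<phi>] k]) (use i x in auto)
  have k': "(?k has_derivative (\<lambda>h. (h, h))) (at x within {u..u'})"
    by (auto intro!: derivative_eq_intros)
  show ?thesis
    unfolding has_vector_derivative_def z12
    by (rule has_derivative_eq_rhs[OF has_derivative_in_compose[OF k' f, simplified], THEN has_derivative_transform[rotated 2]])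
       (use x in \<open>auto simp: flow_def algebra_simps\<close>)
qed

text \<open>This is the flow hypothesis of \<open>path_formula\<close> for a fixed
  \<open>\<phi>\<close>. The density is continuous along a flow line and hence integrable on compact
  time intervals, however large the derivatives are globally.\<close>

lemma test_flow:
  assumes \<phi>: "\<phi> \<in> test_functions" and u: "u \<le> u'" and z: "z1 \<in> states" "z2 \<in> states"
  defines "q \<equiv> \<lambda>z. dy1 \<phi> z + dy2 \<phi> z"
  shows "set_integrable lebesgue {u..u'} (\<lambda>x. q (flow (x - u) z1, flow (x - u) z2)) \<and>
      \<phi> (flow (u' - u) z1, flow (u' - u) z2) - \<phi> (z1, z2) =
        (LINT x:{u..u'}|lebesgue. q (flow (x - u) z1, flow (x - u) z2))"
proof -
  obtain i1 y1 n1 i2 y2 n2 where z12: "z1 = (i1, y1, n1)" "z2 = (i2, y2, n2)"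
    by (cases z1, cases z2)
  have i: "i1 \<in> XX" "i2 \<in> XX" "0 \<le> y1" "0 \<le> y2" using z z12 by auto
  let ?k = "\<lambda>x. (y1 + (x - u), y2 + (x - u))"
  let ?q = "\<lambda>(y1, y2). q ((i1, y1, n1), (i2, y2, n2))"
  have "continuous_on ({0..} \<times> {0..}) (\<lambda>(y1, y2). dy1 \<phi> ((i1, y1, n1), (i2, y2, n2)))"
    "continuous_on ({0..} \<times> {0..}) (\<lambda>(y1, y2). dy2 \<phi> ((i1, y1, n1), (i2, y2, n2)))"
    using \<phi> i unfolding test_functions_def by blast+
  then have "continuous_on ({0..} \<times> {0..}) ?q"
    unfolding q_def split_beta by (rule continuous_on_add)
  then have "continuous_on {u..u'} (\<lambda>x. ?q (?k x))"
    by (rule continuous_on_compose2) (use i in \<open>auto intro!: continuous_intros\<close>)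
  then have c: "continuous_on {u..u'} (\<lambda>x. q (flow (x - u) z1, flow (x - u) z2))"
    by (simp add: z12 flow_def)
  have "((\<lambda>x. q (flow (x - u) z1, flow (x - u) z2)) has_integral
      (\<phi> (flow (u' - u) z1, flow (u' - u) z2) - \<phi> (flow (u - u) z1, flow (u - u) z2))) {u..u'}"
    unfolding q_def by (rule fundamental_theorem_of_calculus[OF u test_flow_derivative[OF \<phi> z]])
  then have 1: "integral {u..u'} (\<lambda>x. q (flow (x - u) z1, flow (x - u) z2)) =
      \<phi> (flow (u' - u) z1, flow (u' - u) z2) - \<phi> (z1, z2)"
    by (subst integral_unique) simp_all
  have 2: "set_integrable lebesgue {u..u'} (\<lambda>x. q (flow (x - u) z1, flow (x - u) z2))"
    by (rule absolutely_integrable_continuous_real[OF c])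
  show ?thesis using 2 set_lebesgue_integral_eq_integral(2)[OF 2] 1 by simp
qed

lemma bounded_on_states_flow:
  "bounded_on_states \<phi> B \<Longrightarrow> 0 \<le> r \<Longrightarrow> bounded_on_states (\<lambda>z. \<phi> (flow r (fst z), flow r (snd z))) B"
  unfolding bounded_on_states_def by (auto intro: flow_states)

section \<open>The predictable jump integrand of the coupled process\<close>

context prm_jumps
begin

text \<open>The exceptional set may depend on the time, because each requirement on a martingale
  involves at most two times.\<close>

lemma martingale_modification:
  assumes V: "martingale M F V" and ae: "\<And>t. 0 \<le> t \<Longrightarrow> AE w in M. V t w = V' t w"
  shows "martingale M F V'"
  unfolding martingale_def
proof (intro conjI allI impI)
  have m: "V t \<in> borel_measurable (F t)" "integrable M (V t)" if "0 \<le> t" for t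
    using V that unfolding martingale_def by blast+
  have mV: "V' t \<in> borel_measurable (F t)" if "0 \<le> t" for t
    by (rule F_measurable_AE[OF that m(1)[OF that] _ ae[OF that]]) simp
  fix t :: real assume t: "0 \<le> t"
  show "V' t \<in> borel_measurable (F t)" by (rule mV[OF t])
  show "integrable M (V' t)"
    by (rule integrable_cong_AE_imp[OF m(2)[OF t] F_measurable_M[OF t mV[OF t]]]) (use ae[OF t] in \<open>auto elim: eventually_mono\<close>)
next
  have m: "V t \<in> borel_measurable (F t)" "integrable M (V t)" if "0 \<le> t" for t
    using V that unfolding martingale_def by blast+
  have mV: "V' t \<in> borel_measurable (F t)" if "0 \<le> t" for t
    by (rule F_measurable_AE[OF that m(1)[OF that] _ ae[OF that]]) simp
  fix s t :: real assume s: "0 \<le> s" "s \<le> t"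
  then have t: "0 \<le> t" by simp
  interpret S: finite_measure_subalgebra M "F s"
    by unfold_locales (rule F_subalgebra[OF s(1)])
  have "AE w in M. real_cond_exp M (F s) (V t) w = real_cond_exp M (F s) (V' t) w"
    using F_measurable_M[OF t m(1)[OF t]] F_measurable_M[OF t mV[OF t]]
    by (intro S.real_cond_exp_cong ae[OF t])
  moreover have "AE w in M. real_cond_exp M (F s) (V t) w = V s w"
    using V s unfolding martingale_def by blast
  ultimately show "AE w in M. real_cond_exp M (F s) (V' t) w = V' s w"
    using ae[OF s(1)] by eventually_elim simp
qed

lemma good_ages:
  fixes Z1 Z2 :: "'w process"
  assumes r: "regular Z1 w" "regular Z2 w" and t: "0 \<le> t"
  shows "AE u in lborel. u \<in> {0<..t} \<longrightarrow> Z1 u w \<in> good_states \<and> Z2 u w \<in> good_states \<and>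
    (\<forall>v. pre Z1 (w, u, v) = Z1 u w \<and> pre Z2 (w, u, v) = Z2 u w)"
proof -
  interpret p1: jump_path lam prec "P w" "\<lambda>t. Z1 t w" using r by (simp add: regular_def)
  interpret p2: jump_path lam prec "P w" "\<lambda>t. Z2 t w" using r by (simp add: regular_def)
  have g: "z \<in> good_states" if "z \<in> states" "fst (snd z) \<notin> bad_ages" for z
    using that by (cases z) auto
  show ?thesis
    using p1.path_AE[OF bad_ages_null t] p2.path_AE[OF bad_ages_null t]
    by eventually_elim (auto intro!: g p1.path_states p2.path_states simp: pre_zl r)
qed

text \<open>\<open>\<rho>\<close> is the time for which the flow still runs after the jump: the
  value 0 gives the jumps of \<open>\<phi>\<close> itself, the remaining time up to \<open>t\<close>
  gives those of the interpolation in Duhamel's formula.\<close>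

definition jump_fun :: "(state \<times> state \<Rightarrow> real) \<Rightarrow> (real \<Rightarrow> real) \<Rightarrow> 'w process \<Rightarrow> 'w process \<Rightarrow> 'w \<times> real \<times> real \<Rightarrow> real" where
  "jump_fun \<phi> \<rho> Z1 Z2 x = (let r = \<rho> (fst (snd x)) in
     jump_diff (\<lambda>z. \<phi> (flow r (fst z), flow r (snd z))) (pre Z1 x) (pre Z2 x) (snd (snd x)))"

context
  fixes Z01 Z02 :: "'w \<Rightarrow> state" and Z1 Z2 :: "'w process"
    and \<phi> :: "state \<times> state \<Rightarrow> real" and \<rho> :: "real \<Rightarrow> real" and B :: real
  assumes sol: "strong_solution M F lam prec P Z01 Z1" "strong_solution M F lam prec P Z02 Z2"
    and B: "bounded_on_states \<phi> B" and cont: "continuous_in_ages \<phi>"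
    and \<rho>: "\<rho> \<in> borel_measurable borel" "\<And>u. 0 \<le> \<rho> u"
begin

private abbreviation "jf \<equiv> jump_fun \<phi> \<rho> Z1 Z2"

lemma jump_fun_measurable: "jf \<in> borel_measurable Pred"
proof -
  note [measurable] = pre_measurable[OF sol(1)] pre_measurable[OF sol(2)] \<rho>(1)
  have c: "(\<lambda>x. \<phi> (clean (g1 x), clean (g2 x))) \<in> borel_measurable Pred"
    if "g1 \<in> Pred \<rightarrow>\<^sub>M state_space" "g2 \<in> Pred \<rightarrow>\<^sub>M state_space" for g1 g2
    using measurable_compose[OF measurable_Pair[OF that] continuous_in_ages_measurable[OF cont]] by simp
  have fl: "(\<lambda>x. flow (\<rho> (fst (snd x))) (g x)) \<in> Pred \<rightarrow>\<^sub>M state_space"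
    if "g \<in> Pred \<rightarrow>\<^sub>M state_space" for g
  proof -
    have "(\<lambda>x. (\<rho> (fst (snd x)), g x)) \<in> Pred \<rightarrow>\<^sub>M borel \<Otimes>\<^sub>M state_space"
      using that by measurable
    from measurable_compose[OF this flow_measurable] show ?thesis by simp
  qed
  have mv: "(\<lambda>x. move (clean (pre Z x)) (snd (snd x))) \<in> Pred \<rightarrow>\<^sub>M state_space"
    if "pre Z \<in> Pred \<rightarrow>\<^sub>M state_space" for Z
  proof -
    have "(\<lambda>x. (pre Z x, snd (snd x))) \<in> Pred \<rightarrow>\<^sub>M state_space \<Otimes>\<^sub>M borel"
      using that by measurable
    from measurable_compose[OF this move_measurable] show ?thesis by simp
  qed
  let ?r = "\<lambda>x::'w \<times> real \<times> real. \<rho> (fst (snd x))"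
  have "(\<lambda>x. \<phi> (clean (flow (?r x) (move (clean (pre Z1 x)) (snd (snd x)))), clean (flow (?r x) (move (clean (pre Z2 x)) (snd (snd x)))))
    - \<phi> (clean (flow (?r x) (pre Z1 x)), clean (flow (?r x) (pre Z2 x)))) \<in> borel_measurable Pred"
    using pre_measurable[OF sol(1)] pre_measurable[OF sol(2)]
    by (intro borel_measurable_diff c fl mv)
  then show ?thesis
  proof (rule measurable_cong[THEN iffD1, rotated])
    fix x assume x: "x \<in> space Pred"
    note s = pre_states[OF x, of Z1] pre_states[OF x, of Z2]
    show "\<phi> (clean (flow (?r x) (move (clean (pre Z1 x)) (snd (snd x)))), clean (flow (?r x) (move (clean (pre Z2 x)) (snd (snd x)))))
    - \<phi> (clean (flow (?r x) (pre Z1 x)), clean (flow (?r x) (pre Z2 x))) = jf x"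
      using s flow_states[OF \<rho>(2)] move_states by (simp add: jump_fun_def jump_diff_def Let_def)
  qed
qed

lemma jump_fun_bound:
  assumes "z1 \<in> good_states" "z2 \<in> good_states" "\<And>v. pre Z1 (w, u, v) = z1" "\<And>v. pre Z2 (w, u, v) = z2"
  shows "(\<integral>\<^sup>+v. ennreal \<bar>jf (w, u, v)\<bar> \<partial>lborel) \<le> ennreal (4 * B * rate_bound)"
  using jump_diff_nn_integral[OF assms(1,2) bounded_on_states_flow[OF B \<rho>(2)[of u]]]
  by (simp add: jump_fun_def Let_def assms(3,4))

lemma B_nonneg: "0 \<le> B"
proof -
  have "(1, 0, 0) \<in> states" by (simp add: XX_def)
  from bounded_on_statesD[OF B this this] show ?thesis by linarith
qed

text \<open>At almost every time both ages are good and the left limits equal the values, so the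
  bound over the mark at good states only has to be integrated over time.\<close>

lemma jump_fun_section_bound:
  assumes t: "0 \<le> t" and r: "regular Z1 w" "regular Z2 w"
  shows "(\<integral>\<^sup>+p. ennreal \<bar>jf (w, p)\<bar> * indicator (strip t) p \<partial>m2) \<le> ennreal (4 * B * rate_bound * t)"
proof -
  have w: "w \<in> space M" using r by (simp add: regular_def)
    let ?h = "\<lambda>p. indicator (strip t) p *\<^sub>R jf (w, p)"
    have "?h \<in> borel_measurable m2" by (rule predictable_section_real[OF jump_fun_measurable t w])
    moreover have "g \<in> borel_measurable m2 \<Longrightarrow> (\<lambda>p. indicator ({0..} \<times> UNIV) p *\<^sub>R g p) \<in> borel_measurable lborel"
      for g :: "real \<times> real \<Rightarrow> real"
    proof -
      have "({0..} \<times> UNIV) \<inter> space lborel \<in> sets (lborel :: (real \<times> real) measure)"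
        by (simp add: borel_closed closed_Times)
      from borel_measurable_restrict_space_iff[OF this] show "g \<in> borel_measurable m2 \<Longrightarrow> (\<lambda>p. indicator ({0..} \<times> UNIV) p *\<^sub>R g p) \<in> borel_measurable lborel"
        unfolding m2_def by blast
    qed
    ultimately have "(\<lambda>p. indicator ({0..} \<times> UNIV) p *\<^sub>R ?h p) \<in> borel_measurable lborel" by blast
    moreover have "indicator ({0..} \<times> UNIV) p *\<^sub>R ?h p = ?h p" for p by (auto simp: indicator_def)
    ultimately have h: "?h \<in> borel_measurable borel"
      by (simp only: measurable_lborel2)
    have "(\<integral>\<^sup>+p. ennreal \<bar>jf (w, p)\<bar> * indicator (strip t) p \<partial>m2) = (\<integral>\<^sup>+p. ennreal \<bar>?h p\<bar> * indicator (strip t) p \<partial>m2)"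
      by (rule nn_integral_cong) (auto simp: indicator_def)
    also have "\<dots> = (\<integral>\<^sup>+u. (\<integral>\<^sup>+v. ennreal \<bar>?h (u, v)\<bar> \<partial>lborel) * indicator {0<..t} u \<partial>lborel)"
      by (rule m2_nn_integral, rule measurable_compose[OF h]) measurable
    also have "\<dots> \<le> (\<integral>\<^sup>+u. ennreal (4 * B * rate_bound) * indicator {0<..t} u \<partial>lborel)"
    proof (rule nn_integral_mono_AE)
      have "AE u in lborel. u \<in> {0<..t} \<longrightarrow> Z1 u w \<in> good_states \<and> Z2 u w \<in> good_states \<and>
        (\<forall>v. pre Z1 (w, u, v) = Z1 u w \<and> pre Z2 (w, u, v) = Z2 u w)"
        by (rule good_ages[OF r t])
      then show "AE u in lborel. (\<integral>\<^sup>+v. ennreal \<bar>?h (u, v)\<bar> \<partial>lborel) * indicator {0<..t} u \<le> ennreal (4 * B * rate_bound) * indicator {0<..t} u"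
      proof eventually_elim
        case (elim u)
        show ?case
        proof (cases "u \<in> {0<..t}")
          case True
          then show ?thesis using elim jump_fun_bound[of "Z1 u w" "Z2 u w" w u] by simp
        qed simp
      qed
    qed
    also have "\<dots> = ennreal (4 * B * rate_bound * t)"
      using t B_nonneg rate_bound_nonneg by (simp add: nn_integral_cmult_indicator ennreal_mult'')
    finally show ?thesis .
qed

lemma jump_fun_finite:
  assumes t: "0 \<le> t"
  shows "finite_intensity jf t"
proof -
  have "AE w in M. (\<integral>\<^sup>+p. ennreal \<bar>jf (w, p)\<bar> * indicator (strip t) p \<partial>m2) \<le> ennreal (4 * B * rate_bound * t)"
    using regular_AE[OF sol(1)] regular_AE[OF sol(2)]
    by eventually_elim (blast intro: jump_fun_section_bound[OF t])
  then have "(\<integral>\<^sup>+w. \<integral>\<^sup>+p. ennreal \<bar>jf (w, p)\<bar> * indicator (strip t) p \<partial>m2 \<partial>M) \<le> (\<integral>\<^sup>+w. ennreal (4 * B * rate_bound * t) \<partial>M)"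
    by (rule nn_integral_mono_AE)
  also have "\<dots> < \<infinity>" by (simp add: emeasure_space_1)
  finally show ?thesis by (simp add: finite_intensity_def)
qed

lemma jump_fun_jumps:
  assumes "regular Z1 w" "regular Z2 w"
  shows "two_paths.jumps lam prec (\<lambda>t. Z1 t w) (\<lambda>t. Z2 t w) (\<lambda>u z. \<phi> (flow (\<rho> u) (fst z), flow (\<rho> u) (snd z))) p = jf (w, p)"
proof -
  interpret p1: jump_path lam prec "P w" "\<lambda>t. Z1 t w" using assms by (simp add: regular_def)
  interpret p2: jump_path lam prec "P w" "\<lambda>t. Z2 t w" using assms by (simp add: regular_def)
  interpret two_paths lam prec "P w" "\<lambda>t. Z1 t w" "\<lambda>t. Z2 t w" ..
  show ?thesis
    by (cases p) (simp add: jumps_def jump_fun_def Let_def pre_zl assms)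
qed

end

end

section \<open>The extended generator of the coupled process\<close>

lemma set_integral_spike:
  fixes f g :: "real \<Rightarrow> real"
  assumes f: "set_integrable lebesgue S f" and ae: "AE u in lborel. u \<in> S \<longrightarrow> g u = f u"
  shows "set_integrable lebesgue S g" "(LINT u:S|lebesgue. g u) = (LINT u:S|lebesgue. f u)"
proof -
  obtain N where N: "N \<in> null_sets lborel" "{u. \<not> (u \<in> S \<longrightarrow> g u = f u)} \<subseteq> N"
    using ae by (auto elim!: AE_E simp: null_sets_def)
  have n: "negligible N"
    using null_sets_completionI[OF N(1)] by (simp add: negligible_iff_null_sets)
  have eq: "g u = f u" if "u \<in> S - N" for u using that N by auto
  show i: "set_integrable lebesgue S g"
    by (rule absolutely_integrable_spike[OF f n eq])
  show "(LINT u:S|lebesgue. g u) = (LINT u:S|lebesgue. f u)"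
    unfolding set_lebesgue_integral_eq_integral(2)[OF i] set_lebesgue_integral_eq_integral(2)[OF f]
    by (rule integral_spike[OF n]) (use eq in simp)
qed

context prm_jumps
begin

text \<open>\<open>A\<close> is prescribed at good states only, and a path spends almost all of its
  time there. This freedom lets the integral form and the sum form be treated by one
  argument.\<close>

lemma coupled_extended_generator:
  assumes sol: "strong_solution M F lam prec P Z01 Z1" "strong_solution M F lam prec P Z02 Z2"
    and A: "\<And>\<phi> z1 z2. \<phi> \<in> test_functions \<Longrightarrow> z1 \<in> good_states \<Longrightarrow> z2 \<in> good_states \<Longrightarrow>
      A \<phi> (z1, z2) = dy1 \<phi> (z1, z2) + dy2 \<phi> (z1, z2) + (LINT v|lborel. jump_diff \<phi> z1 z2 v)"
  shows "extended_generator M F (\<lambda>t w. (Z1 t w, Z2 t w)) test_functions A"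
  unfolding extended_generator_def
proof (intro ballI)
  fix \<phi> :: "state \<times> state \<Rightarrow> real" assume \<phi>: "\<phi> \<in> test_functions"
  obtain B where B: "bounded_on_states \<phi> B" using test_bounded[OF \<phi>] .
  note c = test_continuous[OF \<phi>]
  define f where "f = jump_fun \<phi> (\<lambda>_. 0) Z1 Z2"
  have \<rho>: "(\<lambda>_::real. 0::real) \<in> borel_measurable borel" "\<And>u::real. 0 \<le> (0::real)" by auto
  note fm = jump_fun_measurable[OF sol B c \<rho>, folded f_def]
    and ff = jump_fun_finite[OF sol B c \<rho>, folded f_def]
  have key: "AE w in M. set_integrable lebesgue {0..t} (\<lambda>u. A \<phi> (Z1 u w, Z2 u w)) \<and>
     jump_integral f t w - compensator f t w =
     \<phi> (Z1 t w, Z2 t w) - \<phi> (Z1 0 w, Z2 0 w) - (LINT u:{0..t}|lebesgue. A \<phi> (Z1 u w, Z2 u w))"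
    if t: "0 \<le> t" for t
    using regular_AE[OF sol(1)] regular_AE[OF sol(2)] compensator_set_integrable[OF fm t ff[OF t]] AE_space
  proof eventually_elim
    case (elim w)
    have r: "regular Z1 w" "regular Z2 w" using elim by auto
    interpret p1: jump_path lam prec "P w" "\<lambda>t. Z1 t w" using r by (simp add: regular_def)
    interpret p2: jump_path lam prec "P w" "\<lambda>t. Z2 t w" using r by (simp add: regular_def)
    interpret two_paths lam prec "P w" "\<lambda>t. Z1 t w" "\<lambda>t. Z2 t w" ..
    have j: "jumps (\<lambda>_. \<phi>) p = f (w, p)" for p
      using jump_fun_jumps[OF sol B c \<rho> r, of p] by (simp add: f_def)
    have meas: "(\<lambda>p. indicator (strip t) p *\<^sub>R jumps (\<lambda>_. \<phi>) p) \<in> borel_measurable (P w)"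
      unfolding j using predictable_section_real[OF fm t elim(4)]
      by (subst measurable_cong_sets[OF sets_P[OF elim(4)] refl])
    let ?q = "\<lambda>u z. dy1 \<phi> z + dy2 \<phi> z"
    note PF = path_formula[of t "\<lambda>_. \<phi>" B ?q, OF t B test_flow[OF \<phi>] meas]
    note C = m2_set_integral[OF elim(3) t]
    let ?h = "\<lambda>u. ?q u (Z1 u w, Z2 u w) + (LINT v|lborel. f (w, u, v))"
    have i: "set_integrable lebesgue {0..t} ?h"
      using set_integral_add(1)[OF PF(2) C(1)] by simp
    have ae: "AE u in lborel. u \<in> {0..t} \<longrightarrow> A \<phi> (Z1 u w, Z2 u w) = ?h u"
      using good_ages[OF r t] AE_lborel_singleton[of 0]
    proof eventually_elim
      case (elim u)
      show ?case
      proof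
        assume "u \<in> {0..t}"
        with elim have "u \<in> {0<..t}" by auto
        with elim(1) have g: "Z1 u w \<in> good_states" "Z2 u w \<in> good_states"
          "\<And>v. pre Z1 (w, u, v) = Z1 u w" "\<And>v. pre Z2 (w, u, v) = Z2 u w" by auto
        have "f (w, u, v) = jump_diff \<phi> (Z1 u w) (Z2 u w) v" for v
          by (simp add: f_def jump_fun_def g)
        then show "A \<phi> (Z1 u w, Z2 u w) = ?h u" by (simp add: A[OF \<phi> g(1,2)])
      qed
    qed
    note sp = set_integral_spike[OF i ae]
    have "(LINT u:{0..t}|lebesgue. A \<phi> (Z1 u w, Z2 u w)) =
       (LINT u:{0..t}|lebesgue. ?q u (Z1 u w, Z2 u w)) + compensator f t w"
      unfolding sp(2) compensator_def C(2) by (rule set_integral_add(2)[OF PF(2) C(1)])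
    then show ?case
      using sp(1) PF(3) by (simp add: jump_integral_def j)
  qed
  show "(AE w in M. \<forall>t\<ge>0. set_integrable lebesgue {0..t} (\<lambda>u. A \<phi> (Z1 u w, Z2 u w))) \<and>
    martingale M F (\<lambda>t w. \<phi> (Z1 t w, Z2 t w) - \<phi> (Z1 0 w, Z2 0 w) - (LINT u:{0..t}|lebesgue. A \<phi> (Z1 u w, Z2 u w)))"
  proof
    \<comment> \<open>One exceptional set for all times is required; integer horizons give countably
      many, and smaller horizons follow by restriction.\<close>
    have "AE w in M. \<forall>n::nat. set_integrable lebesgue {0..real n} (\<lambda>u. A \<phi> (Z1 u w, Z2 u w))"
      unfolding AE_all_countable
    proof
      fix n :: nat
      show "AE w in M. set_integrable lebesgue {0..real n} (\<lambda>u. A \<phi> (Z1 u w, Z2 u w))"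
        by (rule eventually_mono[OF key[of "real n"]]) auto
    qed
    then show "AE w in M. \<forall>t\<ge>0. set_integrable lebesgue {0..t} (\<lambda>u. A \<phi> (Z1 u w, Z2 u w))"
    proof eventually_elim
      case (elim w)
      show ?case
      proof (intro allI impI)
        fix t :: real assume "0 \<le> t"
        obtain n :: nat where n: "t \<le> real n" using real_arch_simple by blast
        show "set_integrable lebesgue {0..t} (\<lambda>u. A \<phi> (Z1 u w, Z2 u w))"
          by (rule set_integrable_subset[OF elim[rule_format, of n]]) (use n in auto)
      qed
    qed
    show "martingale M F (\<lambda>t w. \<phi> (Z1 t w, Z2 t w) - \<phi> (Z1 0 w, Z2 0 w) - (LINT u:{0..t}|lebesgue. A \<phi> (Z1 u w, Z2 u w)))"
      by (rule martingale_modification[OF compensated_martingale[OF fm ff]])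
         (assumption, erule eventually_mono[OF key], blast)
  qed
qed

end

section \<open>Density points and the generator\<close>

text \<open>Only times to the right are counted, because ages increase along the flow.\<close>

definition mismatch :: "real set \<Rightarrow> real \<Rightarrow> real \<Rightarrow> real set" where
  "mismatch A y t = {u\<in>{0<..t}. (y + u \<in> A) \<noteq> (y \<in> A)}"

lemma measure_shift:
  assumes "S \<in> sets borel"
  shows "measure lborel {u. y + u \<in> S} = measure lborel (S :: real set)"
proof -
  have "measure lborel S = measure (distr lborel borel ((+) y)) S"
    by (simp add: lborel_distr_plus)
  also have "\<dots> = measure lborel ((+) y -` S \<inter> space lborel)"
    using assms by (intro measure_distr) auto
  finally show ?thesis by (simp add: vimage_def)
qed

text \<open>Lebesgue differentiation of the indicator of \<open>A\<close> over intervals to the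
  right; the negligible exceptional set is enlarged to a Borel null set.\<close>

lemma density_points:
  assumes A: "A \<in> sets (borel :: real measure)"
  obtains N where "N \<in> null_sets lborel"
    "\<And>y. y \<notin> N \<Longrightarrow> ((\<lambda>t. measure lborel (mismatch A y t) / t) \<longlongrightarrow> 0) (at_right 0)"
proof -
  let ?f = "indicator A :: real \<Rightarrow> real"
  have si: "set_integrable lborel {a..b} ?f" for a b
  proof -
    have "emeasure lborel (A \<inter> {a..b}) \<le> emeasure lborel {a..b}"
      by (rule emeasure_mono) auto
    also have "\<dots> < \<infinity>" by (simp add: emeasure_lborel_Icc_eq)
    finally have "integrable lborel (indicator (A \<inter> {a..b}) :: real \<Rightarrow> real)"
      using A by (intro integrable_real_indicator) auto
    then show ?thesis
      unfolding set_integrable_def by (simp add: indicator_inter_arith[abs_def] mult.commute)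
  qed
  have int: "?f integrable_on cbox a b" for a b
    using set_borel_integral_eq_integral(1)[OF si] by simp
  obtain N0 where N0: "negligible N0"
    "\<And>x e. x \<notin> N0 \<Longrightarrow> 0 < e \<Longrightarrow> \<exists>d>0. \<forall>h. 0 < h \<and> h < d \<longrightarrow>
       norm (integral (cbox x (x + h *\<^sub>R One)) ?f /\<^sub>R h ^ DIM(real) - ?f x) < e"
    using integrable_ccontinuous_explicit[of ?f] int by blast
  obtain N where N: "N \<in> null_sets lborel" "N0 \<subseteq> N"
    using N0(1) by (auto simp: negligible_iff_null_sets null_sets_completion_iff2)
  have m: "measure lborel {u\<in>{0<..t}. y + u \<in> A} = integral {y..y + t} ?f" if t: "0 < t" for y t
  proof -
    have "{u\<in>{0<..t}. y + u \<in> A} = {u. y + u \<in> A \<inter> {y<..y + t}}" by auto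
    then have "measure lborel {u\<in>{0<..t}. y + u \<in> A} = measure lborel (A \<inter> {y<..y + t})"
      using A by (simp only:) (rule measure_shift, auto)
    also have "\<dots> = measure lborel (A \<inter> {y..y + t})"
    proof (rule measure_eq_AE)
      show "AE x in lborel. (x \<in> A \<inter> {y<..y + t}) = (x \<in> A \<inter> {y..y + t})"
        using AE_lborel_singleton[of y] by eventually_elim auto
    qed (use A in auto)
    also have "\<dots> = (LINT x:{y..y + t}|lborel. ?f x)"
      unfolding set_lebesgue_integral_def
      using A by (simp flip: indicator_inter_arith add: Int_commute)
    also have "\<dots> = integral {y..y + t} ?f"
      by (rule set_borel_integral_eq_integral(2)[OF si])
    finally show ?thesis .
  qed
  have avg: "((\<lambda>t. integral {y..y + t} ?f / t) \<longlongrightarrow> ?f y) (at_right 0)" if y: "y \<notin> N" for y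
  proof (rule tendstoI)
    fix e :: real assume "0 < e"
    from N0(2)[OF _ this, of y] y N(2) obtain d where d: "d > 0"
      "\<And>h. 0 < h \<Longrightarrow> h < d \<Longrightarrow> norm (integral (cbox y (y + h *\<^sub>R One)) ?f /\<^sub>R h ^ DIM(real) - ?f y) < e"
      by blast
    show "\<forall>\<^sub>F t in at_right 0. dist (integral {y..y + t} ?f / t) (?f y) < e"
      unfolding eventually_at_right_field
      by (rule exI[of _ d]) (use d in \<open>auto simp: dist_norm divide_inverse mult.commute\<close>)
  qed
  show ?thesis
  proof (rule that[OF N(1)])
    fix y assume y: "y \<notin> N"
    show "((\<lambda>t. measure lborel (mismatch A y t) / t) \<longlongrightarrow> 0) (at_right 0)"
    proof (cases "y \<in> A")
      case False
      have "\<forall>\<^sub>F t in at_right 0. integral {y..y + t} ?f / t = measure lborel (mismatch A y t) / t"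
        unfolding eventually_at_right_field
        by (rule exI[of _ 1]) (use m False in \<open>auto simp: mismatch_def\<close>)
      with avg[OF y] show ?thesis using False by (auto intro: Lim_transform_eventually)
    next
      case True
      have "\<forall>\<^sub>F t in at_right 0. 1 - integral {y..y + t} ?f / t = measure lborel (mismatch A y t) / t"
      proof -
        have "1 - integral {y..y + t} ?f / t = measure lborel (mismatch A y t) / t" if t: "0 < t" for t
        proof -
          let ?S = "{u\<in>{0<..t}. y + u \<in> A}"
          have S: "?S \<in> sets borel"
          proof -
            have "{u. y + u \<in> A} \<in> sets borel"
              using measurable_sets[of "\<lambda>u. y + u" borel borel A] A by (simp add: vimage_def)
            moreover have "?S = {u. y + u \<in> A} \<inter> {0<..t}" by auto
            ultimately show ?thesis by simp
          qed
          have "mismatch A y t = {0<..t} - ?S" using True by (auto simp: mismatch_def)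
          moreover have "measure lborel ({0<..t} - ?S) = measure lborel {0<..t} - measure lborel ?S"
          proof (rule measure_Diff)
            show "emeasure lborel {0<..t} \<noteq> \<infinity>" using t by simp
            show "{u \<in> {0<..t}. y + u \<in> A} \<in> sets lborel" using S by simp
          qed auto
          ultimately have "measure lborel (mismatch A y t) = measure lborel {0<..t} - measure lborel ?S"
            by simp
          then show ?thesis using t m[OF t, of y] by (simp add: diff_divide_distrib)
        qed
        then show ?thesis unfolding eventually_at_right_field by (intro exI[of _ 1]) auto
      qed
      moreover have "((\<lambda>t. 1 - integral {y..y + t} ?f / t) \<longlongrightarrow> 1 - 1) (at_right 0)"
        using avg[OF y] True by (intro tendsto_diff tendsto_const) simp
      ultimately show ?thesis by (auto intro: Lim_transform_eventually)
    qed
  qed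
qed

section \<open>Approximate continuity of the rates and of the jump targets\<close>

context jump_rates
begin

text \<open>Only the superlevel sets at rational levels are used, so that a countable union of null sets
  is excluded; right approximate continuity of the rates at the remaining ages suffices.\<close>

definition regular_ages :: "real set \<Rightarrow> bool" where
  "regular_ages E \<longleftrightarrow> bad_ages \<subseteq> E \<and> (\<forall>(i, j)\<in>XX2. \<forall>n. \<forall>q\<in>\<rat>. \<forall>y. y \<notin> E \<longrightarrow>
     ((\<lambda>t. measure lborel (mismatch {y. q < lam i j (max 0 y) n} y t) / t) \<longlongrightarrow> 0) (at_right 0))"

lemma regular_ages_exist: "\<exists>E\<in>null_sets lborel. regular_ages E"
proof -
  have meas: "{y. q < lam i j (max 0 y) n} \<in> sets borel" if "(i, j) \<in> XX2" for i j n q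
  proof -
    have "{y \<in> space borel. q < lam i j (max 0 y) n} \<in> sets borel"
      using lam_measurable[OF that] by measurable
    then show ?thesis by simp
  qed
  \<comment> \<open>The index type of pair, counter and rational is countable; pairs outside
    \<open>XX2\<close> receive the empty set, so that a null set can be chosen for every
    index.\<close>
  define R where "R k N \<longleftrightarrow> N \<in> null_sets lborel \<and> (fst k \<in> XX2 \<longrightarrow> (\<forall>y. y \<notin> N \<longrightarrow>
     ((\<lambda>t. measure lborel (mismatch {y. of_rat (snd (snd k)) < lam (fst (fst k)) (snd (fst k)) (max 0 y) (fst (snd k))} y t) / t)
       \<longlongrightarrow> 0) (at_right 0)))"
    for k :: "(nat \<times> nat) \<times> nat \<times> rat" and N
  have "\<exists>N. R k N" for k
  proof (cases "fst k \<in> XX2")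
    case True
    then have "(fst (fst k), snd (fst k)) \<in> XX2" by simp
    from density_points[OF meas[OF this]] show ?thesis unfolding R_def by blast
  next
    case False
    then show ?thesis unfolding R_def by (intro exI[of _ "{}"]) auto
  qed
  then have R: "R k (SOME N. R k N)" for k by (rule someI_ex)
  define N where "N k = (SOME N. R k N)" for k
  have N: "N k \<in> null_sets lborel"
    "fst k \<in> XX2 \<Longrightarrow> y \<notin> N k \<Longrightarrow>
     ((\<lambda>t. measure lborel (mismatch {y. of_rat (snd (snd k)) < lam (fst (fst k)) (snd (fst k)) (max 0 y) (fst (snd k))} y t) / t)
       \<longlongrightarrow> 0) (at_right 0)" for k y
    using R[of k] unfolding N_def R_def by blast+
  let ?E = "bad_ages \<union> (\<Union>k. N k)"
  have "?E \<in> null_sets lborel"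
    by (intro null_sets.Un bad_ages_null null_sets_UN N)
  moreover have "regular_ages ?E"
    unfolding regular_ages_def
  proof (intro conjI)
    show "bad_ages \<subseteq> ?E" by blast
    show "\<forall>(i, j)\<in>XX2. \<forall>n. \<forall>q\<in>\<rat>. \<forall>y. y \<notin> ?E \<longrightarrow>
     ((\<lambda>t. measure lborel (mismatch {y. q < lam i j (max 0 y) n} y t) / t) \<longlongrightarrow> 0) (at_right 0)"
    proof (intro ballI allI impI, unfold split_beta, intro ballI allI impI)
      fix p n y and q :: real assume "p \<in> XX2" "q \<in> \<rat>" "y \<notin> ?E"
      moreover from \<open>q \<in> \<rat>\<close> obtain r where "q = of_rat r" by (rule Rats_cases)
      ultimately show "((\<lambda>t. measure lborel (mismatch {y. q < lam (fst p) (snd p) (max 0 y) n} y t) / t) \<longlongrightarrow> 0) (at_right 0)"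
        using N(2)[of "(p, n, r)" y] by (metis UNIV_I UN_I UnI2 fst_conv snd_conv)
    qed
  qed
  ultimately show ?thesis by blast
qed

lemma rate_mismatch_fmeasurable:
  assumes ij: "(i, j) \<in> XX2" and y: "0 \<le> y"
  shows "{u\<in>{0<..t}. (a < lam i j (y + u) n) \<noteq> (a < lam i j y n)} \<in> fmeasurable lborel"
proof (rule fmeasurableI2[of "{0<..t}"])
  have "{y \<in> space borel. a < lam i j (max 0 y) n} \<in> sets borel"
    using lam_measurable[OF ij] by measurable
  then have "{u. a < lam i j (max 0 (y + u)) n} \<in> sets borel"
    using measurable_sets[of "\<lambda>u. y + u" borel borel "{y. a < lam i j (max 0 y) n}"] by (simp add: vimage_def)
  moreover have "{u\<in>{0<..t}. (a < lam i j (y + u) n) \<noteq> (a < lam i j y n)} =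
    (if a < lam i j y n then {0<..t} - {u. a < lam i j (max 0 (y + u)) n} else {0<..t} \<inter> {u. a < lam i j (max 0 (y + u)) n})"
    using y by (auto simp: max_def)
  ultimately show "{u\<in>{0<..t}. (a < lam i j (y + u) n) \<noteq> (a < lam i j y n)} \<in> sets lborel" by auto
  show "{0<..t} \<in> fmeasurable lborel" by (cases "0 \<le> t") (auto simp: fmeasurable_def)
qed auto

text \<open>A rational \<open>q\<close> lies between \<open>a\<close> and the current rate. Whenever
  the rate changes sides of \<open>a\<close> it also changes sides of \<open>q\<close>, so density
  at rational levels covers every level except the current rate itself.\<close>

lemma rate_mismatch:
  assumes E: "regular_ages E" and ij: "(i, j) \<in> XX2" and y: "0 \<le> y" "y \<notin> E" and a: "a \<noteq> lam i j y n"
  shows "((\<lambda>t. measure lborel {u\<in>{0<..t}. (a < lam i j (y + u) n) \<noteq> (a < lam i j y n)} / t) \<longlongrightarrow> 0) (at_right 0)"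
proof -
  let ?A = "\<lambda>q. {y. q < lam i j (max 0 y) n}"
  have Am: "?A q \<in> sets borel" for q
  proof -
    have "{y \<in> space borel. q < lam i j (max 0 y) n} \<in> sets borel"
      using lam_measurable[OF ij] by measurable
    then show ?thesis by simp
  qed
  have mm: "mismatch (?A q) y t \<in> fmeasurable lborel" for q t
  proof (rule fmeasurableI2[of "{0<..t}"])
    have "{u. y + u \<in> ?A q} \<in> sets borel"
      using measurable_sets[OF _ Am, of "\<lambda>u. y + u" borel q] by (simp add: vimage_def)
    moreover have "mismatch (?A q) y t = (if y \<in> ?A q then {0<..t} - {u. y + u \<in> ?A q} else {0<..t} \<inter> {u. y + u \<in> ?A q})"
      by (auto simp: mismatch_def)
    ultimately show "mismatch (?A q) y t \<in> sets lborel" by auto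
    show "{0<..t} \<in> fmeasurable lborel" by (cases "0 \<le> t") (auto simp: fmeasurable_def)
  qed (auto simp: mismatch_def)
  obtain q where q: "q \<in> \<rat>" "(a < q \<and> q < lam i j y n) \<or> (lam i j y n < q \<and> q < a)"
    using Rats_dense_in_real[of a "lam i j y n"] Rats_dense_in_real[of "lam i j y n" a] a by (metis linorder_neqE)
  have sub: "{u\<in>{0<..t}. (a < lam i j (y + u) n) \<noteq> (a < lam i j y n)} \<subseteq> mismatch (?A q) y t" for t
    using q(2) y(1) by (auto simp: mismatch_def max_def)
  have lim: "((\<lambda>t. measure lborel (mismatch (?A q) y t) / t) \<longlongrightarrow> 0) (at_right 0)"
    using E ij q(1) y(2) unfolding regular_ages_def by blast
  have ev: "\<forall>\<^sub>F t in at_right 0. (0::real) < t"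
    by (simp add: eventually_at_right_less)
  show ?thesis
  proof (rule tendsto_sandwich[OF _ _ tendsto_const lim])
    show "\<forall>\<^sub>F t in at_right 0. 0 \<le> measure lborel {u\<in>{0<..t}. (a < lam i j (y + u) n) \<noteq> (a < lam i j y n)} / t"
      using ev by eventually_elim simp
    show "\<forall>\<^sub>F t in at_right 0. measure lborel {u\<in>{0<..t}. (a < lam i j (y + u) n) \<noteq> (a < lam i j y n)} / t
        \<le> measure lborel (mismatch (?A q) y t) / t"
      using ev by eventually_elim (intro divide_right_mono measure_mono_fmeasurable[OF sub fmeasurableD[OF rate_mismatch_fmeasurable[OF ij y(1)]] mm]; simp)
  qed
qed

lemma jmp_mismatch_measurable:
  assumes "z \<in> states"
  shows "{u\<in>{0<..t}. jmp (flow u z) v \<noteq> k} \<in> sets borel"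
proof -
  have "(\<lambda>u. (flow (max 0 u) z, v)) \<in> borel \<rightarrow>\<^sub>M state_space \<Otimes>\<^sub>M borel"
    unfolding flow_def split_beta by measurable
  from measurable_compose[OF this jmp_measurable]
  have "(\<lambda>u. jmp (flow (max 0 u) z) v) \<in> borel \<rightarrow>\<^sub>M count_space UNIV"
    using assms by (simp add: flow_states)
  then have "{u\<in>space borel. jmp (flow (max 0 u) z) v \<noteq> k} \<in> sets borel" by measurable
  moreover have "{u\<in>{0<..t}. jmp (flow u z) v \<noteq> k} = {0<..t} \<inter> {u\<in>space borel. jmp (flow (max 0 u) z) v \<noteq> k}"
    by auto
  ultimately show ?thesis by simp
qed

text \<open>A mark lies in at most one cell of the source \<open>i\<close>. At good ages only the
  target \<open>j\<close> of that cell can be reached, and it is reached exactly when the rate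
  exceeds \<open>v - base i j\<close>; so a change of target is a crossing of a fixed level by one
  rate.\<close>

lemma jmp_mismatch:
  assumes E: "regular_ages E" and z: "z \<in> states" "fst (snd z) \<notin> E"
  obtains C where "countable C" "\<And>v. v \<notin> C \<Longrightarrow>
    ((\<lambda>t. measure lborel {u\<in>{0<..t}. jmp (flow u z) v \<noteq> jmp z v} / t) \<longlongrightarrow> 0) (at_right 0)"
proof -
  obtain i y n where zi: "z = (i, y, n)" by (cases z)
  have i: "i \<in> XX" "0 \<le> y" "y \<notin> E" "y \<notin> bad_ages"
    using z E by (auto simp: zi regular_ages_def)
  define N where "N = {u. u - (- y) \<in> bad_ages}"
  have N: "N \<in> null_sets lborel" unfolding N_def by (rule null_sets_translation[OF bad_ages_null])
  let ?M = "\<lambda>v t. {u\<in>{0<..t}. jmp (flow u z) v \<noteq> jmp z v}"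
  have ev: "\<forall>\<^sub>F t in at_right 0. (0::real) < t"
    by (simp add: eventually_at_right_less)
  show ?thesis
  \<comment> \<open>These are the right end points of the current intervals: there the level equals
    the current rate, and density at the starting age gives no information.\<close>
  proof (rule that[of "(\<lambda>j. base i j + lam i j y n) ` XX"])
    show "countable ((\<lambda>j. base i j + lam i j y n) ` XX)" by simp
    fix v assume v: "v \<notin> (\<lambda>j. base i j + lam i j y n) ` XX"
    show "((\<lambda>t. measure lborel (?M v t) / t) \<longlongrightarrow> 0) (at_right 0)"
    proof (cases "\<exists>j\<in>XX - {i}. v \<in> {base i j ..< base i j + nrm i j}")
      case True
      then obtain j where j: "j \<in> XX - {i}" "v \<in> {base i j ..< base i j + nrm i j}" by blast
      define a where "a = v - base i j"
      have a: "a \<noteq> lam i j y n"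
      proof
        assume "a = lam i j y n"
        then have "v = base i j + lam i j y n" by (simp add: a_def)
        then show False using v j by blast
      qed
      have jm: "jmp (i, y', n) v = (if a < lam i j y' n then j else 0)" if y': "0 \<le> y'" "y' \<notin> bad_ages" for y'
      proof -
        have g: "(i, y', n) \<in> good_states" using i y' by simp
        have "jmp (i, y', n) v = j" if "jmp (i, y', n) v \<noteq> 0"
          using jmp_base[OF g refl that] jmp_nonzeroD(1)[OF refl that] j
            base_disjoint[OF XX2I[OF i(1)] XX2I[OF i(1) j(1)], of "jmp (i, y', n) v"] by blast
        moreover have "jmp (i, y', n) v = j \<longleftrightarrow> a < lam i j y' n"
          using jmp_iff[OF i(1) y'(1), of j n v] j Lam_off_bad[OF y', of i j n] by (auto simp: a_def XX_def)
        moreover have "j \<noteq> 0" using j by (auto simp: XX_def)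
        ultimately show ?thesis by auto
      qed
      let ?R = "\<lambda>t. {u\<in>{0<..t}. (a < lam i j (y + u) n) \<noteq> (a < lam i j y n)}"
      have sub: "?M v t \<subseteq> ?R t \<union> N" for t
      proof
        fix u assume u: "u \<in> ?M v t"
        show "u \<in> ?R t \<union> N"
        proof (cases "y + u \<in> bad_ages")
          case False
          then show ?thesis
            using u jm[of "y + u"] jm[OF i(2,4)] i by (auto simp: zi flow_def split: if_splits)
        qed (simp add: N_def add.commute)
      qed
      have Rm: "?R t \<in> fmeasurable lborel" for t
        by (rule rate_mismatch_fmeasurable[OF XX2I[OF i(1) j(1)] i(2)])
      have le: "measure lborel (?M v t) \<le> measure lborel (?R t)" for t
      proof -
        have "measure lborel (?M v t) \<le> measure lborel (?R t \<union> N)"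
        proof (rule measure_mono_fmeasurable[OF sub])
          show "?M v t \<in> sets lborel" using jmp_mismatch_measurable[OF z(1)] by simp
          show "?R t \<union> N \<in> fmeasurable lborel"
            by (rule fmeasurable.Un[OF Rm fmeasurableI_null_sets[OF N]])
        qed
        also have "\<dots> = measure lborel (?R t)"
          by (rule measure_Un_null_set[OF fmeasurableD[OF Rm] N])
        finally show ?thesis .
      qed
      show ?thesis
      proof (rule tendsto_sandwich[OF _ _ tendsto_const rate_mismatch[OF E XX2I[OF i(1) j(1)] i(2,3) a]])
        show "\<forall>\<^sub>F t in at_right 0. 0 \<le> measure lborel (?M v t) / t"
          using ev by eventually_elim simp
        show "\<forall>\<^sub>F t in at_right 0. measure lborel (?M v t) / t \<le> measure lborel (?R t) / t"
          using ev by eventually_elim (intro divide_right_mono le; simp)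
      qed
    next
      case False
      have j0: "jmp (i, y', n) v = 0" if y': "0 \<le> y'" "y' \<notin> bad_ages" for y'
      proof (rule ccontr)
        assume nz: "jmp (i, y', n) v \<noteq> 0"
        have "(i, y', n) \<in> good_states" using i y' by simp
        from jmp_base[OF this refl nz] jmp_nonzeroD(1)[OF refl nz] False show False by blast
      qed
      have sub: "?M v t \<subseteq> N" for t
      proof
        fix u assume u: "u \<in> ?M v t"
        show "u \<in> N"
        proof (rule ccontr)
          assume "u \<notin> N"
          then have "y + u \<notin> bad_ages" by (simp add: N_def add.commute)
          then show False using u j0[of "y + u"] j0[OF i(2,4)] i(2) by (simp add: zi flow_def)
        qed
      qed
      have "?M v t \<in> null_sets lborel" for t
        by (rule null_sets_subset[OF N _ sub]) (use jmp_mismatch_measurable[OF z(1)] in simp)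
      then have "measure lborel (?M v t) = 0" for t
        by (simp add: measure_eq_0_null_sets)
      then show ?thesis by simp
    qed
  qed
qed

end

section \<open>The compensator along the flow for short times\<close>

lemma ennreal_tendsto_0I:
  fixes f :: "'b \<Rightarrow> ennreal"
  assumes "\<And>e::real. 0 < e \<Longrightarrow> \<forall>\<^sub>F x in G. f x \<le> ennreal e"
  shows "(f \<longlongrightarrow> 0) G"
proof (rule order_tendstoI)
  fix a :: ennreal assume a: "0 < a"
  obtain e where e: "0 < e" "ennreal e < a"
  proof (cases a)
    case (real r)
    then show ?thesis using a that[of "r / 2"] by (auto simp: ennreal_less_iff)
  next
    case top
    then show ?thesis using that[of 1] by simp
  qed
  show "\<forall>\<^sub>F x in G. f x < a"
    using assms[OF e(1)] by eventually_elim (use e in auto)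
qed simp

lemma nn_integral_indicator_sum:
  assumes "S \<in> sets N" "S1 \<in> sets N" "S2 \<in> sets N"
  shows "(\<integral>\<^sup>+u. a * indicator S u + (b * indicator S1 u + b * indicator S2 u) \<partial>N) =
    a * emeasure N S + (b * emeasure N S1 + b * emeasure N S2)"
  using assms by (simp add: nn_integral_add nn_integral_cmult_indicator)

text \<open>Two separate flow times are needed: a component hit at time \<open>u\<close> flows for
  \<open>t - u\<close> from its new state, while a component that is not hit flows for
  \<open>t\<close>.\<close>

lemma flow_continuous:
  assumes c: "continuous_in_ages \<phi>" and z: "z1 \<in> states" "z2 \<in> states" and e: "0 < (e::real)"
  obtains d where "0 < d" "\<And>r1 r2. 0 \<le> r1 \<Longrightarrow> r1 < d \<Longrightarrow> 0 \<le> r2 \<Longrightarrow> r2 < d \<Longrightarrow>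
    \<bar>\<phi> (flow r1 z1, flow r2 z2) - \<phi> (z1, z2)\<bar> \<le> e"
proof -
  obtain i1 y1 n1 i2 y2 n2 where z12: "z1 = (i1, y1, n1)" "z2 = (i2, y2, n2)"
    by (cases z1, cases z2)
  have i: "i1 \<in> XX" "i2 \<in> XX" "0 \<le> y1" "0 \<le> y2" using z z12 by auto
  let ?f = "\<lambda>(y1, y2). \<phi> ((i1, y1, n1), (i2, y2, n2))"
  have "continuous_on ({0..} \<times> {0..}) ?f" using c i unfolding continuous_in_ages_def by blast
  then obtain d where d: "0 < d" "\<And>p. p \<in> {0..} \<times> {0..} \<Longrightarrow> dist p (y1, y2) < d \<Longrightarrow> dist (?f p) (?f (y1, y2)) < e"
    unfolding continuous_on_iff using i e by (metis (no_types, lifting) atLeast_iff mem_Sigma_iff)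
  show ?thesis
  proof (rule that[of "d / 2"])
    fix r1 r2 :: real assume r: "0 \<le> r1" "r1 < d / 2" "0 \<le> r2" "r2 < d / 2"
    have "dist (y1 + r1, y2 + r2) (y1, y2) \<le> \<bar>r1\<bar> + \<bar>r2\<bar>"
      unfolding dist_Pair_Pair by (rule order_trans[OF sqrt_sum_squares_le_sum_abs]) (simp add: dist_real_def)
    also have "\<dots> < d" using r by simp
    finally show "\<bar>\<phi> (flow r1 z1, flow r2 z2) - \<phi> (z1, z2)\<bar> \<le> e"
      using d(2)[of "(y1 + r1, y2 + r2)"] i r by (simp add: z12 flow_def dist_real_def)
  qed (use d in simp)
qed

context jump_rates
begin

text \<open>The Duhamel integrand with the random left limits replaced by the flow from the starting
  points. The truncations at 0 are inactive for times in \<open>(0, t]\<close> and give a function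
  that is measurable on the whole plane.\<close>

definition det_jump :: "(state \<times> state \<Rightarrow> real) \<Rightarrow> real \<Rightarrow> state \<Rightarrow> state \<Rightarrow> real \<times> real \<Rightarrow> real" where
  "det_jump \<phi> t z1 z2 p = jump_diff (\<lambda>z. \<phi> (flow (max 0 (t - fst p)) (fst z), flow (max 0 (t - fst p)) (snd z)))
     (flow (max 0 (fst p)) z1) (flow (max 0 (fst p)) z2) (snd p)"

context
  fixes \<phi> B z1 z2
  assumes B: "bounded_on_states \<phi> B" and cont: "continuous_in_ages \<phi>"
    and z: "z1 \<in> states" "z2 \<in> states"
begin

lemma bound_nonneg: "0 \<le> B"
  using bounded_on_statesD[OF B z] by linarith

lemma det_jump_bound: "\<bar>det_jump \<phi> t z1 z2 p\<bar> \<le> 2 * B"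
  unfolding det_jump_def by (intro jump_diff_bound bounded_on_states_flow B flow_states z) auto

lemma det_jump_measurable: "det_jump \<phi> t z1 z2 \<in> borel_measurable (borel \<Otimes>\<^sub>M borel)"
proof -
  let ?S = "borel \<Otimes>\<^sub>M borel :: (real \<times> real) measure"
  have c: "(\<lambda>x. \<phi> (clean (g1 x), clean (g2 x))) \<in> borel_measurable ?S"
    if "g1 \<in> ?S \<rightarrow>\<^sub>M state_space" "g2 \<in> ?S \<rightarrow>\<^sub>M state_space" for g1 g2
    using measurable_compose[OF measurable_Pair[OF that] continuous_in_ages_measurable[OF cont]] by simp
  have fl: "(\<lambda>x. flow (r x) (g x)) \<in> ?S \<rightarrow>\<^sub>M state_space"
    if "g \<in> ?S \<rightarrow>\<^sub>M state_space" "r \<in> borel_measurable ?S" for g r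
    using measurable_compose[OF measurable_Pair[OF that(2,1)] flow_measurable] by simp
  have mv: "(\<lambda>x. move (clean (g x)) (snd x)) \<in> ?S \<rightarrow>\<^sub>M state_space"
    if "g \<in> ?S \<rightarrow>\<^sub>M state_space" for g
    using measurable_compose[OF measurable_Pair[OF that measurable_snd] move_measurable] by simp
  let ?r = "\<lambda>x::real \<times> real. max 0 (t - fst x)" and ?g = "\<lambda>z (x::real \<times> real). flow (max 0 (fst x)) z"
  have "(\<lambda>x. \<phi> (clean (flow (?r x) (move (clean (?g z1 x)) (snd x))), clean (flow (?r x) (move (clean (?g z2 x)) (snd x))))
    - \<phi> (clean (flow (?r x) (?g z1 x)), clean (flow (?r x) (?g z2 x)))) \<in> borel_measurable ?S"
    by (intro borel_measurable_diff c fl mv measurable_const) (auto simp: space_pair_measure)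
  moreover have "\<phi> (clean (flow (?r x) (move (clean (?g z1 x)) (snd x))), clean (flow (?r x) (move (clean (?g z2 x)) (snd x))))
    - \<phi> (clean (flow (?r x) (?g z1 x)), clean (flow (?r x) (?g z2 x))) = det_jump \<phi> t z1 z2 x" for x
    using z by (simp add: det_jump_def jump_diff_def flow_states move_states)
  ultimately show ?thesis by simp
qed

lemma jump_diff_measurable: "jump_diff \<phi> z1 z2 \<in> borel_measurable borel"
proof -
  have "(\<lambda>v. det_jump \<phi> 0 z1 z2 (0, v)) \<in> borel_measurable borel"
    using measurable_compose[OF measurable_Pair[OF measurable_const measurable_ident] det_jump_measurable] by simp
  then show ?thesis by (simp add: det_jump_def[abs_def])
qed

text \<open>A jump resets the age and so forgets how long the flow ran before it. With an unchanged
  target the final state is therefore reached by flowing from \<open>move z v\<close>, for time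
  \<open>t - u\<close> after a hit and for time \<open>t\<close> without one.\<close>

lemma det_jump_matched:
  assumes "0 < u" "u \<le> t" "jmp (flow u z1) v = jmp z1 v" "jmp (flow u z2) v = jmp z2 v"
  obtains r1 r2 where "0 \<le> r1" "r1 \<le> t" "0 \<le> r2" "r2 \<le> t"
    "det_jump \<phi> t z1 z2 (u, v) = \<phi> (flow r1 (move z1 v), flow r2 (move z2 v)) - \<phi> (flow t z1, flow t z2)"
proof -
  have m: "flow (t - u) (move (flow u z') v) = flow (if jmp z' v = 0 then t else t - u) (move z' v)"
    if "jmp (flow u z') v = jmp z' v" for z'
    using that by (cases z') (simp add: move_def flow_def)
  show ?thesis
    by (rule that[of "if jmp z1 v = 0 then t else t - u" "if jmp z2 v = 0 then t else t - u"])
       (use assms in \<open>auto simp: det_jump_def jump_diff_def m flow_flow\<close>)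
qed

abbreviation "err t \<equiv> \<lambda>v. \<integral>\<^sup>+u. ennreal \<bar>det_jump \<phi> t z1 z2 (u, v) - jump_diff \<phi> z1 z2 v\<bar> * indicator {0<..t} u \<partial>lborel"

text \<open>For a fixed mark outside a countable set, the times at which either target differs from
  its initial value have density zero at 0; at the other times continuity of \<open>\<phi>\<close>
  makes the difference small.\<close>

lemma err_pointwise:
  assumes E: "regular_ages E" "fst (snd z1) \<notin> E" "fst (snd z2) \<notin> E"
  shows "AE v in lborel. ((\<lambda>t. ennreal (1 / t) * err t v) \<longlongrightarrow> 0) (at_right 0)"
proof -
  obtain C1 where C1: "countable C1" "\<And>v. v \<notin> C1 \<Longrightarrow>
    ((\<lambda>t. measure lborel {u\<in>{0<..t}. jmp (flow u z1) v \<noteq> jmp z1 v} / t) \<longlongrightarrow> 0) (at_right 0)"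
    using jmp_mismatch[OF E(1) z(1) E(2)] by blast
  obtain C2 where C2: "countable C2" "\<And>v. v \<notin> C2 \<Longrightarrow>
    ((\<lambda>t. measure lborel {u\<in>{0<..t}. jmp (flow u z2) v \<noteq> jmp z2 v} / t) \<longlongrightarrow> 0) (at_right 0)"
    using jmp_mismatch[OF E(1) z(2) E(3)] by blast
  have "C1 \<union> C2 \<in> null_sets lborel" using C1 C2 by (intro countable_imp_null_set_lborel) auto
  then have "AE v in lborel. v \<notin> C1 \<union> C2" by (rule AE_not_in)
  then show ?thesis
  proof eventually_elim
    case (elim v)
    let ?M1 = "\<lambda>t. {u\<in>{0<..t}. jmp (flow u z1) v \<noteq> jmp z1 v}"
    let ?M2 = "\<lambda>t. {u\<in>{0<..t}. jmp (flow u z2) v \<noteq> jmp z2 v}"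
    let ?d = "\<lambda>t. measure lborel (?M1 t) / t + measure lborel (?M2 t) / t"
    have Mm: "?M1 t \<in> sets lborel" "?M2 t \<in> sets lborel" for t
      unfolding sets_lborel by (rule jmp_mismatch_measurable[OF z(1)], rule jmp_mismatch_measurable[OF z(2)])
    have Me: "emeasure lborel (?M1 t) = ennreal (measure lborel (?M1 t))" "emeasure lborel (?M2 t) = ennreal (measure lborel (?M2 t))"
      if "0 < t" for t
    proof -
      have "emeasure lborel {0<..t} < \<infinity>" using that by simp
      moreover have "emeasure lborel (?M1 t) \<le> emeasure lborel {0<..t}" "emeasure lborel (?M2 t) \<le> emeasure lborel {0<..t}"
        by (rule emeasure_mono; force)+
      ultimately have "emeasure lborel (?M1 t) \<noteq> \<infinity>" "emeasure lborel (?M2 t) \<noteq> \<infinity>"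
        by (metis infinity_ennreal_def leD)+
      then show "emeasure lborel (?M1 t) = ennreal (measure lborel (?M1 t))" "emeasure lborel (?M2 t) = ennreal (measure lborel (?M2 t))"
        unfolding infinity_ennreal_def by - (rule emeasure_eq_ennreal_measure, assumption)+
    qed
    have dl: "(?d \<longlongrightarrow> 0) (at_right 0)"
      using tendsto_add[OF C1(2) C2(2), of v v] elim by simp
    show ?case
    proof (rule ennreal_tendsto_0I)
      fix e :: real assume e: "0 < e"
      obtain d1 where d1: "0 < d1" "\<And>r1 r2. 0 \<le> r1 \<Longrightarrow> r1 < d1 \<Longrightarrow> 0 \<le> r2 \<Longrightarrow> r2 < d1 \<Longrightarrow>
        \<bar>\<phi> (flow r1 (move z1 v), flow r2 (move z2 v)) - \<phi> (move z1 v, move z2 v)\<bar> \<le> e / 4"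
        using flow_continuous[OF cont move_states[OF z(1)] move_states[OF z(2)], of "e / 4"] e by auto
      obtain d2 where d2: "0 < d2" "\<And>r1 r2. 0 \<le> r1 \<Longrightarrow> r1 < d2 \<Longrightarrow> 0 \<le> r2 \<Longrightarrow> r2 < d2 \<Longrightarrow>
        \<bar>\<phi> (flow r1 z1, flow r2 z2) - \<phi> (z1, z2)\<bar> \<le> e / 4"
        using flow_continuous[OF cont z, of "e / 4"] e by auto
      \<comment> \<open>The threshold gives \<open>4 * B * (e / (8 * B + 1)) \<le> e / 2\<close>;
        the added 1 keeps it meaningful for \<open>B = 0\<close>.\<close>
      have ev1: "\<forall>\<^sub>F t in at_right 0. ?d t < e / (8 * B + 1)"
        using dl e bound_nonneg by (intro order_tendstoD) auto
      have ev2: "\<forall>\<^sub>F t in at_right 0. 0 < t \<and> t < min d1 d2"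
        unfolding eventually_at_right_field using d1(1) d2(1) by (intro exI[of _ "min d1 d2"]) auto
      show "\<forall>\<^sub>F t in at_right 0. ennreal (1 / t) * err t v \<le> ennreal e"
        using ev1 ev2
      proof eventually_elim
        case (elim t)
        then have t: "0 < t" "t < d1" "t < d2" by auto
        \<comment> \<open>Matched times cost \<open>e / 4\<close> for each of the two terms of the
          difference; mismatched ones cost the crude bound \<open>4 * B\<close>.\<close>
        have pt: "\<bar>det_jump \<phi> t z1 z2 (u, v) - jump_diff \<phi> z1 z2 v\<bar> \<le> e / 2 + 4 * B * (indicator (?M1 t) u + indicator (?M2 t) u)"
          if u: "u \<in> {0<..t}" for u
        proof (cases "u \<in> ?M1 t \<or> u \<in> ?M2 t")
          case True
          have "\<bar>det_jump \<phi> t z1 z2 (u, v) - jump_diff \<phi> z1 z2 v\<bar> \<le> 2 * B + 2 * B"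
            using det_jump_bound[of t "(u, v)"] jump_diff_bound[OF B z, of v] by linarith
          moreover have "4 * B * 1 \<le> 4 * B * (indicator (?M1 t) u + indicator (?M2 t) u)"
            using True bound_nonneg by (intro mult_left_mono) (auto simp: indicator_def)
          ultimately show ?thesis using e by linarith
        next
          case False
          then have j: "jmp (flow u z1) v = jmp z1 v" "jmp (flow u z2) v = jmp z2 v" using u by auto
          obtain r1 r2 where r: "0 \<le> r1" "r1 \<le> t" "0 \<le> r2" "r2 \<le> t"
            "det_jump \<phi> t z1 z2 (u, v) = \<phi> (flow r1 (move z1 v), flow r2 (move z2 v)) - \<phi> (flow t z1, flow t z2)"
            using det_jump_matched[OF _ _ j] u by auto
          have "\<bar>\<phi> (flow r1 (move z1 v), flow r2 (move z2 v)) - \<phi> (move z1 v, move z2 v)\<bar> \<le> e / 4"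
            using r t by (intro d1(2)) auto
          moreover have "\<bar>\<phi> (flow t z1, flow t z2) - \<phi> (z1, z2)\<bar> \<le> e / 4"
            using t by (intro d2(2)) auto
          ultimately have "\<bar>det_jump \<phi> t z1 z2 (u, v) - jump_diff \<phi> z1 z2 v\<bar> \<le> e / 2"
            unfolding r(5) jump_diff_def by linarith
          then show ?thesis using False by simp
        qed
        have "err t v \<le> (\<integral>\<^sup>+u. ennreal (e / 2) * indicator {0<..t} u + (ennreal (4 * B) * indicator (?M1 t) u + ennreal (4 * B) * indicator (?M2 t) u) \<partial>lborel)"
        proof (rule nn_integral_mono)
          fix u
          show "ennreal \<bar>det_jump \<phi> t z1 z2 (u, v) - jump_diff \<phi> z1 z2 v\<bar> * indicator {0<..t} u \<le>
            ennreal (e / 2) * indicator {0<..t} u + (ennreal (4 * B) * indicator (?M1 t) u + ennreal (4 * B) * indicator (?M2 t) u)"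
          proof (cases "u \<in> {0<..t}")
            case True
            have "ennreal \<bar>det_jump \<phi> t z1 z2 (u, v) - jump_diff \<phi> z1 z2 v\<bar> \<le>
               ennreal (e / 2 + 4 * B * (indicator (?M1 t) u + indicator (?M2 t) u))"
              by (rule ennreal_leI[OF pt[OF True]])
            also have "\<dots> = ennreal (e / 2) + (ennreal (4 * B) * indicator (?M1 t) u + ennreal (4 * B) * indicator (?M2 t) u)"
              using e bound_nonneg by (auto simp: indicator_def distrib_left simp flip: ennreal_plus)
            finally show ?thesis using True by simp
          qed simp
        qed
        also have "\<dots> = ennreal (e / 2) * ennreal t + (ennreal (4 * B) * emeasure lborel (?M1 t) + ennreal (4 * B) * emeasure lborel (?M2 t))"
          by (subst nn_integral_indicator_sum[OF _ Mm]) (use t in simp_all)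
        also have "\<dots> = ennreal (e / 2 * t + (4 * B * measure lborel (?M1 t) + 4 * B * measure lborel (?M2 t)))"
          unfolding Me[OF t(1)] using e t bound_nonneg by (simp flip: ennreal_mult ennreal_plus)
        finally have "ennreal (1 / t) * err t v \<le> ennreal (1 / t) * ennreal (e / 2 * t + (4 * B * measure lborel (?M1 t) + 4 * B * measure lborel (?M2 t)))"
          by (rule mult_left_mono) simp
        also have "\<dots> = ennreal (1 / t * (e / 2 * t + (4 * B * measure lborel (?M1 t) + 4 * B * measure lborel (?M2 t))))"
          using t by (intro ennreal_mult'[symmetric]) simp
        also have "\<dots> \<le> ennreal e"
        proof (rule ennreal_leI)
          have "1 / t * (e / 2 * t + (4 * B * measure lborel (?M1 t) + 4 * B * measure lborel (?M2 t))) = e / 2 + 4 * B * ?d t"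
            using t by (simp add: field_simps)
          also have "4 * B * ?d t \<le> 4 * B * (e / (8 * B + 1))"
            using elim bound_nonneg by (intro mult_left_mono) auto
          also have "\<dots> \<le> e / 2"
            using e bound_nonneg by (simp add: field_simps)
          finally show "1 / t * (e / 2 * t + (4 * B * measure lborel (?M1 t) + 4 * B * measure lborel (?M2 t))) \<le> e" by simp
        qed
        finally show ?case .
      qed
    qed
  qed
qed

lemma err_measurable: "err t \<in> borel_measurable lborel"
proof -
  have "(\<lambda>x. ennreal \<bar>det_jump \<phi> t z1 z2 (snd x, fst x) - jump_diff \<phi> z1 z2 (fst x)\<bar> * indicator {0<..t} (snd x))
    \<in> borel_measurable (lborel \<Otimes>\<^sub>M lborel)"
  proof -
    have "(\<lambda>x. det_jump \<phi> t z1 z2 (snd x, fst x)) \<in> borel_measurable (lborel \<Otimes>\<^sub>M lborel)"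
      by (rule measurable_compose[OF _ det_jump_measurable]) measurable
    moreover have "(\<lambda>x. jump_diff \<phi> z1 z2 (fst x)) \<in> borel_measurable (lborel \<Otimes>\<^sub>M lborel)"
      by (rule measurable_compose[OF _ jump_diff_measurable]) measurable
    ultimately show ?thesis by measurable
  qed
  from lborel.borel_measurable_nn_integral_fst[OF this] show ?thesis by simp
qed

text \<open>Dominated convergence in the mark, taken along sequences. The time average is at most
  \<open>4 * B\<close> and vanishes off the two base unions, since the flow avoids bad ages at
  almost every time; these unions have finite length, which is why domination by a fixed set of
  marks is available.\<close>

lemma err_limit:
  assumes E: "regular_ages E" "fst (snd z1) \<notin> E" "fst (snd z2) \<notin> E"
    and \<tau>: "\<And>k::nat. 0 < \<tau> k" "\<tau> \<longlonglongrightarrow> 0"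
  shows "(\<lambda>k. \<integral>\<^sup>+v. ennreal (1 / \<tau> k) * err (\<tau> k) v \<partial>lborel) \<longlonglongrightarrow> 0"
proof -
  obtain i1 y1 n1 i2 y2 n2 where z12: "z1 = (i1, y1, n1)" "z2 = (i2, y2, n2)"
    by (cases z1, cases z2)
  have y: "0 \<le> y1" "0 \<le> y2" "i1 \<in> XX" "i2 \<in> XX" using z z12 by auto
  have g: "z1 \<in> good_states" "z2 \<in> good_states"
    using E z unfolding regular_ages_def z12 by auto
  let ?U = "base_union i1 \<union> base_union i2"
  let ?w = "\<lambda>v. ennreal (4 * B) * indicator ?U v"
  have null: "AE u in lborel. y1 + u \<notin> bad_ages \<and> y2 + u \<notin> bad_ages"
  proof -
    have "AE u in lborel. u \<notin> {u. u - (- c) \<in> bad_ages}" for c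
      by (rule AE_not_in[OF null_sets_translation[OF bad_ages_null]])
    from this[of y1] this[of y2] show ?thesis
      by eventually_elim (auto simp: add.commute)
  qed
  have "(\<lambda>k. \<integral>\<^sup>+v. ennreal (1 / \<tau> k) * err (\<tau> k) v \<partial>lborel) \<longlonglongrightarrow> (\<integral>\<^sup>+v. 0 \<partial>(lborel :: real measure))"
  proof (rule nn_integral_dominated_convergence[where w="?w" and u="\<lambda>k v. ennreal (1 / \<tau> k) * err (\<tau> k) v" and u'="\<lambda>_. 0"])
    show "(\<lambda>v. ennreal (1 / \<tau> k) * err (\<tau> k) v) \<in> borel_measurable lborel" for k
      using err_measurable by (intro borel_measurable_times_ennreal) auto
    show "AE v in lborel. ennreal (1 / \<tau> k) * err (\<tau> k) v \<le> ?w v" for k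
    proof (rule AE_I2)
      fix v
      show "ennreal (1 / \<tau> k) * err (\<tau> k) v \<le> ?w v"
      proof (cases "v \<in> ?U")
        case True
        have "err (\<tau> k) v \<le> (\<integral>\<^sup>+u. ennreal (4 * B) * indicator {0<..\<tau> k} u \<partial>lborel)"
        proof (intro nn_integral_mono mult_right_mono ennreal_leI)
          fix u
          show "\<bar>det_jump \<phi> (\<tau> k) z1 z2 (u, v) - jump_diff \<phi> z1 z2 v\<bar> \<le> 4 * B"
            using det_jump_bound[of "\<tau> k" "(u, v)"] jump_diff_bound[OF B z, of v] by linarith
        qed simp
        also have "\<dots> = ennreal (4 * B) * ennreal (\<tau> k)"
          using \<tau>(1)[of k] by (simp add: nn_integral_cmult_indicator)
        finally have "ennreal (1 / \<tau> k) * err (\<tau> k) v \<le> ennreal (1 / \<tau> k) * (ennreal (4 * B) * ennreal (\<tau> k))"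
          by (rule mult_left_mono) simp
        also have "\<dots> = ennreal (4 * B)"
          using \<tau>(1)[of k] bound_nonneg by (simp flip: ennreal_mult)
        finally show ?thesis using True by simp
      next
        case False
        have nj: "jmp z1 v = 0" "jmp z2 v = 0"
          using jmp_in_base_union[of i1 y1 n1 v] jmp_in_base_union[of i2 y2 n2 v] g False by (auto simp: z12)
        have "err (\<tau> k) v = (\<integral>\<^sup>+u. 0 \<partial>(lborel :: real measure))"
        proof (rule nn_integral_cong_AE)
          show "AE u in lborel. ennreal \<bar>det_jump \<phi> (\<tau> k) z1 z2 (u, v) - jump_diff \<phi> z1 z2 v\<bar> * indicator {0<..\<tau> k} u = 0"
            using null
          proof eventually_elim
            case (elim u)
            show ?case
            proof (cases "u \<in> {0<..\<tau> k}")
              case True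
              then have "(i1, y1 + u, n1) \<in> good_states" "(i2, y2 + u, n2) \<in> good_states" using elim y by auto
              then have "jmp (flow u z1) v = 0" "jmp (flow u z2) v = 0"
                using jmp_in_base_union[of i1 "y1 + u" n1 v] jmp_in_base_union[of i2 "y2 + u" n2 v] False
                by (auto simp: z12 flow_def)
              then show ?thesis using True nj by (simp add: det_jump_def jump_diff_no_hit)
            qed simp
          qed
        qed
        then show ?thesis by simp
      qed
    qed
    show "(\<integral>\<^sup>+v. ?w v \<partial>lborel) < \<infinity>"
    proof -
      have "emeasure lborel ?U \<le> emeasure lborel (base_union i1) + emeasure lborel (base_union i2)"
        by (rule emeasure_subadditive) auto
      also have "\<dots> \<le> ennreal rate_bound + ennreal rate_bound"
        by (intro add_mono emeasure_base_union_le y)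
      also have "\<dots> < \<infinity>" by simp
      finally show ?thesis by (simp add: nn_integral_cmult_indicator ennreal_mult_less_top)
    qed
    show "AE v in lborel. (\<lambda>k. ennreal (1 / \<tau> k) * err (\<tau> k) v) \<longlonglongrightarrow> 0"
      using err_pointwise[OF E]
    proof eventually_elim
      case (elim v)
      have "filterlim \<tau> (at_right 0) sequentially"
        using \<tau> by (auto simp: filterlim_at intro!: always_eventually) (metis less_irrefl)
      from filterlim_compose[OF elim this] show ?case .
    qed
  qed auto
  then show ?thesis by simp
qed

end

end

section \<open>Jump probabilities and the limit of the difference quotient\<close>

lemma set_integral_abs_le:
  assumes "(\<integral>\<^sup>+p. ennreal \<bar>g p\<bar> * indicator S p \<partial>N) \<le> ennreal C" "0 \<le> C"
  shows "\<bar>LINT p:S|N. g p\<bar> \<le> C"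
proof (cases "set_integrable N S g")
  case True
  have "ennreal (norm (LINT p|N. indicator S p *\<^sub>R g p)) \<le> (\<integral>\<^sup>+p. ennreal (norm (indicator S p *\<^sub>R g p)) \<partial>N)"
    using True unfolding set_integrable_def by (rule integral_norm_bound_ennreal)
  also have "\<dots> = (\<integral>\<^sup>+p. ennreal \<bar>g p\<bar> * indicator S p \<partial>N)"
    by (rule nn_integral_cong) (auto simp: indicator_def)
  also note assms(1)
  finally show ?thesis using assms(2) by (simp add: set_lebesgue_integral_def)
next
  case False
  then have "(LINT p:S|N. g p) = 0"
    unfolding set_integrable_def set_lebesgue_integral_def by (rule not_integrable_integral_eq)
  then show ?thesis using assms(2) by simp
qed

context prm_jumps
begin

text \<open>The parity of the counter is a bounded function that changes by exactly one at every
  hit, so the absolute jump integrand counts jumps although the counter is unbounded. The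
  compensation formula and Markov's inequality then bound the probability. Pairing the process with
  itself reuses the estimate for two components; the factor 4 is its constant with
  \<open>B = 1\<close>.\<close>

lemma expected_jumps:
  assumes sol: "strong_solution M F lam prec P Z0 Z" and t: "0 \<le> t"
  defines "S \<equiv> {w\<in>space M. snd (snd (Z t w)) \<noteq> snd (snd (Z 0 w))}"
  shows "S \<in> events" "prob S \<le> 4 * rate_bound * t"
proof -
  define \<phi> :: "state \<times> state \<Rightarrow> real" where "\<phi> z = (if even (snd (snd (fst z))) then 1 else 0)" for z
  have B: "bounded_on_states \<phi> 1" by (auto simp: bounded_on_states_def \<phi>_def)
  have c: "continuous_in_ages \<phi>"
    unfolding continuous_in_ages_def \<phi>_def split_beta by simp
  have \<rho>: "(\<lambda>_::real. 0::real) \<in> borel_measurable borel" "\<And>u::real. 0 \<le> (0::real)" by auto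
  define f where "f = jump_fun \<phi> (\<lambda>_. 0) Z Z"
  note fm = jump_fun_measurable[OF sol sol B c \<rho>, folded f_def]
    and fb = jump_fun_section_bound[OF sol sol B c \<rho> t, folded f_def]
  have Zm: "Z s \<in> M \<rightarrow>\<^sub>M state_space" if "0 \<le> s" for s
    using sol F_measurable_M[OF that] that unfolding strong_solution_def by blast
  have "(\<lambda>w. real (snd (snd (Z s w)))) \<in> borel_measurable M" if "0 \<le> s" for s
    using Zm[OF that] by measurable
  from borel_measurable_neq[OF this[OF t] this[OF order_refl]] show S: "S \<in> events"
    unfolding S_def by simp
  have "emeasure M S = (\<integral>\<^sup>+w. indicator S w \<partial>M)" using S by simp
  also have "\<dots> \<le> (\<integral>\<^sup>+w. \<integral>\<^sup>+p. ennreal \<bar>f (w, p)\<bar> * indicator (strip t) p \<partial>P w \<partial>M)"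
  proof (rule nn_integral_mono_AE)
    show "AE w in M. indicator S w \<le> (\<integral>\<^sup>+p. ennreal \<bar>f (w, p)\<bar> * indicator (strip t) p \<partial>P w)"
      using regular_AE[OF sol]
    proof eventually_elim
      case (elim w)
      then interpret jump_path lam prec "P w" "\<lambda>t. Z t w" by (simp add: regular_def)
      have fG: "\<bar>f (w, p)\<bar> = hG p" if p: "p \<in> strip t" for p
      proof -
        have "0 < fst p" using p by auto
        then show ?thesis
          using elim by (cases p) (auto simp: f_def jump_fun_def jump_diff_def move_def \<phi>_def pre_zl hG_eq)
      qed
      have "(\<integral>\<^sup>+p. ennreal \<bar>f (w, p)\<bar> * indicator (strip t) p \<partial>P w) = (\<integral>\<^sup>+p. ennreal (indicator (strip t) p *\<^sub>R hG p) \<partial>P w)"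
        by (rule nn_integral_cong) (use fG in \<open>auto simp: indicator_def\<close>)
      also have "\<dots> = ennreal (LINT p:strip t|P w. hG p)"
        unfolding set_lebesgue_integral_def
        by (rule nn_integral_eq_integral)
           (use path_eqs(2)[OF t] hG_eq in \<open>auto simp: set_integrable_def indicator_def\<close>)
      also have "\<dots> = ennreal (real (cnt t) - real (cnt 0))"
        using path_eqs(6)[OF t] by simp
      finally have e: "(\<integral>\<^sup>+p. ennreal \<bar>f (w, p)\<bar> * indicator (strip t) p \<partial>P w) = ennreal (real (cnt t) - real (cnt 0))" .
      show ?case
      proof (cases "w \<in> S")
        case True
        then have "cnt 0 < cnt t" using cnt_mono[OF order_refl t] by (simp add: S_def)
        then have "1 \<le> real (cnt t) - real (cnt 0)" by linarith
        then have "ennreal 1 \<le> ennreal (real (cnt t) - real (cnt 0))" by (rule ennreal_leI)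
        then show ?thesis unfolding e using True by simp
      qed simp
    qed
  qed
  also have "\<dots> = (\<integral>\<^sup>+w. \<integral>\<^sup>+p. ennreal \<bar>f (w, p)\<bar> * indicator (strip t) p \<partial>m2 \<partial>M)"
    by (rule predictable_compensation[of "\<lambda>x. ennreal \<bar>f x\<bar>", OF _ t]) (use fm in measurable)
  also have "\<dots> \<le> (\<integral>\<^sup>+w. ennreal (4 * rate_bound * t) \<partial>M)"
  proof (rule nn_integral_mono_AE)
    show "AE w in M. (\<integral>\<^sup>+p. ennreal \<bar>f (w, p)\<bar> * indicator (strip t) p \<partial>m2) \<le> ennreal (4 * rate_bound * t)"
      using regular_AE[OF sol] by eventually_elim (use fb in simp)
  qed
  also have "\<dots> = ennreal (4 * rate_bound * t)" by (simp add: emeasure_space_1)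
  finally show "prob S \<le> 4 * rate_bound * t"
    using t rate_bound_nonneg by (simp add: emeasure_eq_measure)
qed

context
  fixes Z1 Z2 :: "'w process" and z1 z2 \<phi> B
  assumes sol: "strong_solution M F lam prec P (\<lambda>_. z1) Z1" "strong_solution M F lam prec P (\<lambda>_. z2) Z2"
    and z: "z1 \<in> states" "z2 \<in> states"
    and B: "bounded_on_states \<phi> B" and cont: "continuous_in_ages \<phi>"
begin

lemma test_integrable:
  assumes t: "0 \<le> t"
  shows "integrable M (\<lambda>w. \<phi> (Z1 t w, Z2 t w))"
proof -
  have m: "Z1 t \<in> M \<rightarrow>\<^sub>M state_space" "Z2 t \<in> M \<rightarrow>\<^sub>M state_space"
    and s: "\<And>w. w \<in> space M \<Longrightarrow> Z1 t w \<in> states \<and> Z2 t w \<in> states"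
    using sol F_measurable_M[OF t] t unfolding strong_solution_def by blast+
  have "(\<lambda>w. \<phi> (clean (Z1 t w), clean (Z2 t w))) \<in> borel_measurable M"
    using measurable_compose[OF measurable_Pair[OF m] continuous_in_ages_measurable[OF cont]] by simp
  then have "(\<lambda>w. \<phi> (Z1 t w, Z2 t w)) \<in> borel_measurable M"
    by (rule measurable_cong[THEN iffD1, rotated]) (use s in simp)
  moreover have "AE w in M. norm (\<phi> (Z1 t w, Z2 t w)) \<le> B"
    using s bounded_on_statesD[OF B] by (intro AE_I2) auto
  ultimately show ?thesis by (intro integrable_const_bound)
qed

text \<open>Along the flow the age is the starting age plus time, so bad ages are met only for a
  null set of times, whatever the starting ages are.\<close>

lemma det_jump_section_bound:
  assumes t: "0 \<le> t"
  shows "(\<integral>\<^sup>+p. ennreal \<bar>det_jump \<phi> t z1 z2 p\<bar> * indicator (strip t) p \<partial>m2) \<le> ennreal (4 * B * rate_bound * t)"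
proof -
  have m: "det_jump \<phi> t z1 z2 \<in> borel_measurable borel"
    using det_jump_measurable[OF B cont z] by (simp add: borel_prod)
  have "(\<integral>\<^sup>+p. ennreal \<bar>det_jump \<phi> t z1 z2 p\<bar> * indicator (strip t) p \<partial>m2) =
     (\<integral>\<^sup>+u. (\<integral>\<^sup>+v. ennreal \<bar>det_jump \<phi> t z1 z2 (u, v)\<bar> \<partial>lborel) * indicator {0<..t} u \<partial>lborel)"
    by (rule m2_nn_integral, rule measurable_compose[OF m]) measurable
  also have "\<dots> \<le> (\<integral>\<^sup>+u. ennreal (4 * B * rate_bound) * indicator {0<..t} u \<partial>lborel)"
  proof (rule nn_integral_mono_AE)
    have "AE u in lborel. u \<notin> {u. u - (- c) \<in> bad_ages}" for c
      by (rule AE_not_in[OF null_sets_translation[OF bad_ages_null]])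
    from this[of "fst (snd z1)"] this[of "fst (snd z2)"]
    show "AE u in lborel. (\<integral>\<^sup>+v. ennreal \<bar>det_jump \<phi> t z1 z2 (u, v)\<bar> \<partial>lborel) * indicator {0<..t} u \<le> ennreal (4 * B * rate_bound) * indicator {0<..t} u"
    proof eventually_elim
      case (elim u)
      show ?case
      proof (cases "u \<in> {0<..t}")
        case True
        have "flow u z1 \<in> good_states" "flow u z2 \<in> good_states"
          using elim True z by (cases z1; cases z2; auto simp: flow_def add.commute)+
        then show ?thesis
          using True jump_diff_nn_integral[OF _ _ bounded_on_states_flow[OF B, of "t - u"], of "flow u z1" "flow u z2"]
          by (simp add: det_jump_def)
      qed simp
    qed
  qed
  also have "\<dots> = ennreal (4 * B * rate_bound * t)"
    using t bound_nonneg[OF B cont z] rate_bound_nonneg by (simp add: nn_integral_cmult_indicator ennreal_mult'')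
  finally show ?thesis .
qed

definition det_comp :: "real \<Rightarrow> real" where
  "det_comp t = (LINT p:strip t|m2. det_jump \<phi> t z1 z2 p)"

text \<open>Duhamel's formula around the deterministic flow: interpolating by \<open>u \<mapsto> \<phi>(flow (t - u) (Z u))\<close>
  removes the derivative of \<open>\<phi>\<close>, which need not be bounded.\<close>

lemma duhamel:
  assumes t: "0 < t"
  shows "\<bar>(LINT w|M. \<phi> (Z1 t w, Z2 t w)) - \<phi> (flow t z1, flow t z2) - det_comp t\<bar> \<le> 64 * B * rate_bound\<^sup>2 * t\<^sup>2"
proof -
  have t0: "0 \<le> t" using t by simp
  define \<rho> where "\<rho> u = max 0 (t - u)" for u
  have \<rho>: "\<rho> \<in> borel_measurable borel" "\<And>u. 0 \<le> \<rho> u" by (auto simp: \<rho>_def[abs_def])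
  define f where "f = jump_fun \<phi> \<rho> Z1 Z2"
  note fm = jump_fun_measurable[OF sol B cont \<rho>, folded f_def]
    and ff = jump_fun_finite[OF sol B cont \<rho> t0, folded f_def]
    and fb = jump_fun_section_bound[OF sol B cont \<rho> t0, folded f_def]
  let ?C = "4 * B * rate_bound * t"
  have C0: "0 \<le> ?C" using bound_nonneg[OF B cont z] rate_bound_nonneg t by simp
  have 1: "AE w in M. \<phi> (Z1 t w, Z2 t w) - \<phi> (flow t z1, flow t z2) = jump_integral f t w"
    using regular_AE[OF sol(1)] regular_AE[OF sol(2)] AE_space
  proof eventually_elim
    case (elim w)
    have r: "regular Z1 w" "regular Z2 w" using elim by auto
    interpret p1: jump_path lam prec "P w" "\<lambda>t. Z1 t w" using r by (simp add: regular_def)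
    interpret p2: jump_path lam prec "P w" "\<lambda>t. Z2 t w" using r by (simp add: regular_def)
    interpret two_paths lam prec "P w" "\<lambda>t. Z1 t w" "\<lambda>t. Z2 t w" ..
    let ?\<theta> = "\<lambda>u z. \<phi> (flow (\<rho> u) (fst z), flow (\<rho> u) (snd z))"
    have j: "jumps ?\<theta> p = f (w, p)" for p
      using jump_fun_jumps[OF sol B cont \<rho> r, of p] by (simp add: f_def)
    have "(\<lambda>p. indicator (strip t) p *\<^sub>R jumps ?\<theta> p) \<in> borel_measurable (P w)"
      unfolding j using predictable_section_real[OF fm t0 elim(3)]
      by (subst measurable_cong_sets[OF sets_P[OF elim(3)] refl])
    \<comment> \<open>The density is zero: the time spent flowing and the remaining flow time always
      add up to \<open>t\<close>, so the interpolation is constant between jumps.\<close>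
    note PF = path_formula(3)[of t ?\<theta> B "\<lambda>_ _. 0", OF t0 bounded_on_states_flow[OF B \<rho>(2)] _ this]
    have "?\<theta> t (Z1 t w, Z2 t w) - ?\<theta> 0 (Z1 0 w, Z2 0 w) =
       (LINT u:{0..t}|lebesgue. 0) + (LINT p:strip t|P w. jumps ?\<theta> p)"
      by (rule PF) (auto simp: \<rho>_def flow_flow set_integrable_def set_lebesgue_integral_def max_def)
    moreover have "jumps ?\<theta> = (\<lambda>p. f (w, p))" by (rule ext) (rule j)
    moreover have "\<rho> t = 0" "\<rho> 0 = t" using t by (auto simp: \<rho>_def)
    ultimately show ?case
      using elim by (simp add: jump_integral_def set_lebesgue_integral_def)
  qed
  define J where "J = {w\<in>space M. snd (snd (Z1 t w)) \<noteq> snd (snd (Z1 0 w))} \<union> {w\<in>space M. snd (snd (Z2 t w)) \<noteq> snd (snd (Z2 0 w))}"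
  note J1 = expected_jumps[OF sol(1) t0] and J2 = expected_jumps[OF sol(2) t0]
  have J: "J \<in> events" "prob J \<le> 8 * rate_bound * t"
  proof -
    show "J \<in> events" unfolding J_def using J1(1) J2(1) by (rule sets.Un)
    have "prob J \<le> prob {w\<in>space M. snd (snd (Z1 t w)) \<noteq> snd (snd (Z1 0 w))} + prob {w\<in>space M. snd (snd (Z2 t w)) \<noteq> snd (snd (Z2 0 w))}"
      unfolding J_def using J1(1) J2(1) by (rule measure_Un_le)
    then show "prob J \<le> 8 * rate_bound * t" using J1(2) J2(2) by linarith
  qed
  have K: "\<bar>det_comp t\<bar> \<le> ?C"
    unfolding det_comp_def by (rule set_integral_abs_le[OF det_jump_section_bound[OF t0] C0])
  \<comment> \<open>If neither component has jumped by time \<open>t\<close>, both left limits lie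
    on the flow and the compensator is deterministic; on the event \<open>J\<close> each of the two
    integrals is at most \<open>?C\<close>.\<close>
  have 2: "AE w in M. \<bar>compensator f t w - det_comp t\<bar> \<le> indicator J w * (2 * ?C)"
    using regular_AE[OF sol(1)] regular_AE[OF sol(2)] AE_space
  proof eventually_elim
    case (elim w)
    have r: "regular Z1 w" "regular Z2 w" using elim by auto
    interpret p1: jump_path lam prec "P w" "\<lambda>t. Z1 t w" using r by (simp add: regular_def)
    interpret p2: jump_path lam prec "P w" "\<lambda>t. Z2 t w" using r by (simp add: regular_def)
    show ?case
    proof (cases "w \<in> J")
      case True
      have "\<bar>compensator f t w\<bar> \<le> ?C"
        unfolding compensator_def by (rule set_integral_abs_le[OF fb[OF r] C0])
      then show ?thesis using K True by simp
    next
      case False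
      then have c: "p1.cnt t = p1.cnt 0" "p2.cnt t = p2.cnt 0" using elim(3) by (auto simp: J_def)
      have "f (w, p) = det_jump \<phi> t z1 z2 p" if p: "p \<in> strip t" for p
      proof -
        have u: "0 < fst p" "fst p \<le> t" using p by auto
        have "pre Z1 (w, p) = flow (fst p) z1" "pre Z2 (w, p) = flow (fst p) z2"
          using p1.no_jump_path(2)[of "fst p" t] p2.no_jump_path(2)[of "fst p" t] u c elim
            pre_zl[OF r(1), of "fst p" "snd p"] pre_zl[OF r(2), of "fst p" "snd p"] by simp_all
        then show ?thesis using u by (simp add: f_def jump_fun_def det_jump_def \<rho>_def Let_def)
      qed
      then have "compensator f t w = det_comp t"
        unfolding compensator_def det_comp_def
        by (intro set_lebesgue_integral_cong) (use strip_m2 in auto)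
      then show ?thesis using False by simp
    qed
  qed
  have ic: "integrable M (compensator f t)" by (rule compensator_integrable[OF fm t0 ff])
  have ij: "integrable M (jump_integral f t)" by (rule jump_integral_integrable[OF fm t0 ff])
  have "(LINT w|M. \<phi> (Z1 t w, Z2 t w)) - \<phi> (flow t z1, flow t z2) = (LINT w|M. \<phi> (Z1 t w, Z2 t w) - \<phi> (flow t z1, flow t z2))"
    using test_integrable[OF t0] by (simp add: prob_space)
  also have "\<dots> = (LINT w|M. jump_integral f t w)"
    by (rule integral_cong_AE) (use 1 test_integrable[OF t0] ij in auto)
  also have "\<dots> = (LINT w|M. compensator f t w)" by (rule expectation_jump_integral[OF fm t0 ff])
  finally have "(LINT w|M. \<phi> (Z1 t w, Z2 t w)) - \<phi> (flow t z1, flow t z2) - det_comp t = (LINT w|M. compensator f t w - det_comp t)"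
    using ic by (simp add: prob_space)
  also have "\<bar>\<dots>\<bar> \<le> (LINT w|M. \<bar>compensator f t w - det_comp t\<bar>)"
    by (rule integral_abs_bound)
  also have "\<dots> \<le> (LINT w|M. indicator J w * (2 * ?C))"
  proof (rule integral_mono_AE[OF _ _ 2])
    show "integrable M (\<lambda>w. \<bar>compensator f t w - det_comp t\<bar>)" using ic by simp
    show "integrable M (\<lambda>w. indicat_real J w * (2 * ?C))"
      by (intro integrable_mult_left integrable_real_indicator J(1)) (simp add: emeasure_eq_measure)
  qed
  also have "\<dots> = prob J * (2 * ?C)" using J(1) by (simp add: sets.Int_space_eq2)
  \<comment> \<open>The constant is 8 from the jump probability of two components, 2 from the two
    integrals and 4 from \<open>?C\<close>; both factors are linear in \<open>t\<close>.\<close>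
  also have "\<dots> \<le> (8 * rate_bound * t) * (2 * ?C)"
    using J(2) C0 by (intro mult_right_mono) auto
  also have "\<dots> = 64 * B * rate_bound\<^sup>2 * t\<^sup>2" by (simp add: power2_eq_square)
  finally show ?thesis .
qed

text \<open>Fubini brings the time integral inside, so that the average over time is taken at a
  fixed mark, where the density argument applies.\<close>

lemma det_comp_error:
  assumes t: "0 < t" and g: "z1 \<in> good_states" "z2 \<in> good_states"
  shows "ennreal \<bar>det_comp t / t - (LINT v|lborel. jump_diff \<phi> z1 z2 v)\<bar> \<le>
    (\<integral>\<^sup>+v. ennreal (1 / t) * (\<integral>\<^sup>+u. ennreal \<bar>det_jump \<phi> t z1 z2 (u, v) - jump_diff \<phi> z1 z2 v\<bar> * indicator {0<..t} u \<partial>lborel) \<partial>lborel)"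
proof -
  let ?D = "jump_diff \<phi> z1 z2" and ?G = "det_jump \<phi> t z1 z2"
  let ?I = "LINT v|lborel. ?D v"
  have t0: "0 \<le> t" using t by simp
  have Gm: "?G \<in> borel_measurable borel"
    using det_jump_measurable[OF B cont z] by (simp add: borel_prod)
  have Dm: "(\<lambda>p::real \<times> real. ?D (snd p)) \<in> borel_measurable borel"
    by (rule measurable_compose[OF _ jump_diff_measurable[OF B cont z]]) (simp flip: borel_prod)
  have b2: "f \<in> borel_measurable borel \<Longrightarrow> (\<lambda>p. indicator (strip t) p *\<^sub>R f p) \<in> borel_measurable m2" for f :: "real \<times> real \<Rightarrow> real"
    unfolding m2_def by (intro measurable_restrict_space1 borel_measurable_scaleR borel_measurable_indicator) (auto simp flip: borel_prod)
  have fin: "set_integrable m2 (strip t) f"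
    if "f \<in> borel_measurable borel" "(\<integral>\<^sup>+p. ennreal \<bar>f p\<bar> * indicator (strip t) p \<partial>m2) < \<infinity>" for f :: "real \<times> real \<Rightarrow> real"
  proof -
    have "(\<integral>\<^sup>+p. ennreal (norm (indicator (strip t) p *\<^sub>R f p)) \<partial>m2) = (\<integral>\<^sup>+p. ennreal \<bar>f p\<bar> * indicator (strip t) p \<partial>m2)"
      by (rule nn_integral_cong) (auto simp: indicator_def)
    then show ?thesis
      unfolding set_integrable_def integrable_iff_bounded using b2[OF that(1)] that(2) by simp
  qed
  have iG: "set_integrable m2 (strip t) ?G"
    by (rule fin[OF Gm le_less_trans[OF det_jump_section_bound[OF t0]]]) simp
  have iD: "set_integrable m2 (strip t) (\<lambda>p. ?D (snd p))"
  proof (rule fin[OF Dm])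
    have "(\<integral>\<^sup>+p. ennreal \<bar>?D (snd p)\<bar> * indicator (strip t) p \<partial>m2) =
      (\<integral>\<^sup>+u. (\<integral>\<^sup>+v. ennreal \<bar>?D v\<bar> \<partial>lborel) * indicator {0<..t} u \<partial>lborel)"
      by (subst m2_nn_integral, rule measurable_compose[OF Dm]) measurable
    also have "\<dots> \<le> (\<integral>\<^sup>+u. ennreal (4 * B * rate_bound) * indicator {0<..t} u \<partial>lborel)"
      by (intro nn_integral_mono mult_right_mono jump_diff_nn_integral[OF g B]) simp
    also have "\<dots> < \<infinity>" using t by (simp add: nn_integral_cmult_indicator ennreal_mult_less_top)
    finally show "(\<integral>\<^sup>+p. ennreal \<bar>?D (snd p)\<bar> * indicator (strip t) p \<partial>m2) < \<infinity>" .
  qed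
  have "(LINT p:strip t|m2. ?D (snd p)) = (LINT u:{0..t}|lebesgue. ?I)"
    using m2_set_integral(2)[OF iD t0] by simp
  also have "\<dots> = t * ?I"
    unfolding set_lebesgue_integral_def using t by simp
  finally have D: "(LINT p:strip t|m2. ?D (snd p)) = t * ?I" .
  have "det_comp t - t * ?I = (LINT p:strip t|m2. ?G p - ?D (snd p))"
    unfolding det_comp_def D[symmetric] by (rule set_integral_diff(2)[OF iG iD, symmetric])
  also have "ennreal \<bar>\<dots>\<bar> \<le> (\<integral>\<^sup>+p. ennreal (norm (indicator (strip t) p *\<^sub>R (?G p - ?D (snd p)))) \<partial>m2)"
    using integral_norm_bound_ennreal[OF set_integral_diff(1)[OF iG iD, unfolded set_integrable_def]]
    by (simp add: set_lebesgue_integral_def)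
  also have "\<dots> = (\<integral>\<^sup>+p. ennreal \<bar>?G p - ?D (snd p)\<bar> * indicator (strip t) p \<partial>m2)"
    by (rule nn_integral_cong) (auto simp: indicator_def)
  also have "\<dots> = (\<integral>\<^sup>+u. (\<integral>\<^sup>+v. ennreal \<bar>?G (u, v) - ?D v\<bar> \<partial>lborel) * indicator {0<..t} u \<partial>lborel)"
  proof -
    have "(\<lambda>p. ?G p - ?D (snd p)) \<in> borel_measurable borel" using Gm Dm by (rule borel_measurable_diff)
    then have "(\<lambda>p. ennreal \<bar>?G p - ?D (snd p)\<bar>) \<in> borel_measurable borel"
      by (rule measurable_compose) measurable
    from m2_nn_integral[OF this] show ?thesis by simp
  qed
  also have "\<dots> = (\<integral>\<^sup>+u. \<integral>\<^sup>+v. ennreal \<bar>?G (u, v) - ?D v\<bar> * indicator {0<..t} u \<partial>lborel \<partial>lborel)"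
    by (rule nn_integral_cong) (auto simp: indicator_def)
  also have "\<dots> = (\<integral>\<^sup>+v. \<integral>\<^sup>+u. ennreal \<bar>?G (u, v) - ?D v\<bar> * indicator {0<..t} u \<partial>lborel \<partial>lborel)"
  proof (rule lborel_pair.Fubini'[symmetric])
    have "(\<lambda>p. ?G p - ?D (snd p)) \<in> borel_measurable (lborel \<Otimes>\<^sub>M lborel)"
      using borel_measurable_diff[OF Gm Dm] by (simp add: lborel_prod)
    then show "(\<lambda>(u, v). ennreal \<bar>?G (u, v) - ?D v\<bar> * indicator {0<..t} u) \<in> borel_measurable (lborel \<Otimes>\<^sub>M lborel)"
      unfolding split_beta by simp measurable
  qed
  finally have e: "ennreal \<bar>det_comp t - t * ?I\<bar> \<le> (\<integral>\<^sup>+v. \<integral>\<^sup>+u. ennreal \<bar>?G (u, v) - ?D v\<bar> * indicator {0<..t} u \<partial>lborel \<partial>lborel)" .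
  have "\<bar>det_comp t / t - ?I\<bar> = 1 / t * \<bar>det_comp t - t * ?I\<bar>"
    using t by (simp add: abs_mult[symmetric] field_simps abs_if)
  then have "ennreal \<bar>det_comp t / t - ?I\<bar> = ennreal (1 / t) * ennreal \<bar>det_comp t - t * ?I\<bar>"
    using t by (simp only:) (rule ennreal_mult', simp)
  also have "\<dots> \<le> ennreal (1 / t) * (\<integral>\<^sup>+v. \<integral>\<^sup>+u. ennreal \<bar>?G (u, v) - ?D v\<bar> * indicator {0<..t} u \<partial>lborel \<partial>lborel)"
    by (rule mult_left_mono[OF e]) simp
  also have "\<dots> = (\<integral>\<^sup>+v. ennreal (1 / t) * (\<integral>\<^sup>+u. ennreal \<bar>?G (u, v) - ?D v\<bar> * indicator {0<..t} u \<partial>lborel) \<partial>lborel)"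
    by (rule nn_integral_cmult[symmetric]) (rule err_measurable[OF B cont z])
  finally show ?thesis .
qed

text \<open>The difference quotient is the sum of three parts: the quotient along the flow, which
  gives the derivatives, the averaged deterministic compensator, which gives the integral over the
  mark, and the Duhamel remainder, which is of order \<open>t\<close>.\<close>

lemma generator_at:
  assumes \<phi>: "\<phi> \<in> test_functions" and E: "regular_ages E" "fst (snd z1) \<notin> E" "fst (snd z2) \<notin> E"
  shows "generator_value M (\<lambda>t w. (Z1 t w, Z2 t w)) (z1, z2) \<phi>
    (dy1 \<phi> (z1, z2) + dy2 \<phi> (z1, z2) + (LINT v|lborel. jump_diff \<phi> z1 z2 v))"
  unfolding generator_value_def
proof (intro conjI allI impI)
  show "integrable M (\<lambda>w. \<phi> (Z1 t w, Z2 t w))" if "0 \<le> t" for t by (rule test_integrable[OF that])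
  have g: "z1 \<in> good_states" "z2 \<in> good_states"
    using E z unfolding regular_ages_def by (cases z1; cases z2; auto)+
  let ?I = "LINT v|lborel. jump_diff \<phi> z1 z2 v"
  let ?q = "dy1 \<phi> (z1, z2) + dy2 \<phi> (z1, z2)"
  let ?e = "\<lambda>t. LINT w|M. \<phi> (Z1 t w, Z2 t w)"
  have "((\<lambda>x. \<phi> (flow (x - 0) z1, flow (x - 0) z2)) has_vector_derivative ?q) (at 0 within {0..1})"
    using test_flow_derivative[OF \<phi> z, of 0 0 1] by simp
  then have "((\<lambda>t. \<phi> (flow t z1, flow t z2)) has_field_derivative ?q) (at 0 within {0..1})"
    by (simp add: has_real_derivative_iff_has_vector_derivative)
  then have d: "((\<lambda>t. (\<phi> (flow t z1, flow t z2) - \<phi> (z1, z2)) / t) \<longlongrightarrow> ?q) (at_right 0)"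
    by (simp add: has_field_derivative_iff at_within_Icc_at_right)
  show "((\<lambda>t. (?e t - \<phi> (z1, z2)) / t) \<longlongrightarrow> ?q + ?I) (at_right 0)"
    unfolding tendsto_at_iff_sequentially comp_def
  proof (intro allI impI)
    fix \<tau> :: "nat \<Rightarrow> real" assume \<tau>: "\<forall>k. \<tau> k \<in> {0<..} - {0}" "\<tau> \<longlonglongrightarrow> 0"
    then have \<tau>0: "0 < \<tau> k" for k by simp
    have 1: "(\<lambda>k. (\<phi> (flow (\<tau> k) z1, flow (\<tau> k) z2) - \<phi> (z1, z2)) / \<tau> k) \<longlonglongrightarrow> ?q"
      using d \<tau> unfolding tendsto_at_iff_sequentially comp_def by blast
    have "(\<lambda>k. ennreal \<bar>det_comp (\<tau> k) / \<tau> k - ?I\<bar>) \<longlonglongrightarrow> 0"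
    proof (rule tendsto_sandwich[OF _ _ tendsto_const err_limit[OF B cont z E \<tau>0 \<tau>(2)]])
      show "\<forall>\<^sub>F k in sequentially. ennreal \<bar>det_comp (\<tau> k) / \<tau> k - ?I\<bar> \<le>
        (\<integral>\<^sup>+v. ennreal (1 / \<tau> k) * (\<integral>\<^sup>+u. ennreal \<bar>det_jump \<phi> (\<tau> k) z1 z2 (u, v) - jump_diff \<phi> z1 z2 v\<bar> * indicator {0<..\<tau> k} u \<partial>lborel) \<partial>lborel)"
        by (intro always_eventually allI det_comp_error \<tau>0 g)
    qed simp
    then have "(\<lambda>k. \<bar>det_comp (\<tau> k) / \<tau> k - ?I\<bar>) \<longlonglongrightarrow> 0"
      using tendsto_ennrealD[of "\<lambda>k. \<bar>det_comp (\<tau> k) / \<tau> k - ?I\<bar>" 0 sequentially] by simp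
    then have 2: "(\<lambda>k. det_comp (\<tau> k) / \<tau> k) \<longlonglongrightarrow> ?I"
      by (simp add: tendsto_rabs_zero_iff LIM_zero_iff)
    let ?R = "\<lambda>t. ?e t - \<phi> (flow t z1, flow t z2) - det_comp t"
    have 3: "(\<lambda>k. ?R (\<tau> k) / \<tau> k) \<longlonglongrightarrow> 0"
    proof (rule Lim_null_comparison)
      show "\<forall>\<^sub>F k in sequentially. norm (?R (\<tau> k) / \<tau> k) \<le> 64 * B * rate_bound\<^sup>2 * \<tau> k"
      proof (intro always_eventually allI)
        fix k
        have "norm (?R (\<tau> k) / \<tau> k) = \<bar>?R (\<tau> k)\<bar> / \<tau> k" using \<tau>0[of k] by simp
        also have "\<dots> \<le> 64 * B * rate_bound\<^sup>2 * (\<tau> k)\<^sup>2 / \<tau> k"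
          using \<tau>0[of k] by (intro divide_right_mono duhamel) auto
        also have "\<dots> = 64 * B * rate_bound\<^sup>2 * \<tau> k" using \<tau>0[of k] by (simp add: power2_eq_square)
        finally show "norm (?R (\<tau> k) / \<tau> k) \<le> 64 * B * rate_bound\<^sup>2 * \<tau> k" .
      qed
      show "(\<lambda>k. 64 * B * rate_bound\<^sup>2 * \<tau> k) \<longlonglongrightarrow> 0"
        using tendsto_mult_right_zero[OF \<tau>(2)] by simp
    qed
    have "(\<lambda>k. (\<phi> (flow (\<tau> k) z1, flow (\<tau> k) z2) - \<phi> (z1, z2)) / \<tau> k + det_comp (\<tau> k) / \<tau> k + ?R (\<tau> k) / \<tau> k) \<longlonglongrightarrow> ?q + ?I + 0"
      by (intro tendsto_add 1 2 3)
    moreover have "(\<phi> (flow t z1, flow t z2) - \<phi> (z1, z2)) / t + det_comp t / t + ?R t / t = (?e t - \<phi> (z1, z2)) / t" for t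
      by (simp add: diff_divide_distrib)
    ultimately show "(\<lambda>k. (?e (\<tau> k) - \<phi> (z1, z2)) / \<tau> k) \<longlonglongrightarrow> ?q + ?I" by simp
  qed
qed

end

end

section \<open>Extended and pointwise generator of the augmented process\<close>

theorem theorem4p3:
  fixes M :: "'w measure"
    and F :: "real \<Rightarrow> 'w measure"
    and P :: "'w \<Rightarrow> (real \<times> real) measure"
    and lam :: rates
    and prec :: "nat rel"
  assumes "prob_space M"
    and "usual_filtration M F"
    and "adapted_prm M F P"
    and "strict_linear_order_on XX prec"
    and "rate_functions lam"
    and "A1 lam"
    and "A2 lam"
    and "intervals_well_defined lam prec"
  shows
    "(\<forall>Z01 Z02 Z1 Z2.
        strong_solution M F lam prec P Z01 Z1 \<longrightarrow> strong_solution M F lam prec P Z02 Z2 \<longrightarrow>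
        extended_generator M F (\<lambda>t w. (Z1 t w, Z2 t w)) test_functions (gen_integral lam prec) \<and>
        extended_generator M F (\<lambda>t w. (Z1 t w, Z2 t w)) test_functions (gen_sum lam))
     \<and>
     (\<exists>E\<in>null_sets lborel. \<forall>i1\<in>XX. \<forall>i2\<in>XX. \<forall>n1 n2. \<forall>y1\<in>{0..} - E. \<forall>y2\<in>{0..} - E.
        \<forall>\<phi>\<in>test_functions. let z1 = (i1, y1, n1); z2 = (i2, y2, n2) in
          gen_integral lam prec \<phi> (z1, z2) = gen_sum lam \<phi> (z1, z2) \<and>
          (\<forall>Z1 Z2.
             strong_solution M F lam prec P (\<lambda>_. z1) Z1 \<longrightarrow>
             strong_solution M F lam prec P (\<lambda>_. z2) Z2 \<longrightarrow>
             generator_value M (\<lambda>t w. (Z1 t w, Z2 t w)) (z1, z2) \<phi>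
               (gen_integral lam prec \<phi> (z1, z2))))"
proof -
  interpret prob_space M by fact
  interpret prm_jumps M F P lam prec
    by unfold_locales (use assms in auto)
  have I: "gen_integral lam prec \<phi> (z1, z2) = dy1 \<phi> (z1, z2) + dy2 \<phi> (z1, z2) + (LINT v|lborel. jump_diff \<phi> z1 z2 v)"
    if "z1 \<in> good_states" "z2 \<in> good_states" for \<phi> z1 z2
    using gen_integral_eq that good_states_subset by blast
  have S: "gen_sum lam \<phi> (z1, z2) = gen_integral lam prec \<phi> (z1, z2)"
    if "\<phi> \<in> test_functions" "z1 \<in> good_states" "z2 \<in> good_states" for \<phi> z1 z2
    using test_bounded[OF that(1)] gen_sum_eq[OF that(2,3)] by metis
  \<comment> \<open>Regularity of \<open>E\<close> includes \<open>bad_ages \<subseteq> E\<close>,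
    so the same null set serves the equality of the two forms and the limit of the difference
    quotient.\<close>
  obtain E where E: "E \<in> null_sets lborel" "regular_ages E" using regular_ages_exist by blast
  have "gen_integral lam prec \<phi> (z1, z2) = gen_sum lam \<phi> (z1, z2) \<and>
      (strong_solution M F lam prec P (\<lambda>_. z1) Z1 \<longrightarrow> strong_solution M F lam prec P (\<lambda>_. z2) Z2 \<longrightarrow>
       generator_value M (\<lambda>t w. (Z1 t w, Z2 t w)) (z1, z2) \<phi> (gen_integral lam prec \<phi> (z1, z2)))"
    if z: "z1 \<in> states" "z2 \<in> states" "fst (snd z1) \<notin> E" "fst (snd z2) \<notin> E" and \<phi>: "\<phi> \<in> test_functions"
    for z1 z2 \<phi> Z1 Z2
  proof -
    have g: "z1 \<in> good_states" "z2 \<in> good_states"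
      using E(2) z unfolding regular_ages_def by (cases z1; cases z2; auto)+
    obtain B where B: "bounded_on_states \<phi> B" using test_bounded[OF \<phi>] .
    show ?thesis
      using generator_at[OF _ _ z(1,2) B test_continuous[OF \<phi>] \<phi> E(2) z(3,4)] S[OF \<phi> g] I[OF g] by simp
  qed
  note part2 = this
  show ?thesis
  proof (intro conjI allI impI)
    fix Z01 Z02 Z1 Z2
    assume sol: "strong_solution M F lam prec P Z01 Z1" "strong_solution M F lam prec P Z02 Z2"
    show "extended_generator M F (\<lambda>t w. (Z1 t w, Z2 t w)) test_functions (gen_integral lam prec)"
      by (rule coupled_extended_generator[OF sol I])
    show "extended_generator M F (\<lambda>t w. (Z1 t w, Z2 t w)) test_functions (gen_sum lam)"
      by (rule coupled_extended_generator[OF sol]) (simp add: S I)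
  next
    show "\<exists>E\<in>null_sets lborel. \<forall>i1\<in>XX. \<forall>i2\<in>XX. \<forall>n1 n2. \<forall>y1\<in>{0..} - E. \<forall>y2\<in>{0..} - E.
        \<forall>\<phi>\<in>test_functions. let z1 = (i1, y1, n1); z2 = (i2, y2, n2) in
          gen_integral lam prec \<phi> (z1, z2) = gen_sum lam \<phi> (z1, z2) \<and>
          (\<forall>Z1 Z2.
             strong_solution M F lam prec P (\<lambda>_. z1) Z1 \<longrightarrow>
             strong_solution M F lam prec P (\<lambda>_. z2) Z2 \<longrightarrow>
             generator_value M (\<lambda>t w. (Z1 t w, Z2 t w)) (z1, z2) \<phi>
               (gen_integral lam prec \<phi> (z1, z2)))"
      unfolding Let_def
    proof (intro bexI[OF _ E(1)] ballI allI)
      fix i1 i2 n1 n2 y1 y2 \<phi>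
      assume "i1 \<in> XX" "i2 \<in> XX" "y1 \<in> {0..} - E" "y2 \<in> {0..} - E" and \<phi>: "\<phi> \<in> test_functions"
      then have "(i1, y1, n1) \<in> states" "(i2, y2, n2) \<in> states" "fst (snd (i1, y1, n1)) \<notin> E" "fst (snd (i2, y2, n2)) \<notin> E"
        by auto
      from part2[OF this \<phi>]
      show "gen_integral lam prec \<phi> ((i1, y1, n1), i2, y2, n2) = gen_sum lam \<phi> ((i1, y1, n1), i2, y2, n2) \<and>
          (\<forall>Z1 Z2.
             strong_solution M F lam prec P (\<lambda>_. (i1, y1, n1)) Z1 \<longrightarrow>
             strong_solution M F lam prec P (\<lambda>_. (i2, y2, n2)) Z2 \<longrightarrow>
             generator_value M (\<lambda>t w. (Z1 t w, Z2 t w)) ((i1, y1, n1), i2, y2, n2) \<phi>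
               (gen_integral lam prec \<phi> ((i1, y1, n1), i2, y2, n2)))"
        by blast
    qed
  qed
qed

end
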